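(* Let $C$ be any compact subset of $\mathring{\Theta}$ and let the true parameter $\theta_0$ belong to the interior $\mathring{C}$ of $C$. Let $k\ge 2$ be fixed, and suppose that the evaluation points $(u_1,\ldots,u_k)\in\mathbb{R}^k$ satisfy $|u_i|\neq|u_j|$ for $i\neq j$ and $u_i\neq 0$ for all $i$. Let $X_1,X_2,\ldots$ be i.i.d. with density $f(\cdot;\theta_0)$. Then the probability that the equation $\widetilde S_n(\theta)=0$ has at least one root $\theta\in C$ tends to $1$ as $n\to\infty$, and there exists a sequence of roots $\hat\theta_n$ such that $\hat\theta_n\to\theta_0$ in probability. Moreover, every consistent sequence of roots $\hat\theta_n$ (i.e. every sequence of roots with $\hat\theta_n\to\theta_0$ in probability) satisfies \[ \sqrt{n}\,(\hat\theta_n-\theta_0)=\widetilde I(\theta_0)^{-1}\frac{1}{\sqrt n}\sum_{j=1}^n\widetilde S(X_j;\theta_0)+o_p(1). \] In particular, the sequence $\sqrt n\,(\hat\theta_n-\theta_0)$ is asymptotically normal with mean zero and covariance matrix $\widetilde I(\theta_0)^{-1}$.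
   Context: Stable law. The parameter is $\theta=(\mu,\sigma,\alpha,\beta)^\top\in\Theta=\mathbb{R}\times(0,\infty)\times(0,2]\times[-1,1]$, and $\mathring{\Theta}=\mathbb{R}\times(0,\infty)\times(0,2)\times(-1,1)$ is the interior. The stable distribution with parameter $\theta$ has characteristic function \[ \varphi(u;\theta)=\exp\Big(-|\sigma u|^\alpha\big\{1+i\beta\,\mathrm{sign}(u)\tan\tfrac{\pi\alpha}{2}\,(|\sigma u|^{1-\alpha}-1)\big\}+i\mu u\Big)\quad(\alpha\neq1), \] \[ \varphi(u;\theta)=\exp\Big(-|\sigma u|-i\sigma u\,(2\beta/\pi)\log|\sigma u|+i\mu u\Big)\quad(\alpha=1) \] (this is a continuous parametrization, also across $\alpha=1$), and $f(x;\theta)$ denotes its density. $\mathbb{E}_\theta$ is expectation when $X$ has density $f(\cdot;\theta)$. Write $\varphi^R,\varphi^I$ for the real and imaginary parts of $\varphi$. A subscript $\theta$ on a function denotes its vector of partial derivatives with respect to the four components of $\theta$ (a column). Trigonometrically approximated score. For evaluation points $u_1,\ldots,u_k$ put \[ g(x)=(\cos(u_1x),\ldots,\cos(u_kx),\sin(u_1x),\ldots,\sin(u_kx))^\top, \] \[ \gamma(\theta)=\mathbb{E}_\theta[g(X)]=(\varphi^R(u_1;\theta),\ldots,\varphi^R(u_k;\theta),\varphi^I(u_1;\theta),\ldots,\varphi^I(u_k;\theta))^\top, \] \[ \gamma_\theta(\theta)=(\varphi^R_\theta(u_1;\theta),\ldots,\varphi^R_\theta(u_k;\theta),\varphi^I_\theta(u_1;\theta),\ldots,\varphi^I_\theta(u_k;\theta))\quad(4\times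 2k\text{ matrix}), \] $\Sigma(\theta)=\mathbb{E}_\theta[(g(X)-\gamma(\theta))(g(X)-\gamma(\theta))^\top]$, and \[ \widetilde S(x;\theta)=\gamma_\theta(\theta)\,\Sigma(\theta)^{-1}(g(x)-\gamma(\theta)),\qquad \widetilde I(\theta)=\gamma_\theta(\theta)\Sigma(\theta)^{-1}\gamma_\theta(\theta)^\top . \] For a sample $X_1,\ldots,X_n$, $\widetilde S_n(\theta)=\frac1n\sum_{j=1}^n\widetilde S(X_j;\theta)$. Roots of $\widetilde S_n(\theta)=0$ are sought in $C$. $o_p(1)$ and convergence in probability are under $\theta_0$, as $n\to\infty$. *)

theory Defs
  imports "HOL-Probability.Probability"
begin

text \<open>
  A parameter \<open>\<theta> = (\<mu>, \<sigma>, \<alpha>, \<beta>)\<close> is a vector in \<open>real ^ 4\<close>, in this order of components. In the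
  numeral type \<open>4\<close> the index written \<open>4\<close> is the same element as \<open>0\<close>; the indices 1, 2, 3, 4 are
  pairwise distinct and exhaust the type.
\<close>

definition stable_param_interior :: "(real ^ 4) set" where
  "stable_param_interior = {\<theta>. \<theta> $ 2 > 0 \<and> 0 < \<theta> $ 3 \<and> \<theta> $ 3 < 2 \<and> -1 < \<theta> $ 4 \<and> \<theta> $ 4 < 1}"

text \<open>
  At \<open>u = 0\<close> the conventions \<open>0 powr a = 0\<close> and \<open>ln 0 = 0\<close> give the value 1 in both branches.
\<close>

definition stable_cf :: "real ^ 4 \<Rightarrow> real \<Rightarrow> complex" where
  "stable_cf \<theta> u =
     (let \<mu> = \<theta> $ 1; \<sigma> = \<theta> $ 2; \<alpha> = \<theta> $ 3; \<beta> = \<theta> $ 4 in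
      if \<alpha> \<noteq> 1 then
        exp (- complex_of_real (\<bar>\<sigma> * u\<bar> powr \<alpha>) *
               (1 + \<i> * complex_of_real
                      (\<beta> * sgn u * tan (pi * \<alpha> / 2) * (\<bar>\<sigma> * u\<bar> powr (1 - \<alpha>) - 1)))
             + \<i> * complex_of_real (\<mu> * u))
      else
        exp (- complex_of_real \<bar>\<sigma> * u\<bar>
             - \<i> * complex_of_real (\<sigma> * u * (2 * \<beta> / pi) * ln \<bar>\<sigma> * u\<bar>)
             + \<i> * complex_of_real (\<mu> * u)))"

text \<open>
  A density of the stable law, i.e. of the distribution with characteristic function
  \<open>stable_cf \<theta>\<close>. It is determined up to a Lebesgue null set, and it is only used through the
  measure \<open>density lborel f\<close>, which does not depend on the version chosen.
\<close>

definition stable_density :: "real ^ 4 \<Rightarrow> real \<Rightarrow> real" where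
  "stable_density \<theta> =
     (SOME f. f \<in> borel_measurable borel \<and> (\<forall>x. 0 \<le> f x) \<and>
        real_distribution (density lborel (\<lambda>x. ennreal (f x))) \<and>
        char (density lborel (\<lambda>x. ennreal (f x))) = stable_cf \<theta>)"

definition stable_expectation ::
    "real ^ 4 \<Rightarrow> (real \<Rightarrow> 'b::{banach, second_countable_topology}) \<Rightarrow> 'b" where
  "stable_expectation \<theta> h = (\<integral>x. h x \<partial>density lborel (\<lambda>x. ennreal (stable_density \<theta> x)))"

text \<open>
  The evaluation points are \<open>u :: real ^ 'k\<close> with \<open>k = CARD('k)\<close>. Vectors with \<open>2k\<close> entries are
  indexed by \<open>'k + 'k\<close>: \<open>Inl j\<close> for the cosine (real) entries, \<open>Inr j\<close> for the sine (imaginary) ones.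
\<close>

definition trig_vec :: "real ^ 'k \<Rightarrow> real \<Rightarrow> real ^ ('k::finite + 'k)" where
  "trig_vec u x = (\<chi> i. case i of Inl j \<Rightarrow> cos (u $ j * x) | Inr j \<Rightarrow> sin (u $ j * x))"

definition trig_mean :: "real ^ 'k \<Rightarrow> real ^ 4 \<Rightarrow> real ^ ('k::finite + 'k)" where
  "trig_mean u \<theta> = stable_expectation \<theta> (trig_vec u)"

definition partial_deriv :: "4 \<Rightarrow> (real ^ 4 \<Rightarrow> real) \<Rightarrow> real ^ 4 \<Rightarrow> real" where
  "partial_deriv l F \<theta> = deriv (\<lambda>t. F (\<theta> + t *\<^sub>R axis l 1)) 0"

text \<open>Four rows and \<open>2k\<close> columns.\<close>

definition trig_mean_deriv :: "real ^ 'k \<Rightarrow> real ^ 4 \<Rightarrow> real ^ ('k::finite + 'k) ^ 4" where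
  "trig_mean_deriv u \<theta> =
     (\<chi> l i. case i of Inl j \<Rightarrow> partial_deriv l (\<lambda>\<theta>. Re (stable_cf \<theta> (u $ j))) \<theta>
                     | Inr j \<Rightarrow> partial_deriv l (\<lambda>\<theta>. Im (stable_cf \<theta> (u $ j))) \<theta>)"

definition trig_cov :: "real ^ 'k \<Rightarrow> real ^ 4 \<Rightarrow> real ^ ('k::finite + 'k) ^ ('k + 'k)" where
  "trig_cov u \<theta> =
     (\<chi> i j. stable_expectation \<theta>
        (\<lambda>x. (trig_vec u x - trig_mean u \<theta>) $ i * (trig_vec u x - trig_mean u \<theta>) $ j))"

definition trig_score :: "real ^ 'k::finite \<Rightarrow> real \<Rightarrow> real ^ 4 \<Rightarrow> real ^ 4" where
  "trig_score u x \<theta> =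
     (trig_mean_deriv u \<theta> ** matrix_inv (trig_cov u \<theta>)) *v (trig_vec u x - trig_mean u \<theta>)"

definition trig_info :: "real ^ 'k::finite \<Rightarrow> real ^ 4 \<Rightarrow> real ^ 4 ^ 4" where
  "trig_info u \<theta> =
     trig_mean_deriv u \<theta> ** matrix_inv (trig_cov u \<theta>) ** transpose (trig_mean_deriv u \<theta>)"

text \<open>The sample \<open>X\<^sub>1, \<dots>, X\<^sub>n\<close> is represented by \<open>x 0, \<dots>, x (n - 1)\<close>.\<close>

definition mean_score :: "real ^ 'k::finite \<Rightarrow> (nat \<Rightarrow> real) \<Rightarrow> nat \<Rightarrow> real ^ 4 \<Rightarrow> real ^ 4" where
  "mean_score u x n \<theta> = (1 / real n) *\<^sub>R (\<Sum>j<n. trig_score u (x j) \<theta>)"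

definition tendsto_in_prob ::
    "'w measure \<Rightarrow> (nat \<Rightarrow> 'w \<Rightarrow> 'b::metric_space) \<Rightarrow> 'b \<Rightarrow> bool" where
  "tendsto_in_prob M Y c \<longleftrightarrow>
     (\<forall>\<epsilon>>0. (\<lambda>n. measure M {\<omega> \<in> space M. dist (Y n \<omega>) c > \<epsilon>}) \<longlonglongrightarrow> 0)"

text \<open>The normal distribution with mean \<open>m\<close> and positive definite covariance matrix \<open>V\<close>.\<close>

definition mv_normal :: "real ^ 'd \<Rightarrow> real ^ 'd ^ 'd \<Rightarrow> (real ^ 'd::finite) measure" where
  "mv_normal m V = density lborel (\<lambda>z. ennreal
     (exp (- ((z - m) \<bullet> (matrix_inv V *v (z - m))) / 2) / sqrt ((2 * pi) ^ CARD('d) * det V)))"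

text \<open>
  Weak convergence of random elements to a probability measure; the library's \<open>weak_conv_m\<close>
  covers the real line only.
\<close>

definition tendsto_in_distribution ::
    "'w measure \<Rightarrow> (nat \<Rightarrow> 'w \<Rightarrow> 'b::metric_space) \<Rightarrow> 'b measure \<Rightarrow> bool" where
  "tendsto_in_distribution M Y N \<longleftrightarrow>
     (\<forall>h :: 'b \<Rightarrow> real. continuous_on UNIV h \<and> bounded (range h) \<longrightarrow>
        (\<lambda>n. \<integral>\<omega>. h (Y n \<omega>) \<partial>M) \<longlonglongrightarrow> (\<integral>z. h z \<partial>N))"

end

theory Submission
  imports Defs "HOL-Complex_Analysis.Complex_Analysis" "HOL-Real_Asymp.Real_Asymp"
begin

text \<open>
  The score has the form \<open>A(\<theta>) (y - \<gamma>(\<theta>))\<close> with \<open>y\<close> the sample mean of the bounded vectors \<open>g(X\<^sub>j)\<close>,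
  and \<open>A(\<theta>\<^sub>0)\<close> times the Jacobian of \<open>\<gamma>\<close> at \<open>\<theta>\<^sub>0\<close> is the information matrix. Since \<open>\<gamma>\<close> is continuously
  differentiable, also across \<open>\<alpha> = 1\<close>, Brouwer's theorem gives a root near \<open>\<theta>\<^sub>0\<close> as soon as \<open>y\<close> is near
  \<open>\<gamma>(\<theta>\<^sub>0)\<close>, and every root close to \<open>\<theta>\<^sub>0\<close> is linear in \<open>y - \<gamma>(\<theta>\<^sub>0)\<close> up to a relatively small error.
  Asymptotic normality then follows from the one-dimensional central limit theorem and the convergence
  of characteristic functions.

  That the stable density exists at all has to be proved. The functions whose product with any function
  of nonnegative (Gaussian-regularised) Fourier transform has again such a transform are closed under
  sums, products and bounded limits and contain the characters. For \<open>s = (1 - h\<^sup>2) exp (i h t)\<close> the power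
  series of \<open>1 - (1 - s) powr \<alpha>\<close> (\<open>\<alpha> < 1\<close>) and of \<open>(1 - s) powr \<alpha> + \<alpha> s - 1\<close> (\<open>1 < \<alpha> < 2\<close>) have nonnegative
  coefficients, so their suitably scaled exponentials belong to this class, and the limit \<open>h \<rightarrow> 0\<close>
  yields the totally skewed stable characteristic functions; the case \<open>\<alpha> = 1\<close> is a limit of \<open>\<alpha> \<noteq> 1\<close>.
\<close>

text \<open>The same infix is declared for coefficients of formal power series.\<close>

no_notation fps_nth (infixl "$" 75)

section \<open>Positive Fourier transforms and multipliers\<close>

text \<open>\<open>stable_density\<close> is an unspecified choice, so expectations under it become
  accessible only after existence is proved. From then on densities disappear: first and second
  moments of \<open>trig_vec\<close> are values of \<open>stable_cf\<close> at u_i, u_i + u_j and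
  u_i - u_j, and all regularity in the parameter is regularity of \<open>stable_cf\<close>. The
  obstacle there is \<alpha> = 1, where the tangent has a pole. In the exponent it meets a factor
  exp ((\<alpha> - 1) L) - 1 with L = ln (\<sigma> |u|), and the product has a removable
  singularity. The same exponent shows that the Jacobian has full rank: its real part separates
  \<sigma> from \<alpha>, its imaginary part \<mu> from \<beta>, as soon as two different values of
  L occur. The covariance matrix is nonsingular because a nontrivial trigonometric sum attains each
  value on a countable set only, which is null for a law with a density. Brouwer's theorem gives a
  root for each sample separately. A consistent sequence has to be a measurable function of the
  sample, hence the selection of a root closest to \<theta>0; being closest, it inherits the
  localisation of every root that Brouwer's theorem provides.\<close>

lemma borel_measurable_cis [measurable]: "cis \<in> borel_measurable borel"
  by (intro borel_measurable_continuous_onI continuous_intros)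

text \<open>This is the characteristic function of the standard normal law at x / e, after the
  substitution v = e u.\<close>

lemma gaussian_fourier:
  fixes e x :: real
  assumes "e > 0"
  shows "integrable lborel (\<lambda>u. exp (- (e * u)\<^sup>2 / 2))"
    and "(\<integral>u. cis (x * u) * of_real (exp (- (e * u)\<^sup>2 / 2)) \<partial>lborel)
           = of_real (sqrt (2 * pi) / e * exp (- (x / e)\<^sup>2 / 2))"
proof -
  have eq: "exp (- (e * u)\<^sup>2 / 2) = sqrt (2 * pi) * std_normal_density (e * u)" for u
    by (simp add: std_normal_density_def)
  have "integrable lborel (\<lambda>u. std_normal_density (0 + e * u))"
    using lborel_integrable_real_affine[OF integrable_normal_density, of 1 e 0 0] assms by simp
  then show "integrable lborel (\<lambda>u. exp (- (e * u)\<^sup>2 / 2))"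
    unfolding eq by simp
  have "complex_of_real (exp (- ((x/e)\<^sup>2) / 2)) = char std_normal_distribution (x / e)"
    by (simp add: char_std_normal_distribution)
  also have "\<dots> = (\<integral>v. std_normal_density v *\<^sub>R cis (x / e * v) \<partial>lborel)"
    unfolding char_def
    by (subst integral_density) (auto simp: cis_conv_exp)
  also have "\<dots> = \<bar>e\<bar> *\<^sub>R (\<integral>u. std_normal_density (0 + e * u) *\<^sub>R cis (x / e * (0 + e * u)) \<partial>lborel)"
    using assms by (intro lborel_integral_real_affine) auto
  also have "\<dots> = e *\<^sub>R (\<integral>u. std_normal_density (e * u) *\<^sub>R cis (x * u) \<partial>lborel)"
    using assms by simp
  also have "\<dots> = e *\<^sub>R (\<integral>u. (1 / sqrt (2 * pi)) *\<^sub>R (cis (x * u) * of_real (exp (- (e * u)\<^sup>2 / 2))) \<partial>lborel)"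
    unfolding eq by (simp add: scaleR_conv_of_real mult_ac)
  also have "\<dots> = e *\<^sub>R (1 / sqrt (2 * pi)) *\<^sub>R (\<integral>u. (cis (x * u) * of_real (exp (- (e * u)\<^sup>2 / 2))) \<partial>lborel)"
    by (simp only: integral_scaleR_right)
  finally show "(\<integral>u. cis (x * u) * of_real (exp (- (e * u)\<^sup>2 / 2)) \<partial>lborel)
           = of_real (sqrt (2 * pi) / e * exp (- (x / e)\<^sup>2 / 2))"
    using assms by (simp add: scaleR_conv_of_real field_simps)
qed

text \<open>The Gaussian factor makes the integral meaningful for every bounded measurable
  \<open>g\<close>, in particular for the constant 1, whose Fourier transform is not a function.
  Membership in \<open>\<real>\<^sub>\<ge>\<^sub>0\<close> expresses reality and nonnegativity at
  once.\<close>

definition fourier_nonneg :: "(real \<Rightarrow> complex) \<Rightarrow> bool" where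
  "fourier_nonneg g \<longleftrightarrow> g \<in> borel_measurable borel \<and> (\<exists>B. \<forall>u. norm (g u) \<le> B) \<and>
     (\<forall>e>0. \<forall>x. (\<integral>u. g u * (cis (x * u) * of_real (exp (- (e * u)\<^sup>2 / 2))) \<partial>lborel) \<in> \<real>\<^sub>\<ge>\<^sub>0)"

text \<open>Multipliers compose, so closure under products is immediate; for
  \<open>fourier_nonneg\<close> itself it would be a statement about convolutions of
  transforms.\<close>

definition fourier_multiplier :: "(real \<Rightarrow> complex) \<Rightarrow> bool" where
  "fourier_multiplier f \<longleftrightarrow> (\<forall>g. fourier_nonneg g \<longrightarrow> fourier_nonneg (\<lambda>u. f u * g u))"

lemma fourier_integrable:
  fixes g :: "real \<Rightarrow> complex"
  assumes "g \<in> borel_measurable borel" "\<And>u. norm (g u) \<le> B" "e > 0"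
  shows "integrable lborel (\<lambda>u. g u * (cis (x * u) * of_real (exp (- (e * u)\<^sup>2 / 2))))"
proof (rule Bochner_Integration.integrable_bound)
  show "integrable lborel (\<lambda>u. B * exp (- (e * u)\<^sup>2 / 2))"
    using gaussian_fourier(1)[OF \<open>e > 0\<close>] by simp
  have [measurable]: "g \<in> borel_measurable borel" by fact
  show "(\<lambda>u. g u * (cis (x * u) * of_real (exp (- (e * u)\<^sup>2 / 2)))) \<in> borel_measurable lborel"
    by measurable
  have "0 \<le> B" using assms(2)[of 0] norm_ge_zero order_trans by blast
  then show "AE u in lborel. norm (g u * (cis (x * u) * of_real (exp (- (e * u)\<^sup>2 / 2))))
      \<le> norm (B * exp (- (e * u)\<^sup>2 / 2))"
    using assms(2) by (intro AE_I2) (auto simp: norm_mult abs_mult intro!: mult_right_mono)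
qed

lemma fourier_nonneg_one: "fourier_nonneg (\<lambda>_. 1)"
  unfolding fourier_nonneg_def
proof (intro conjI allI impI)
  fix e x :: real assume "e > 0"
  show "(\<integral>u. 1 * (cis (x * u) * of_real (exp (- (e * u)\<^sup>2 / 2))) \<partial>lborel) \<in> \<real>\<^sub>\<ge>\<^sub>0"
    unfolding mult_1 gaussian_fourier(2)[OF \<open>e > 0\<close>] using \<open>e > 0\<close> by (simp del: of_real_mult of_real_divide)
qed auto

lemma fourier_multiplier_imp_nonneg: "fourier_multiplier f \<Longrightarrow> fourier_nonneg f"
  unfolding fourier_multiplier_def using fourier_nonneg_one by fastforce

lemma fourier_multiplier_measurable: "fourier_multiplier f \<Longrightarrow> f \<in> borel_measurable borel"
  using fourier_multiplier_imp_nonneg fourier_nonneg_def by blast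

lemma fourier_multiplier_bounded:
  assumes "fourier_multiplier f" obtains B where "B \<ge> 0" "\<And>u. norm (f u) \<le> B"
  using fourier_multiplier_imp_nonneg[OF assms] unfolding fourier_nonneg_def
  by (metis norm_ge_zero order_trans)

text \<open>Multiplication by a character moves the frequency \<open>x\<close> to
  \<open>a + x\<close>, and positivity is required at all frequencies.\<close>

lemma fourier_multiplier_cis: "fourier_multiplier (\<lambda>u. cis (a * u))"
  unfolding fourier_multiplier_def
proof (intro allI impI)
  fix g assume g: "fourier_nonneg g"
  then have [measurable]: "g \<in> borel_measurable borel" by (auto simp: fourier_nonneg_def)
  have "cis (a * u) * g u * (cis (x * u) * of_real (exp (- (e * u)\<^sup>2 / 2)))
     = g u * (cis ((a + x) * u) * of_real (exp (- (e * u)\<^sup>2 / 2)))" for u x e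
    by (simp add: ring_distribs flip: cis_mult)
  note eq = this
  show "fourier_nonneg (\<lambda>u. cis (a * u) * g u)"
    using g unfolding fourier_nonneg_def eq by (auto simp: norm_mult)
qed

lemma fourier_multiplier_mult:
  assumes "fourier_multiplier f" "fourier_multiplier g"
  shows "fourier_multiplier (\<lambda>u. f u * g u)"
  using assms unfolding fourier_multiplier_def by (simp add: mult.assoc)

lemma fourier_multiplier_one: "fourier_multiplier (\<lambda>_. 1)"
  unfolding fourier_multiplier_def by simp

lemma fourier_multiplier_power: "fourier_multiplier f \<Longrightarrow> fourier_multiplier (\<lambda>u. f u ^ n)"
  by (induction n) (auto intro: fourier_multiplier_one fourier_multiplier_mult)

lemma fourier_multiplier_scale:
  assumes "fourier_multiplier f" "c \<ge> 0"
  shows "fourier_multiplier (\<lambda>u. of_real c * f u)"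
  unfolding fourier_multiplier_def
proof (intro allI impI)
  fix g assume "fourier_nonneg g"
  then have g: "fourier_nonneg (\<lambda>u. f u * g u)"
    using assms by (auto simp: fourier_multiplier_def)
  then obtain B where "\<And>u. norm (f u * g u) \<le> B"
    by (auto simp: fourier_nonneg_def)
  then have "norm (of_real c * f u * g u) \<le> c * B" for u
    using assms(2) mult_left_mono by (fastforce simp: norm_mult mult.assoc)
  then have "\<exists>B. \<forall>u. norm (of_real c * f u * g u) \<le> B" by blast
  then show "fourier_nonneg (\<lambda>u. of_real c * f u * g u)"
    using g assms(2) unfolding fourier_nonneg_def
    by (auto simp: mult.assoc intro!: nonneg_Reals_mult_I)
qed

lemma fourier_multiplier_add:
  assumes "fourier_multiplier f" "fourier_multiplier f'"
  shows "fourier_multiplier (\<lambda>u. f u + f' u)"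
  unfolding fourier_multiplier_def
proof (intro allI impI)
  fix g assume "fourier_nonneg g"
  then have g: "fourier_nonneg (\<lambda>u. f u * g u)" "fourier_nonneg (\<lambda>u. f' u * g u)"
    using assms by (auto simp: fourier_multiplier_def)
  then have [measurable]: "(\<lambda>u. f u * g u) \<in> borel_measurable borel"
     "(\<lambda>u. f' u * g u) \<in> borel_measurable borel" by (auto simp: fourier_nonneg_def)
  obtain B B' where B: "\<And>u. norm (f u * g u) \<le> B" "\<And>u. norm (f' u * g u) \<le> B'"
    using g by (auto simp: fourier_nonneg_def)
  have eq: "(f u + f' u) * g u = f u * g u + f' u * g u" for u
    by (simp add: algebra_simps)
  show "fourier_nonneg (\<lambda>u. (f u + f' u) * g u)"
    unfolding fourier_nonneg_def eq
  proof (intro conjI allI impI)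
    show "\<exists>B. \<forall>u. norm (f u * g u + f' u * g u) \<le> B"
      using B by (intro exI[of _ "B + B'"]) (auto intro!: norm_triangle_le add_mono)
    fix e x :: real assume "e > 0"
    show "(\<integral>u. (f u * g u + f' u * g u) * (cis (x * u) * of_real (exp (- (e * u)\<^sup>2 / 2))) \<partial>lborel) \<in> \<real>\<^sub>\<ge>\<^sub>0"
      unfolding distrib_right
      using fourier_integrable[OF _ B(1) \<open>e > 0\<close>] fourier_integrable[OF _ B(2) \<open>e > 0\<close>]
        g \<open>e > 0\<close> unfolding fourier_nonneg_def
      by (subst Bochner_Integration.integral_add) (auto intro!: nonneg_Reals_add_I)
  qed measurable
qed

text \<open>The uniform bound times the Gaussian is an integrable majorant, so the regularised
  transforms converge, and the nonnegative reals form a closed set.\<close>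

lemma fourier_multiplier_lim:
  fixes f :: "nat \<Rightarrow> real \<Rightarrow> complex"
  assumes f: "\<And>n. fourier_multiplier (f n)"
    and B: "\<And>n u. norm (f n u) \<le> B"
    and lim: "\<And>u. (\<lambda>n. f n u) \<longlonglongrightarrow> F u"
  shows "fourier_multiplier F"
  unfolding fourier_multiplier_def
proof (intro allI impI)
  fix g assume g: "fourier_nonneg g"
  then have fg: "fourier_nonneg (\<lambda>u. f n u * g u)" for n
    using f by (auto simp: fourier_multiplier_def)
  have [measurable]: "g \<in> borel_measurable borel" using g by (auto simp: fourier_nonneg_def)
  have [measurable]: "f n \<in> borel_measurable borel" for n using f fourier_multiplier_measurable by blast
  have [measurable]: "F \<in> borel_measurable borel"
    by (rule borel_measurable_LIMSEQ_metric[OF _ lim]) measurable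
  obtain B' where B': "\<And>u. norm (g u) \<le> B'" using g by (auto simp: fourier_nonneg_def)
  have "0 \<le> B" using B[of 0 0] norm_ge_zero order_trans by blast
  have bn: "norm (f n u * g u) \<le> B * B'" for n u
    unfolding norm_mult using B B' \<open>0 \<le> B\<close> by (intro mult_mono) auto
  have FB: "norm (F u) \<le> B" for u
    using LIMSEQ_le_const2[OF tendsto_norm[OF lim]] B by blast
  show "fourier_nonneg (\<lambda>u. F u * g u)"
    unfolding fourier_nonneg_def
  proof (intro conjI allI impI)
    show "\<exists>B. \<forall>u. norm (F u * g u) \<le> B"
      using FB B' \<open>0 \<le> B\<close> by (intro exI[of _ "B * B'"]) (auto simp: norm_mult intro!: mult_mono)
    fix e x :: real assume "e > 0"
    have "(\<lambda>n. \<integral>u. f n u * g u * (cis (x * u) * of_real (exp (- (e * u)\<^sup>2 / 2))) \<partial>lborel)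
       \<longlonglongrightarrow> (\<integral>u. F u * g u * (cis (x * u) * of_real (exp (- (e * u)\<^sup>2 / 2))) \<partial>lborel)"
    proof (rule integral_dominated_convergence)
      show "integrable lborel (\<lambda>u. (B * B') * exp (- (e * u)\<^sup>2 / 2))"
        using gaussian_fourier(1)[OF \<open>e > 0\<close>] by simp
      show "AE u in lborel. norm (f n u * g u * (cis (x * u) * of_real (exp (- (e * u)\<^sup>2 / 2))))
          \<le> (B * B') * exp (- (e * u)\<^sup>2 / 2)" for n
        using bn[of n] by (intro AE_I2) (simp add: norm_mult mult_right_mono)
      show "AE u in lborel. (\<lambda>n. f n u * g u * (cis (x * u) * of_real (exp (- (e * u)\<^sup>2 / 2))))
         \<longlonglongrightarrow> F u * g u * (cis (x * u) * of_real (exp (- (e * u)\<^sup>2 / 2)))"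
        by (intro AE_I2 tendsto_mult lim tendsto_const)
    qed measurable
    moreover have "(\<integral>u. f n u * g u * (cis (x * u) * of_real (exp (- (e * u)\<^sup>2 / 2))) \<partial>lborel) \<in> \<real>\<^sub>\<ge>\<^sub>0" for n
      using fg[of n] \<open>e > 0\<close> by (auto simp: fourier_nonneg_def)
    ultimately show "(\<integral>u. F u * g u * (cis (x * u) * of_real (exp (- (e * u)\<^sup>2 / 2))) \<partial>lborel) \<in> \<real>\<^sub>\<ge>\<^sub>0"
      by (rule closed_sequentially[OF closed_nonneg_Reals_complex, rotated])
  qed measurable
qed

lemma fourier_multiplier_sum:
  assumes "\<And>i. i \<in> A \<Longrightarrow> fourier_multiplier (f i)"
  shows "fourier_multiplier (\<lambda>u. \<Sum>i\<in>A. f i u)"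
  using assms
proof (induction A rule: infinite_finite_induct)
  case (insert i A)
  then show ?case by (simp add: fourier_multiplier_add)
qed (use fourier_multiplier_scale[OF fourier_multiplier_one, of 0] in simp_all)

text \<open>The partial sums of the exponential series have nonnegative coefficients and stay below
  exp B when \<open>f\<close> is bounded by B.\<close>

lemma fourier_multiplier_exp:
  assumes f: "fourier_multiplier f"
  shows "fourier_multiplier (\<lambda>u. exp (f u))"
proof -
  obtain B where B: "B \<ge> 0" "\<And>u. norm (f u) \<le> B"
    using fourier_multiplier_bounded[OF f] by blast
  show ?thesis
  proof (rule fourier_multiplier_lim)
    show "fourier_multiplier (\<lambda>u. \<Sum>k<n. of_real (1 / fact k) * f u ^ k)" for n
      by (intro fourier_multiplier_sum fourier_multiplier_scale fourier_multiplier_power f) auto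
    show "norm (\<Sum>k<n. of_real (1 / fact k) * f u ^ k) \<le> exp B" for n u
    proof -
      have "norm (\<Sum>k<n. of_real (1 / fact k) * f u ^ k) \<le> (\<Sum>k<n. B ^ k /\<^sub>R fact k)"
        using B by (intro sum_norm_le) (auto simp: norm_mult norm_divide norm_power divide_inverse
           norm_inverse intro!: mult_left_mono power_mono)
      also have "\<dots> \<le> (\<Sum>k. B ^ k /\<^sub>R fact k)"
        using B by (intro sum_le_suminf summable_exp_generic) auto
      finally show ?thesis by (simp add: exp_def)
    qed
    show "(\<lambda>n. \<Sum>k<n. of_real (1 / fact k) * f u ^ k) \<longlonglongrightarrow> exp (f u)" for u
      using exp_converges[of "f u"] unfolding sums_def by (simp add: scaleR_conv_of_real divide_inverse)
  qed
qed

text \<open>With nonnegative coefficients, the partial sums on the circle of radius \<open>r\<close>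
  are bounded by the value at the point \<open>r\<close> itself. The second claim records this
  bound; it later controls the real part of exponents uniformly.\<close>

lemma fourier_multiplier_power_series:
  fixes c :: "nat \<Rightarrow> real"
  assumes c: "\<And>n. c n \<ge> 0" and r: "0 \<le> r" "r < 1"
    and q: "\<And>z::complex. norm z < 1 \<Longrightarrow> (\<lambda>n. of_real (c n) * z ^ n) sums q z"
  shows "fourier_multiplier (\<lambda>u. q (of_real r * cis (a * u)))"
    and "norm (q (of_real r * cis (a * u))) \<le> Re (q (of_real r))"
proof -
  have n: "norm (of_real r * cis (a * u)) = r" for u using r by (simp add: norm_mult)
  have s: "(\<lambda>n. of_real (c n) * (of_real r * cis (a * u)) ^ n) sums q (of_real r * cis (a * u))" for u
    using q n r by simp
  have sr: "(\<lambda>n. of_real (c n * r ^ n)) sums q (of_real r)"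
    using q[of "of_real r"] r by simp
  have sr': "(\<lambda>n. c n * r ^ n) sums Re (q (of_real r))"
    using sums_Re[OF sr] by simp
  have b: "norm (\<Sum>k<n. of_real (c k) * (of_real r * cis (a * u)) ^ k) \<le> Re (q (of_real r))" for n u
  proof -
    have "norm (\<Sum>k<n. of_real (c k) * (of_real r * cis (a * u)) ^ k) \<le> (\<Sum>k<n. c k * r ^ k)"
      using c r by (intro sum_norm_le) (auto simp: norm_mult norm_power)
    also have "\<dots> \<le> Re (q (of_real r))"
      using sum_le_suminf[OF sums_summable[OF sr'], of "{..<n}"] c r sums_unique[OF sr'] by auto
    finally show ?thesis .
  qed
  show "fourier_multiplier (\<lambda>u. q (of_real r * cis (a * u)))"
  proof (rule fourier_multiplier_lim[OF _ b])
    show "fourier_multiplier (\<lambda>u. \<Sum>k<n. of_real (c k) * (of_real r * cis (a * u)) ^ k)" for n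
      using c r by (intro fourier_multiplier_sum fourier_multiplier_scale fourier_multiplier_power fourier_multiplier_cis) auto
    show "(\<lambda>n. \<Sum>k<n. of_real (c k) * (of_real r * cis (a * u)) ^ k) \<longlonglongrightarrow> q (of_real r * cis (a * u))" for u
      using s unfolding sums_def .
  qed
  show "norm (q (of_real r * cis (a * u))) \<le> Re (q (of_real r))"
    by (rule LIMSEQ_le_const2[OF tendsto_norm[OF s[unfolded sums_def]]]) (use b in blast)
qed

section \<open>Binomial series and totally skewed stable exponents\<close>

lemma one_minus_powr_sums:
  fixes z :: complex and a :: real
  assumes "norm z < 1"
  shows "(\<lambda>n. of_real (pochhammer (- a) n / fact n) * z ^ n) sums (1 - z) powr of_real a"
proof -
  have "(of_real a gchoose n) * (- z) ^ n = of_real (pochhammer (- a) n / fact n) * z ^ n" for n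
  proof -
    have "(- 1) ^ n * (- z) ^ n = z ^ n"
      by (simp flip: power_mult_distrib)
    moreover have "pochhammer (- complex_of_real a) n = of_real (pochhammer (- a) n)"
      using pochhammer_of_real[of "- a" n, where 'a = complex] by simp
    ultimately show ?thesis
      by (simp only: gbinomial_pochhammer of_real_divide of_real_fact) (simp add: divide_simps)
  qed
  then show ?thesis
    using gen_binomial_complex[of "- z" "of_real a"] assms by simp
qed

text \<open>In the product (-a)(1 - a)(2 - a)... only the first factor is negative.\<close>

lemma pochhammer_nonpos_first:
  fixes a :: real
  assumes "0 < a" "a < 1" "n \<ge> 1"
  shows "pochhammer (- a) n \<le> 0"
proof -
  obtain m where m: "n = Suc m" using assms(3) by (cases n) auto
  have "pochhammer (- a + 1) m > 0" using assms by (intro pochhammer_pos) auto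
  then show ?thesis unfolding m pochhammer_rec using assms by (simp add: mult_nonneg_nonneg)
qed

text \<open>Exactly the first two factors -a and 1 - a are negative, and their product is
  positive.\<close>

lemma pochhammer_nonneg_second:
  fixes a :: real
  assumes "1 < a" "a < 2" "n \<ge> 2"
  shows "pochhammer (- a) n \<ge> 0"
proof -
  obtain m where m: "n = Suc (Suc m)" using assms(3) by (intro that[of "n - 2"]) arith
  have "pochhammer (- a + 1 + 1) m > 0" using assms by (intro pochhammer_pos) auto
  then have "(-a) * ((- a + 1) * pochhammer (- a + 1 + 1) m) \<ge> 0"
    using assms by (intro mult_nonpos_nonpos mult_nonpos_nonneg) auto
  then show ?thesis unfolding m pochhammer_rec .
qed

lemma norm_cis_minus_linear: "norm (cis y - 1 - \<i> * of_real y) \<le> y\<^sup>2 / 2"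
proof -
  have "norm (iexp y - (1 + \<i> * of_real y)) \<le> \<bar>y\<bar>\<^sup>2 / fact 2"
    using iexp_approx1[of y 1] by (simp add: eval_nat_numeral)
  then show ?thesis by (simp add: cis_conv_exp diff_diff_eq)
qed

text \<open>For 0 < h \<le> 1 the modulus is below 1, inside the disk of the binomial series, while
  the defect h^2 vanishes faster than the phase h x and leaves no trace in the limit.\<close>

abbreviation (input) near_one :: "real \<Rightarrow> real \<Rightarrow> complex" where
  "near_one h x \<equiv> of_real (1 - h\<^sup>2) * cis (h * x)"

text \<open>The error splits into the Taylor remainder of \<open>cis\<close>, which contributes h
  x^2 / 2, and the damping factor, which contributes h.\<close>

lemma near_one_quotient_bound:
  assumes "0 < h" "h \<le> 1"
  shows "norm ((1 - near_one h x) / of_real h + \<i> * of_real x) \<le> h * (x\<^sup>2 / 2 + 1)"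
proof -
  have "(1 - near_one h x) / of_real h + \<i> * of_real x
      = - (cis (h * x) - 1 - \<i> * of_real (h * x)) / of_real h + of_real h * cis (h * x)"
    using assms by (simp add: divide_simps power2_eq_square) (simp add: algebra_simps)
  also have "norm \<dots> \<le> norm (cis (h * x) - 1 - \<i> * of_real (h * x)) / h + h"
    using assms by (intro norm_triangle_le add_mono) (simp_all add: norm_divide norm_mult norm_minus_cancel del: of_real_mult mult_minus_right minus_diff_eq)
  also have "\<dots> \<le> ((h * x)\<^sup>2 / 2) / h + h"
    using assms norm_cis_minus_linear[of "h * x"] by (intro add_mono divide_right_mono) auto
  also have "\<dots> = h * (x\<^sup>2 / 2 + 1)"
    using assms by (simp add: field_simps power2_eq_square)
  finally show ?thesis .
qed

text \<open>A positive factor adds a real number to the principal logarithm, so no branch is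
  crossed.\<close>

lemma scaled_powr:
  fixes h a :: real and w :: complex
  assumes "h > 0"
  shows "of_real (h powr - a) * (of_real h * w) powr of_real a = w powr of_real a"
proof (cases "w = 0")
  case False
  have "Ln (of_real h * w) = ln h + Ln w"
    using assms False by (simp add: Ln_times_of_real Ln_of_real)
  moreover have "of_real (h powr - a) = exp (- complex_of_real a * of_real (ln h))"
    using assms by (simp add: powr_def flip: exp_of_real)
  ultimately show ?thesis
    using assms False by (simp add: powr_def algebra_simps flip: exp_add)
qed auto

text \<open>By homogeneity the expression is the power of (1 - \<open>near_one\<close>) / h, whose
  base tends to -i x. This point is off the branch cut except for x = 0; there the base is h and the
  expression is h powr a, which tends to 0.\<close>

lemma near_one_powr_limit:
  fixes a x :: real
  assumes a: "a > 0"
  defines "h \<equiv> \<lambda>n. 1 / real (Suc n)"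
  shows "(\<lambda>n. of_real (h n powr - a) * (1 - near_one (h n) x) powr of_real a)
           \<longlonglongrightarrow> (- \<i> * of_real x) powr of_real a"
proof -
  have h: "0 < h n" "h n \<le> 1" for n by (auto simp: h_def)
  have h0: "h \<longlonglongrightarrow> 0" unfolding h_def by (rule LIMSEQ_Suc[OF lim_1_over_n])
  show ?thesis
  proof (cases "x = 0")
    case True
    have "of_real (h n powr - a) * (1 - near_one (h n) x) powr of_real a = complex_of_real (h n powr a)" for n
    proof -
      have "(1 - near_one (h n) x) powr complex_of_real a = of_real ((h n)\<^sup>2 powr a)"
        using True h[of n] by (simp add: powr_of_real flip: of_real_power)
      also have "(h n)\<^sup>2 powr a = h n powr a * h n powr a"
        using h(1)[of n] by (simp add: power2_eq_square powr_mult)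
      finally show ?thesis using h(1)[of n] by (simp add: powr_minus)
    qed
    moreover have "(\<lambda>n. complex_of_real (h n powr a)) \<longlonglongrightarrow> of_real (0 powr a)"
      using h h0 a by (intro tendsto_of_real tendsto_powr') (auto intro: less_imp_le always_eventually)
    ultimately show ?thesis using True a by simp
  next
    case False
    define w where "w n = (1 - near_one (h n) x) / of_real (h n)" for n
    have eq: "1 - near_one (h n) x = of_real (h n) * w n" for n
      using h(1)[of n] by (simp add: w_def)
    have "w \<longlonglongrightarrow> - \<i> * of_real x"
    proof (subst LIM_zero_iff[symmetric], rule Lim_null_comparison)
      show "\<forall>\<^sub>F n in sequentially. norm (w n - - \<i> * of_real x) \<le> h n * (x\<^sup>2 / 2 + 1)"
        using near_one_quotient_bound[OF h] by (simp add: w_def)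
      show "(\<lambda>n. h n * (x\<^sup>2 / 2 + 1)) \<longlonglongrightarrow> 0"
        using tendsto_mult_left_zero[OF h0] .
    qed
    then have "(\<lambda>n. w n powr of_real a) \<longlonglongrightarrow> (- \<i> * of_real x) powr of_real a"
      using False by (intro tendsto_powr_complex tendsto_const) (auto simp: complex_nonpos_Reals_iff)
    then show ?thesis unfolding eq scaled_powr[OF h(1)] .
  qed
qed

text \<open>Up to the damping, exp (-l + l q) is the transform of a compound Poisson sum with
  intensity l = c h^(-a), jumps at multiples of h s, and jump probabilities given by the
  coefficients of q = 1 - (1 - z)^a. The exponent is -l (1 - z)^a, and l is scaled so that it
  converges.\<close>

lemma fourier_multiplier_lower:
  fixes a c s :: real
  assumes a: "0 < a" "a < 1" and c: "c \<ge> 0"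
  shows "fourier_multiplier (\<lambda>u. exp (- of_real c * (- \<i> * of_real (s * u)) powr of_real a))"
proof -
  define h where "h = (\<lambda>n. 1 / real (Suc n))"
  have h: "0 < h n" "h n \<le> 1" for n by (auto simp: h_def)
  define l where "l n = c * h n powr - a" for n
  have l: "l n \<ge> 0" for n using c by (simp add: l_def)
  define q where "q z = 1 - (1 - z) powr of_real a" for z :: complex
  define p where "p n = (if n = 0 then 0 else - (pochhammer (- a) n / fact n))" for n
  have p: "p n \<ge> 0" for n
    using pochhammer_nonpos_first[OF a, of n] by (auto simp: p_def divide_nonpos_pos)
  have q: "(\<lambda>n. of_real (p n) * z ^ n) sums q z" if "norm z < 1" for z
  proof -
    have "(\<lambda>n. (if n = 0 then 1 else 0) - of_real (pochhammer (- a) n / fact n) * z ^ n) sums (1 - (1 - z) powr of_real a)"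
      using that by (intro sums_diff one_minus_powr_sums) (use sums_single[of 0 "\<lambda>_. 1::complex"] in simp)
    moreover have "(if n = 0 then 1 else 0) - of_real (pochhammer (- a) n / fact n) * z ^ n = of_real (p n) * z ^ n" for n
      by (simp add: p_def)
    ultimately show ?thesis by (simp add: q_def)
  qed
  have r: "0 \<le> 1 - (h n)\<^sup>2" "1 - (h n)\<^sup>2 < 1" for n
    using h[of n] by (auto simp: power_le_one)
  have qm1: "fourier_multiplier (\<lambda>u. q (of_real (1 - (h n)\<^sup>2) * cis (b * u)))" for n b
    using fourier_multiplier_power_series(1)[OF p r q] .
  have qm2: "norm (q (of_real (1 - (h n)\<^sup>2) * cis (b * u))) \<le> Re (q (of_real (1 - (h n)\<^sup>2)))" for n b u
    using fourier_multiplier_power_series(2)[OF p r q] .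
  show ?thesis
  proof (rule fourier_multiplier_lim)
    show "fourier_multiplier (\<lambda>u. of_real (exp (- l n)) * exp (of_real (l n) * q (of_real (1 - (h n)\<^sup>2) * cis (h n * s * u))))" for n
      by (intro fourier_multiplier_scale fourier_multiplier_exp l qm1) auto
    show "norm (of_real (exp (- l n)) * exp (of_real (l n) * q (of_real (1 - (h n)\<^sup>2) * cis (h n * s * u)))) \<le> 1" for n u
    proof -
      \<comment> \<open>The value of \<open>q\<close> at the radius is below 1, hence -l + l q has
        nonpositive real part on the whole circle.\<close>
      have "Re (q (of_real (1 - (h n)\<^sup>2))) = 1 - ((h n)\<^sup>2) powr a"
        by (simp add: q_def powr_of_real flip: of_real_power)
      then have "norm (q (of_real (1 - (h n)\<^sup>2) * cis (h n * s * u))) \<le> 1"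
        using qm2[of n "h n * s" u]
        using powr_ge_zero[of "(h n)\<^sup>2" a] by linarith
      then have "Re (q (of_real (1 - (h n)\<^sup>2) * cis (h n * s * u))) \<le> 1"
        using complex_Re_le_cmod order_trans by blast
      then have "l n * Re (q (of_real (1 - (h n)\<^sup>2) * cis (h n * s * u))) \<le> l n * 1"
        by (intro mult_left_mono l)
      then show ?thesis by (simp add: norm_mult flip: exp_add del: of_real_power of_real_diff)
    qed
    show "(\<lambda>n. of_real (exp (- l n)) * exp (of_real (l n) * q (of_real (1 - (h n)\<^sup>2) * cis (h n * s * u))))
        \<longlonglongrightarrow> exp (- of_real c * (- \<i> * of_real (s * u)) powr of_real a)" for u
    proof -
      have eq: "of_real (exp (- l n)) * exp (of_real (l n) * q (of_real (1 - (h n)\<^sup>2) * cis (h n * s * u)))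
        = exp (- of_real c * (of_real (h n powr - a) * (1 - near_one (h n) (s * u)) powr of_real a))" for n
        unfolding exp_of_real[symmetric] exp_add[symmetric] by (simp add: q_def l_def algebra_simps)
      show ?thesis unfolding eq
        using near_one_powr_limit[OF a(1), of "s * u"] unfolding h_def
        by (intro tendsto_exp tendsto_mult tendsto_const)
    qed
  qed
qed

text \<open>For 1 < a < 2 the binomial series begins with 1 - a z, and only the coefficients from
  z^2 on are nonnegative. They form \<open>q\<close>; the linear term is restored by a constant and
  a character, which amounts to centring the compound Poisson sum.\<close>

lemma fourier_multiplier_upper:
  fixes a c s :: real
  assumes a: "1 < a" "a < 2" and c: "c \<ge> 0"
  shows "fourier_multiplier (\<lambda>u. exp (of_real c * (- \<i> * of_real (s * u)) powr of_real a))"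
proof -
  define h where "h = (\<lambda>n. 1 / real (Suc n))"
  have h: "0 < h n" "h n \<le> 1" for n by (auto simp: h_def)
  have h0: "h \<longlonglongrightarrow> 0" unfolding h_def by (rule LIMSEQ_Suc[OF lim_1_over_n])
  define l where "l n = c * h n powr - a" for n
  have l: "l n \<ge> 0" for n using c by (simp add: l_def)
  define q where "q z = (1 - z) powr of_real a + of_real a * z - 1" for z :: complex
  define p where "p n = (if n < 2 then 0 else pochhammer (- a) n / fact n)" for n :: nat
  have p: "p n \<ge> 0" for n
    using pochhammer_nonneg_second[OF a, of n] by (auto simp: p_def)
  have q: "(\<lambda>n. of_real (p n) * z ^ n) sums q z" if "norm z < 1" for z
  proof -
    have "(\<lambda>n. of_real (pochhammer (- a) n / fact n) * z ^ n + (if n = 1 then of_real a * z else 0) - (if n = 0 then 1 else 0))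
        sums ((1 - z) powr of_real a + of_real a * z - 1)"
      using that sums_single[of 0 "\<lambda>_. 1::complex"] sums_single[of 1 "\<lambda>_. of_real a * z"]
      by (intro sums_diff sums_add one_minus_powr_sums) auto
    moreover have "of_real (pochhammer (- a) n / fact n) * z ^ n + (if n = 1 then of_real a * z else 0) - (if n = 0 then 1 else 0) = of_real (p n) * z ^ n" for n
      by (auto simp: p_def less_2_cases_iff)
    ultimately show ?thesis by (simp add: q_def)
  qed
  have r: "0 \<le> 1 - (h n)\<^sup>2" "1 - (h n)\<^sup>2 < 1" for n
    using h[of n] by (auto simp: power_le_one)
  have qm1: "fourier_multiplier (\<lambda>u. q (of_real (1 - (h n)\<^sup>2) * cis (b * u)))" for n b
    using fourier_multiplier_power_series(1)[OF p r q] .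
  have qm2: "norm (q (of_real (1 - (h n)\<^sup>2) * cis (b * u))) \<le> Re (q (of_real (1 - (h n)\<^sup>2)))" for n b u
    using fourier_multiplier_power_series(2)[OF p r q] .
  \<comment> \<open>With z = \<open>near_one (h n) (s * u)\<close>, the total exponent is l (1 -
    z)^a + l a (z - 1 - i h s u). The last bracket is the remainder \<open>d\<close> below.\<close>
  let ?f = "\<lambda>n u. of_real (exp (l n * (1 - a))) * (cis ((- l n * a * h n * s) * u) *
          exp (of_real (l n) * q (of_real (1 - (h n)\<^sup>2) * cis (h n * s * u))))"
  show ?thesis
  proof (rule fourier_multiplier_lim)
    show "fourier_multiplier (?f n)" for n
      by (intro fourier_multiplier_scale fourier_multiplier_mult fourier_multiplier_cis
           fourier_multiplier_exp l qm1) auto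
    show "norm (?f n u) \<le> exp c" for n u
    proof -
      have hh: "h n powr a \<le> 1" using h[of n] a powr_mono2[of a "h n" 1] by simp
      have "Re (q (of_real (1 - (h n)\<^sup>2))) = ((h n)\<^sup>2) powr a + a * (1 - (h n)\<^sup>2) - 1"
        by (simp add: q_def powr_of_real flip: of_real_power)
      then have "norm (q (of_real (1 - (h n)\<^sup>2) * cis (h n * s * u))) \<le> ((h n)\<^sup>2) powr a + a * (1 - (h n)\<^sup>2) - 1"
        using qm2[of n "h n * s" u] by linarith
      then have "Re (q (of_real (1 - (h n)\<^sup>2) * cis (h n * s * u))) \<le> ((h n)\<^sup>2) powr a + a * (1 - (h n)\<^sup>2) - 1"
        using complex_Re_le_cmod order_trans by blast
      \<comment> \<open>The terms a (1 - h^2) - 1 + (1 - a) collapse to -a h^2, so only (h^2)^a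
        remains, and l (h^2)^a = c h^a.\<close>
      then have "Re (q (of_real (1 - (h n)\<^sup>2) * cis (h n * s * u))) + (1 - a) \<le> ((h n)\<^sup>2) powr a"
        using a by (simp add: algebra_simps) (smt (verit) mult_nonneg_nonneg zero_le_power2)
      then have "l n * (Re (q (of_real (1 - (h n)\<^sup>2) * cis (h n * s * u))) + (1 - a)) \<le> l n * ((h n)\<^sup>2) powr a"
        by (intro mult_left_mono l)
      also have "\<dots> = c * h n powr a"
        using h(1)[of n] by (simp add: l_def power2_eq_square powr_mult powr_minus)
      also have "\<dots> \<le> c * 1" using hh c by (intro mult_left_mono) auto
      finally show ?thesis by (simp add: norm_mult algebra_simps flip: exp_add del: of_real_power of_real_diff)
    qed
    show "(\<lambda>n. ?f n u) \<longlonglongrightarrow> exp (of_real c * (- \<i> * of_real (s * u)) powr of_real a)" for u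
    proof -
      define d where "d n = near_one (h n) (s * u) - 1 - \<i> * of_real (h n * (s * u))" for n
      have eq: "?f n u = exp (of_real c * (of_real (h n powr - a) * (1 - near_one (h n) (s * u)) powr of_real a)
              + of_real (l n * a) * d n)" for n
        unfolding exp_of_real[symmetric] exp_add[symmetric] cis_conv_exp[of "(- l n * a * h n * s) * u"]
        by (simp add: q_def l_def d_def algebra_simps)
      have "(\<lambda>n. of_real (l n * a) * d n) \<longlonglongrightarrow> 0"
      proof (rule Lim_null_comparison)
        \<comment> \<open>The remainder \<open>d\<close> is of order h^2 while l is c h^(-a), and a
          < 2.\<close>
        have "norm (of_real (l n * a) * d n) \<le> c * a * ((s * u)\<^sup>2 / 2 + 1) * h n powr (2 - a)" for n
        proof -
          have "d n = - of_real (h n) * ((1 - near_one (h n) (s * u)) / of_real (h n) + \<i> * of_real (s * u))"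
            using h(1)[of n] by (simp add: d_def field_simps)
          then have "norm (d n) = h n * norm ((1 - near_one (h n) (s * u)) / of_real (h n) + \<i> * of_real (s * u))"
            using h(1)[of n] by (simp only: norm_mult norm_minus_cancel norm_of_real)
          also have "\<dots> \<le> h n * (h n * ((s * u)\<^sup>2 / 2 + 1))"
            using near_one_quotient_bound[OF h, of n "s * u"] h(1)[of n] by (intro mult_left_mono) auto
          finally have "norm (of_real (l n * a) * d n) \<le> (l n * a) * (h n * (h n * ((s * u)\<^sup>2 / 2 + 1)))"
            using l[of n] a by (simp add: norm_mult mult_left_mono)
          also have "\<dots> = c * a * ((s * u)\<^sup>2 / 2 + 1) * (h n powr - a * h n powr 2)"
            using h(1)[of n] by (simp add: l_def power2_eq_square algebra_simps)
          also have "h n powr - a * h n powr 2 = h n powr (2 - a)"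
            by (simp add: powr_add[symmetric])
          finally show ?thesis .
        qed
        then show "\<forall>\<^sub>F n in sequentially. norm (of_real (l n * a) * d n) \<le> c * a * ((s * u)\<^sup>2 / 2 + 1) * h n powr (2 - a)"
          by simp
        have "(\<lambda>n. h n powr (2 - a)) \<longlonglongrightarrow> 0 powr (2 - a)"
          using h h0 a by (intro tendsto_powr') (auto intro: less_imp_le always_eventually)
        then show "(\<lambda>n. c * a * ((s * u)\<^sup>2 / 2 + 1) * h n powr (2 - a)) \<longlonglongrightarrow> 0"
          using a by (intro tendsto_mult_right_zero) simp
      qed
      then have "(\<lambda>n. exp (of_real c * (of_real (h n powr - a) * (1 - near_one (h n) (s * u)) powr of_real a)
              + of_real (l n * a) * d n)) \<longlonglongrightarrow> exp (of_real c * (- \<i> * of_real (s * u)) powr of_real a + 0)"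
        using near_one_powr_limit[of a "s * u"] a unfolding h_def
        by (intro tendsto_exp tendsto_mult tendsto_add tendsto_const) auto
      then show ?thesis unfolding eq by simp
    qed
  qed
qed

section \<open>Densities from characteristic functions\<close>

text \<open>Fourier inversion in a situation where integrability of the inverse transform
  \<open>F\<close> is not known beforehand. Boundedness of \<open>F\<close> permits Gaussian
  factors; positivity then yields integrability by monotone convergence, and only afterwards are the
  Gaussian factors removed by domination.\<close>

lemma fourier_nonneg_density:
  fixes \<phi> :: "real \<Rightarrow> complex"
  assumes int: "integrable lborel \<phi>" and cont: "continuous_on UNIV \<phi>" and zero: "\<phi> 0 = 1"
    and nn: "fourier_nonneg \<phi>"
  shows "\<exists>f. f \<in> borel_measurable borel \<and> (\<forall>x. 0 \<le> f x) \<and>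
        real_distribution (density lborel (\<lambda>x. ennreal (f x))) \<and>
        char (density lborel (\<lambda>x. ennreal (f x))) = \<phi>"
proof -
  have [measurable]: "\<phi> \<in> borel_measurable borel" using nn by (auto simp: fourier_nonneg_def)
  obtain B where B: "\<And>u. norm (\<phi> u) \<le> B" using nn by (auto simp: fourier_nonneg_def)
  define e where "e n = 1 / real (Suc n)" for n
  have e: "e n > 0" for n by (simp add: e_def)
  have e0: "e \<longlonglongrightarrow> 0" unfolding e_def by (rule LIMSEQ_Suc[OF lim_1_over_n])
  have e_dec: "e (Suc n) \<le> e n" for n by (simp add: e_def frac_le)
  have g1: "(\<lambda>n. exp (- (e n * u)\<^sup>2 / 2)) \<longlonglongrightarrow> 1" for u
  proof -
    have "(\<lambda>n. exp (- (e n * u)\<^sup>2 / 2)) \<longlonglongrightarrow> exp (- (0 * u)\<^sup>2 / 2)"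
      by (intro tendsto_intros e0) auto
    then show ?thesis by simp
  qed
  define F where "F x = (\<integral>u. \<phi> u * cis (- x * u) \<partial>lborel) / of_real (2 * pi)" for x
  define f where "f x = Re (F x)" for x
  \<comment> \<open>The hypothesis gives positivity in the presence of the Gaussian factor;
    integrability of \<open>\<phi>\<close> lets this factor tend to 1.\<close>
  have F_nonneg: "F x \<in> \<real>\<^sub>\<ge>\<^sub>0" for x
  proof -
    have "(\<lambda>n. \<integral>u. \<phi> u * (cis (- x * u) * of_real (exp (- (e n * u)\<^sup>2 / 2))) \<partial>lborel)
       \<longlonglongrightarrow> (\<integral>u. \<phi> u * cis (- x * u) \<partial>lborel)"
    proof (rule integral_dominated_convergence)
      show "integrable lborel (\<lambda>u. norm (\<phi> u))" using int by simp
      show "AE u in lborel. (\<lambda>n. \<phi> u * (cis (- x * u) * of_real (exp (- (e n * u)\<^sup>2 / 2)))) \<longlonglongrightarrow> \<phi> u * cis (- x * u)"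
        using tendsto_mult[OF tendsto_const tendsto_mult[OF tendsto_const tendsto_of_real[OF g1]]]
        by (intro AE_I2) fastforce
      show "AE u in lborel. norm (\<phi> u * (cis (- x * u) * of_real (exp (- (e n * u)\<^sup>2 / 2)))) \<le> norm (\<phi> u)" for n
        by (intro AE_I2) (simp add: norm_mult mult_left_le)
    qed measurable
    moreover have "(\<integral>u. \<phi> u * (cis (- x * u) * of_real (exp (- (e n * u)\<^sup>2 / 2))) \<partial>lborel) \<in> \<real>\<^sub>\<ge>\<^sub>0" for n
      using nn e[of n] unfolding fourier_nonneg_def by blast
    ultimately have "(\<integral>u. \<phi> u * cis (- x * u) \<partial>lborel) \<in> \<real>\<^sub>\<ge>\<^sub>0"
      by (rule closed_sequentially[OF closed_nonneg_Reals_complex, rotated])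
    then show ?thesis unfolding F_def by (intro nonneg_Reals_divide_I) auto
  qed
  have Ff: "F x = of_real (f x)" and f_nonneg: "0 \<le> f x" for x
    using F_nonneg[of x] by (auto simp: f_def complex_nonneg_Reals_iff complex_eq_iff)
  have [measurable]: "F \<in> borel_measurable borel"
    unfolding F_def[abs_def] by measurable
  have [measurable]: "f \<in> borel_measurable borel"
    unfolding f_def[abs_def] by measurable
  define K where "K = (\<integral>u. norm (\<phi> u) \<partial>lborel) / (2 * pi)"
  have F_le: "norm (F x) \<le> K" for x
  proof -
    have "norm (\<integral>u. \<phi> u * cis (- x * u) \<partial>lborel) \<le> (\<integral>u. norm (\<phi> u * cis (- x * u)) \<partial>lborel)"
      by (rule integral_norm_bound)
    then show ?thesis by (simp add: F_def K_def norm_divide norm_mult divide_right_mono)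
  qed
  have F_int: "integrable lborel (\<lambda>x. F x * (cis (t * x) * of_real (exp (- (e n * x)\<^sup>2 / 2))))" for t n
    using fourier_integrable[OF _ F_le e] by simp
  \<comment> \<open>Fubini leaves a Gaussian integral in x, and the substitution u = t - e v turns
    the result into an average of \<open>\<phi>\<close> near t against the standard normal
    density.\<close>
  have F_eq: "(\<integral>x. F x * (cis (t * x) * of_real (exp (- (e n * x)\<^sup>2 / 2))) \<partial>lborel)
     = (\<integral>v. \<phi> (t - e n * v) * of_real (std_normal_density v) \<partial>lborel)" for t n
  proof -
    let ?g = "\<lambda>x. exp (- (e n * x)\<^sup>2 / 2)"
    let ?h = "\<lambda>x u. \<phi> u * (cis ((t - u) * x) * of_real (?g x))"
    have "F x * (cis (t * x) * of_real (?g x)) = (\<integral>u. ?h x u \<partial>lborel) / of_real (2 * pi)" for x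
    proof -
      have "(\<integral>u. ?h x u \<partial>lborel) = (\<integral>u. (\<phi> u * cis (- x * u)) * (cis (t * x) * of_real (?g x)) \<partial>lborel)"
        by (intro Bochner_Integration.integral_cong) (auto simp: algebra_simps cis_mult)
      also have "\<dots> = (\<integral>u. \<phi> u * cis (- x * u) \<partial>lborel) * (cis (t * x) * of_real (?g x))"
        by simp
      finally show ?thesis by (simp add: F_def)
    qed
    then have "(\<integral>x. F x * (cis (t * x) * of_real (?g x)) \<partial>lborel) = (\<integral>x. \<integral>u. ?h x u \<partial>lborel \<partial>lborel) / of_real (2 * pi)"
      by simp
    also have "(\<integral>x. \<integral>u. ?h x u \<partial>lborel \<partial>lborel) = (\<integral>u. \<integral>x. ?h x u \<partial>lborel \<partial>lborel)"
    proof (rule lborel_pair.Fubini_integral[symmetric], rule lborel_pair.Fubini_integrable)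
      have "integrable lborel (\<lambda>x. (\<integral>u. norm (\<phi> u) \<partial>lborel) * ?g x)"
        using gaussian_fourier(1)[OF e] by simp
      then show "integrable lborel (\<lambda>x. \<integral>u. norm (case (x, u) of (x, u) \<Rightarrow> ?h x u) \<partial>lborel)"
        by (simp add: norm_mult)
      show "AE x in lborel. integrable lborel (\<lambda>u. case (x, u) of (x, u) \<Rightarrow> ?h x u)"
      proof (rule AE_I2)
        fix x
        show "integrable lborel (\<lambda>u. case (x, u) of (x, u) \<Rightarrow> ?h x u)"
          by (rule Bochner_Integration.integrable_bound[OF int]) (auto simp: norm_mult mult_left_le)
      qed
    qed measurable
    also have "(\<integral>u. \<integral>x. ?h x u \<partial>lborel \<partial>lborel)
        = (\<integral>u. \<phi> u * of_real (sqrt (2 * pi) / e n * exp (- ((t - u) / e n)\<^sup>2 / 2)) \<partial>lborel)"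
      by (simp only: integral_mult_right_zero gaussian_fourier(2)[OF e])
    also have "\<dots> = \<bar>- e n\<bar> *\<^sub>R (\<integral>v. \<phi> (t + - e n * v) * of_real (sqrt (2 * pi) / e n * exp (- ((t - (t + - e n * v)) / e n)\<^sup>2 / 2)) \<partial>lborel)"
      using e[of n] by (intro lborel_integral_real_affine) auto
    also have "(\<lambda>v. \<phi> (t + - e n * v) * complex_of_real (sqrt (2 * pi) / e n * exp (- ((t - (t + - e n * v)) / e n)\<^sup>2 / 2)))
        = (\<lambda>v. of_real (2 * pi / e n) * (\<phi> (t - e n * v) * of_real (std_normal_density v)))"
    proof
      fix v
      have s: "sqrt (2 * pi) = 2 * pi / sqrt (2 * pi)"
        by (simp add: real_div_sqrt)
      have "(t - (t + - e n * v)) / e n = v" using e[of n] by simp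
      then have "sqrt (2 * pi) / e n * exp (- ((t - (t + - e n * v)) / e n)\<^sup>2 / 2) = 2 * pi / e n * std_normal_density v"
        unfolding std_normal_density_def by (subst s) simp
      then show "\<phi> (t + - e n * v) * complex_of_real (sqrt (2 * pi) / e n * exp (- ((t - (t + - e n * v)) / e n)\<^sup>2 / 2))
        = of_real (2 * pi / e n) * (\<phi> (t - e n * v) * of_real (std_normal_density v))"
        by (simp only:) simp
    qed
    finally show ?thesis
      using e[of n] by (simp add: scaleR_conv_of_real)
  qed
  have lim: "(\<lambda>n. \<integral>x. F x * (cis (t * x) * of_real (exp (- (e n * x)\<^sup>2 / 2))) \<partial>lborel) \<longlonglongrightarrow> \<phi> t" for t
  proof -
    have "(\<lambda>n. \<integral>v. \<phi> (t - e n * v) * of_real (std_normal_density v) \<partial>lborel)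
        \<longlonglongrightarrow> (\<integral>v. \<phi> t * of_real (std_normal_density v) \<partial>lborel)"
    proof (rule integral_dominated_convergence)
      show "integrable lborel (\<lambda>v. B * std_normal_density v)"
        by (intro integrable_mult_right integrable_normal_density) simp
      show "AE v in lborel. norm (\<phi> (t - e n * v) * of_real (std_normal_density v)) \<le> B * std_normal_density v" for n
        using B by (intro AE_I2) (simp add: norm_mult mult_right_mono)
      show "AE v in lborel. (\<lambda>n. \<phi> (t - e n * v) * of_real (std_normal_density v)) \<longlonglongrightarrow> \<phi> t * of_real (std_normal_density v)"
      proof (intro AE_I2 tendsto_mult tendsto_const)
        fix v
        have "(\<lambda>n. t - e n * v) \<longlonglongrightarrow> t - 0 * v" by (intro tendsto_intros e0)
        then show "(\<lambda>n. \<phi> (t - e n * v)) \<longlonglongrightarrow> \<phi> t"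
          using cont by (intro isCont_tendsto_compose[of t \<phi>]) (auto simp: continuous_on_eq_continuous_at)
      qed
    qed measurable
    also have "(\<integral>v. \<phi> t * of_real (std_normal_density v) \<partial>lborel) = \<phi> t"
      using integral_normal_density[of 1 0] by (simp add: integral_complex_of_real)
    finally show ?thesis unfolding F_eq .
  qed
  have f_int_n: "integrable lborel (\<lambda>x. f x * exp (- (e n * x)\<^sup>2 / 2))" for n
    using integrable_Re[OF F_int[of 0 n]] by (simp add: Ff)
  have f_lim: "(\<lambda>n. \<integral>x. f x * exp (- (e n * x)\<^sup>2 / 2) \<partial>lborel) \<longlonglongrightarrow> 1"
  proof -
    have "(\<integral>x. F x * (cis (0 * x) * of_real (exp (- (e n * x)\<^sup>2 / 2))) \<partial>lborel)
        = complex_of_real (\<integral>x. f x * exp (- (e n * x)\<^sup>2 / 2) \<partial>lborel)" for n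
      by (simp add: Ff integral_complex_of_real flip: of_real_mult)
    then have "(\<lambda>n. complex_of_real (\<integral>x. f x * exp (- (e n * x)\<^sup>2 / 2) \<partial>lborel)) \<longlonglongrightarrow> 1"
      using lim[of 0] zero by (simp only:)
    then show ?thesis using tendsto_Re by fastforce
  qed
  have f_mono: "incseq (\<lambda>n. f x * exp (- (e n * x)\<^sup>2 / 2))" for x
  proof (rule incseq_SucI)
    fix n
    have "(e (Suc n) * x)\<^sup>2 \<le> (e n * x)\<^sup>2"
      unfolding power_mult_distrib using e[of "Suc n"] e_dec[of n]
      by (intro mult_right_mono power_mono) auto
    then show "f x * exp (- (e n * x)\<^sup>2 / 2) \<le> f x * exp (- (e (Suc n) * x)\<^sup>2 / 2)"
      using f_nonneg by (intro mult_left_mono) auto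
  qed
  have f_conv: "(\<lambda>n. f x * exp (- (e n * x)\<^sup>2 / 2)) \<longlonglongrightarrow> f x" for x
    using tendsto_mult[OF tendsto_const g1, of "f x" x] by simp
  \<comment> \<open>As \<open>e\<close> decreases, the regularised functions increase to
    \<open>f\<close>, and their integrals tend to \<open>\<phi> 0\<close>; this gives both
    integrability and total mass 1.\<close>
  have f_hbi: "has_bochner_integral lborel f 1"
    by (rule has_bochner_integral_monotone_convergence[OF f_int_n _ _ f_lim]) (use f_mono f_conv in auto)
  then have f_int: "integrable lborel f" and f_1: "(\<integral>x. f x \<partial>lborel) = 1"
    by (auto simp: has_bochner_integral_iff)
  have rd: "real_distribution (density lborel (\<lambda>x. ennreal (f x)))"
  proof (intro real_distribution.intro prob_spaceI real_distribution_axioms.intro)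
    have "emeasure (density lborel (\<lambda>x. ennreal (f x))) UNIV = (\<integral>\<^sup>+x. ennreal (f x) \<partial>lborel)"
      by (simp add: emeasure_density)
    also have "\<dots> = 1"
      using f_int f_1 f_nonneg by (subst nn_integral_eq_integral) auto
    finally show "emeasure (density lborel (\<lambda>x. ennreal (f x))) (space (density lborel (\<lambda>x. ennreal (f x)))) = 1"
      by simp
  qed simp
  have "char (density lborel (\<lambda>x. ennreal (f x))) t = \<phi> t" for t
  proof -
    have "(\<lambda>n. \<integral>x. F x * (cis (t * x) * of_real (exp (- (e n * x)\<^sup>2 / 2))) \<partial>lborel)
       \<longlonglongrightarrow> (\<integral>x. f x *\<^sub>R cis (t * x) \<partial>lborel)"
    proof (rule integral_dominated_convergence[OF _ _ f_int])
      show "AE x in lborel. norm (F x * (cis (t * x) * of_real (exp (- (e n * x)\<^sup>2 / 2)))) \<le> f x" for n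
        using f_nonneg by (intro AE_I2) (simp add: norm_mult mult_left_le Ff)
      show "AE x in lborel. (\<lambda>n. F x * (cis (t * x) * of_real (exp (- (e n * x)\<^sup>2 / 2)))) \<longlonglongrightarrow> f x *\<^sub>R cis (t * x)"
        using tendsto_mult[OF tendsto_const tendsto_mult[OF tendsto_const tendsto_of_real[OF g1]]]
        by (intro AE_I2) (fastforce simp: Ff scaleR_conv_of_real)
    qed measurable
    then have "(\<integral>x. f x *\<^sub>R cis (t * x) \<partial>lborel) = \<phi> t"
      using lim LIMSEQ_unique by blast
    then show ?thesis
      unfolding char_def using f_nonneg by (subst integral_density) (auto simp: cis_conv_exp)
  qed
  then show ?thesis using f_nonneg rd by (intro exI[of _ f]) auto
qed

section \<open>Regularity of the stable characteristic function in the parameter\<close>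

text \<open>Continuously differentiable functions on the line are obtained here from entire ones, so
  that removable singularities are settled in the complex plane.\<close>

lemma entire_restrict_real:
  assumes "f holomorphic_on UNIV"
  shows "((\<lambda>x. Re (f (of_real x))) has_real_derivative Re (deriv f (of_real x))) (at x)"
    and "isCont (\<lambda>x. Re (deriv f (of_real x))) x"
proof -
  have "(f has_field_derivative deriv f (of_real x)) (at (of_real x))"
    using assms by (simp add: holomorphic_derivI)
  then have "((\<lambda>x. f (of_real x)) has_vector_derivative deriv f (of_real x)) (at x)"
    by (rule has_vector_derivative_real_field)
  then show "((\<lambda>x. Re (f (of_real x))) has_real_derivative Re (deriv f (of_real x))) (at x)"
    unfolding has_real_derivative_iff_has_vector_derivative
    by (rule bounded_linear.has_vector_derivative[OF bounded_linear_Re])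
  have "continuous_on UNIV (\<lambda>x::real. Re (deriv f (of_real x)))"
    by (intro continuous_on_Re continuous_on_of_real continuous_on_id
          continuous_on_compose2[OF holomorphic_on_imp_continuous_on[OF holomorphic_deriv[OF assms open_UNIV]]]) auto
  then show "isCont (\<lambda>x. Re (deriv f (of_real x))) x"
    by (simp add: continuous_on_eq_continuous_at)
qed

section \<open>Entire quotients with a removable singularity at 0\<close>

definition expm1_quot :: "'a \<Rightarrow> 'a::{real_normed_field,banach}" where
  "expm1_quot x = (if x = 0 then 1 else (exp x - 1) / x)"

definition sin_quot :: "'a \<Rightarrow> 'a::{real_normed_field,banach}" where
  "sin_quot x = (if x = 0 then 1 else sin x / x)"

lemma holomorphic_expm1_quot: "(expm1_quot :: complex \<Rightarrow> complex) holomorphic_on UNIV"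
proof (rule pole_theorem_open_0[where a = 0 and g = "\<lambda>z. exp z - 1"])
  have "((\<lambda>z. exp z - 1) has_field_derivative 1) (at (0::complex))"
    by (auto intro!: derivative_eq_intros)
  then show "expm1_quot (0::complex) = deriv (\<lambda>z. exp z - 1) 0"
    by (simp add: expm1_quot_def DERIV_imp_deriv)
qed (auto simp: expm1_quot_def intro!: holomorphic_intros)

lemma holomorphic_sin_quot: "(sin_quot :: complex \<Rightarrow> complex) holomorphic_on UNIV"
proof (rule pole_theorem_open_0[where a = 0 and g = sin])
  have "(sin has_field_derivative 1) (at (0::complex))"
    by (auto intro!: derivative_eq_intros)
  then show "sin_quot (0::complex) = deriv sin 0"
    by (simp add: sin_quot_def DERIV_imp_deriv)
qed (auto simp: sin_quot_def intro!: holomorphic_intros)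

text \<open>The real derivatives are read off from the entire extension, so their continuity comes
  along.\<close>

definition expm1_quot' :: "real \<Rightarrow> real" where "expm1_quot' x = Re (deriv expm1_quot (of_real x))"
definition sin_quot' :: "real \<Rightarrow> real" where "sin_quot' x = Re (deriv sin_quot (of_real x))"

lemma expm1_quot_of_real: "Re (expm1_quot (complex_of_real x)) = expm1_quot x"
  by (simp add: expm1_quot_def Re_exp)

lemma sin_quot_of_real: "Re (sin_quot (complex_of_real x)) = sin_quot x"
  by (simp add: sin_quot_def sin_of_real flip: of_real_diff of_real_divide)

lemma DERIV_expm1_quot: "(expm1_quot has_real_derivative expm1_quot' x) (at x)"
  using entire_restrict_real(1)[OF holomorphic_expm1_quot, of x]
  by (simp add: expm1_quot_of_real expm1_quot'_def)

lemma DERIV_sin_quot: "(sin_quot has_real_derivative sin_quot' x) (at x)"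
  using entire_restrict_real(1)[OF holomorphic_sin_quot, of x]
  by (simp add: sin_quot_of_real sin_quot'_def)

lemma isCont_quot':
  "isCont expm1_quot' x" "isCont sin_quot' x"
  using entire_restrict_real(2)[OF holomorphic_sin_quot, of x] entire_restrict_real(2)[OF holomorphic_expm1_quot, of x]
  by (simp_all add: expm1_quot'_def[abs_def] sin_quot'_def[abs_def])

lemma has_derivative_quot [derivative_intros]:
  fixes f :: "'a::real_normed_vector \<Rightarrow> real"
  assumes "(f has_derivative f') (at x within S)"
  shows "((\<lambda>x. expm1_quot (f x)) has_derivative (\<lambda>h. f' h * expm1_quot' (f x))) (at x within S)"
    and "((\<lambda>x. sin_quot (f x)) has_derivative (\<lambda>h. f' h * sin_quot' (f x))) (at x within S)"
  using DERIV_compose_FDERIV[OF DERIV_expm1_quot assms] DERIV_compose_FDERIV[OF DERIV_sin_quot assms] .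

lemma continuous_on_quot [continuous_intros]:
  fixes f :: "'a::topological_space \<Rightarrow> real"
  assumes "continuous_on S f"
  shows "continuous_on S (\<lambda>x. expm1_quot (f x))" "continuous_on S (\<lambda>x. sin_quot (f x))"
    "continuous_on S (\<lambda>x. expm1_quot' (f x))" "continuous_on S (\<lambda>x. sin_quot' (f x))"
proof -
  have "continuous_on UNIV (expm1_quot :: real \<Rightarrow> real)" "continuous_on UNIV (sin_quot :: real \<Rightarrow> real)"
    "continuous_on UNIV expm1_quot'" "continuous_on UNIV sin_quot'"
    using DERIV_isCont[OF DERIV_expm1_quot] DERIV_isCont[OF DERIV_sin_quot] isCont_quot'
    by (auto simp: continuous_on_eq_continuous_at)
  then show "continuous_on S (\<lambda>x. expm1_quot (f x))" "continuous_on S (\<lambda>x. sin_quot (f x))"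
    "continuous_on S (\<lambda>x. expm1_quot' (f x))" "continuous_on S (\<lambda>x. sin_quot' (f x))"
    using assms by (auto intro: continuous_on_compose2)
qed

lemma sin_quot_pos:
  assumes "\<bar>x\<bar> < pi" shows "sin_quot x > (0::real)"
proof (cases "x > 0")
  case True
  then show ?thesis using assms sin_gt_zero[of x] by (simp add: sin_quot_def)
next
  case False
  then show ?thesis using assms sin_gt_zero[of "- x"]
    by (cases "x = 0") (auto simp: sin_quot_def divide_neg_neg)
qed

text \<open>
  The function \<open>(d, L) \<mapsto> cot (pi * d / 2) * (exp (d * L) - 1)\<close> with its removable singularity
  at \<open>d = 0\<close> filled in; here \<open>d\<close> stands for \<open>\<alpha> - 1\<close> and \<open>L\<close> for \<open>ln \<bar>\<sigma> u\<bar>\<close>.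
\<close>

definition skew :: "real \<Rightarrow> real \<Rightarrow> real" where
  "skew d L = cos (pi * d / 2) * L * expm1_quot (d * L) / (pi / 2 * sin_quot (pi * d / 2))"

text \<open>The quotient rule for the partial derivative in \<open>d\<close>; numerator over
  denominator has been folded back into \<open>skew\<close>.\<close>

definition skew_d :: "real \<Rightarrow> real \<Rightarrow> real" where
  "skew_d d L = ((cos (pi * d / 2) * L\<^sup>2 * expm1_quot' (d * L) - pi / 2 * sin (pi * d / 2) * L * expm1_quot (d * L))
       - skew d L * (pi / 2)\<^sup>2 * sin_quot' (pi * d / 2)) / (pi / 2 * sin_quot (pi * d / 2))"

definition skew_L :: "real \<Rightarrow> real \<Rightarrow> real" where
  "skew_L d L = cos (pi * d / 2) * (expm1_quot (d * L) + L * d * expm1_quot' (d * L)) / (pi / 2 * sin_quot (pi * d / 2))"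

lemma skew_zero: "skew 0 L = 2 / pi * L"
  by (simp add: skew_def expm1_quot_def sin_quot_def)

lemma tan_shifted: "tan (pi * (d + 1) / 2) = - (cos (pi * d / 2) / sin (pi * d / 2))"
proof -
  have "tan (pi * (d + 1) / 2) = tan (pi / 2 + pi * d / 2)" by (simp add: algebra_simps add_divide_distrib)
  also have "\<dots> = - (cos (pi * d / 2) / sin (pi * d / 2))"
    by (simp add: tan_def sin_add cos_add)
  finally show ?thesis .
qed

lemma skew_nonzero:
  assumes "d \<noteq> 0"
  shows "skew d L = - tan (pi * (d + 1) / 2) * (exp (d * L) - 1)"
  using assms unfolding tan_shifted by (simp add: skew_def expm1_quot_def sin_quot_def)

lemma sin_quot_ne: "\<bar>d\<bar> < 1 \<Longrightarrow> sin_quot (pi * d / 2) \<noteq> (0::real)"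
proof -
  assume "\<bar>d\<bar> < 1"
  then have "pi * \<bar>d\<bar> < pi * 2" using pi_gt_zero by (intro mult_strict_left_mono) auto
  then show ?thesis using sin_quot_pos[of "pi * d / 2"] by (auto simp: abs_mult)
qed

lemma has_derivative_skew [derivative_intros]:
  fixes f g :: "'a::real_normed_vector \<Rightarrow> real"
  assumes "(f has_derivative f') (at x within S)" "(g has_derivative g') (at x within S)"
    and "\<bar>f x\<bar> < 1"
  shows "((\<lambda>x. skew (f x) (g x)) has_derivative (\<lambda>h. f' h * skew_d (f x) (g x) + g' h * skew_L (f x) (g x))) (at x within S)"
proof -
  have ne: "sin_quot (pi * f x / 2) \<noteq> 0" using sin_quot_ne assms(3) by blast
  let ?A = "cos (pi * f x / 2) * (g x)\<^sup>2 * expm1_quot' (f x * g x) - pi / 2 * sin (pi * f x / 2) * g x * expm1_quot (f x * g x)"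
  let ?B = "cos (pi * f x / 2) * (expm1_quot (f x * g x) + g x * f x * expm1_quot' (f x * g x))"
  let ?E = "(pi / 2)\<^sup>2 * sin_quot' (pi * f x / 2)"
  let ?N = "cos (pi * f x / 2) * g x * expm1_quot (f x * g x)"
  let ?D = "pi / 2 * sin_quot (pi * f x / 2)"
  have N: "((\<lambda>x. cos (pi * f x / 2) * g x * expm1_quot (f x * g x)) has_derivative (\<lambda>h. f' h * ?A + g' h * ?B)) (at x within S)"
    using assms by (auto intro!: derivative_eq_intros simp: fun_eq_iff algebra_simps power2_eq_square)
  have D: "((\<lambda>x. pi / 2 * sin_quot (pi * f x / 2)) has_derivative (\<lambda>h. f' h * ?E)) (at x within S)"
    using assms by (auto intro!: derivative_eq_intros simp: fun_eq_iff algebra_simps power2_eq_square)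
  have "((a * A + b * B) * D - n * (a * E)) / (D * D) = a * ((A - n / D * E) / D) + b * (B / D)"
    if "D \<noteq> 0" for a b A B n D E :: real
    using that by (simp add: divide_simps) (simp add: algebra_simps)
  note alg = this[of ?D _ ?A _ ?B ?N ?E]
  have "((\<lambda>x. cos (pi * f x / 2) * g x * expm1_quot (f x * g x) / (pi / 2 * sin_quot (pi * f x / 2))) has_derivative
     (\<lambda>h. ((f' h * ?A + g' h * ?B) * ?D - ?N * (f' h * ?E)) / (?D * ?D))) (at x within S)"
    using ne by (intro has_derivative_divide'[OF N D]) simp
  then show ?thesis
    unfolding skew_def[abs_def, symmetric] using ne
    by (subst (asm) alg) (simp_all add: skew_d_def skew_L_def skew_def mult.assoc)
qed

text \<open>A logarithm of the characteristic function for \<open>u \<noteq> 0\<close>, in terms of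
  L = ln (\<sigma> |u|). The case distinction at \<alpha> = 1 is absorbed by
  \<open>skew\<close>.\<close>

definition stable_exponent :: "real ^ 4 \<Rightarrow> real \<Rightarrow> complex" where
  "stable_exponent \<theta> u = Complex (- exp (\<theta> $ 3 * ln (\<theta> $ 2 * \<bar>u\<bar>)))
     (\<theta> $ 1 * u - \<theta> $ 4 * \<theta> $ 2 * u * skew (\<theta> $ 3 - 1) (ln (\<theta> $ 2 * \<bar>u\<bar>)))"

lemma stable_cf_eq_exponent:
  assumes "\<theta> \<in> stable_param_interior" "u \<noteq> 0"
  shows "stable_cf \<theta> u = exp (stable_exponent \<theta> u)"
proof -
  define L where "L = ln (\<theta> $ 2 * \<bar>u\<bar>)"
  have \<sigma>: "\<theta> $ 2 > 0" and pos: "\<theta> $ 2 * \<bar>u\<bar> > 0" using assms by (auto simp: stable_param_interior_def)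
  have ab: "\<bar>\<theta> $ 2 * u\<bar> = exp L" using pos \<sigma> by (simp add: L_def abs_mult)
  have su: "\<theta> $ 2 * u = sgn u * exp L" using ab \<sigma> by (simp add: abs_mult mult.commute[of _ u]) (metis abs_mult_sgn mult.assoc mult.commute)
  have L: "ln (\<theta> $ 2 * \<bar>u\<bar>) = L" by (simp add: L_def)
  show ?thesis
  proof (cases "\<theta> $ 3 = 1")
    case True
    then show ?thesis
      unfolding stable_cf_def stable_exponent_def Let_def ab L
      by (simp add: skew_zero complex_eq_iff Re_exp Im_exp algebra_simps)
  next
    case False
    have e: "exp L powr (1 - \<theta> $ 3) = exp ((1 - \<theta> $ 3) * L)" "exp L powr \<theta> $ 3 = exp (\<theta> $ 3 * L)"
      by (simp_all add: powr_def)
    \<comment> \<open>In terms of v = |\<sigma> u|: v^\<alpha> (v^(1 - \<alpha>) - 1) = -v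
      (v^(\<alpha> - 1) - 1). This puts the tangent next to the factor that vanishes at \<alpha> =
      1.\<close>
    have key: "sgn u * exp L * (exp ((\<theta> $ 3 - 1) * L) - 1)
       = - (exp (\<theta> $ 3 * L) * sgn u * (exp ((1 - \<theta> $ 3) * L) - 1))"
      by (simp add: algebra_simps flip: exp_add)
    have "skew (\<theta> $ 3 - 1) L = - tan (pi * \<theta> $ 3 / 2) * (exp ((\<theta> $ 3 - 1) * L) - 1)"
      using False skew_nonzero[of "\<theta> $ 3 - 1" L] by simp
    then have "\<theta> $ 4 * \<theta> $ 2 * u * skew (\<theta> $ 3 - 1) L
       = - (\<theta> $ 4 * tan (pi * \<theta> $ 3 / 2)) * (\<theta> $ 2 * u * (exp ((\<theta> $ 3 - 1) * L) - 1))"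
      by (simp only: mult_minus_left mult_minus_right mult_ac)
    also have "\<dots> = - (\<theta> $ 4 * tan (pi * \<theta> $ 3 / 2)) * - (exp (\<theta> $ 3 * L) * sgn u * (exp ((1 - \<theta> $ 3) * L) - 1))"
      by (simp only: su key)
    also have "\<dots> = exp (\<theta> $ 3 * L) * (\<theta> $ 4 * sgn u * tan (pi * \<theta> $ 3 / 2) * (exp ((1 - \<theta> $ 3) * L) - 1))"
      by (simp only: mult_minus_left mult_minus_right minus_minus mult_ac)
    finally have im: "\<theta> $ 4 * \<theta> $ 2 * u * skew (\<theta> $ 3 - 1) L
        = exp (\<theta> $ 3 * L) * (\<theta> $ 4 * sgn u * tan (pi * \<theta> $ 3 / 2) * (exp ((1 - \<theta> $ 3) * L) - 1))" .
    show ?thesis using False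
      unfolding stable_cf_def stable_exponent_def Let_def ab L e im
      by (simp add: complex_eq_iff Re_exp Im_exp algebra_simps)
  qed
qed

text \<open>The differential of the exponent in direction \<open>h\<close>. In the imaginary part
  \<sigma> occurs both as a factor and inside L, with dL/d\<sigma> = 1/\<sigma>; hence the sum of
  \<open>skew\<close> and \<open>skew_L\<close> in the second component.\<close>

definition stable_exponent_partial :: "real ^ 4 \<Rightarrow> real \<Rightarrow> real ^ 4 \<Rightarrow> complex" where
  "stable_exponent_partial \<theta> u h = Complex
     (- exp (\<theta> $ 3 * ln (\<theta> $ 2 * \<bar>u\<bar>)) * (\<theta> $ 3 / \<theta> $ 2 * h $ 2 + ln (\<theta> $ 2 * \<bar>u\<bar>) * h $ 3))
     (u * h $ 1
       - \<theta> $ 4 * u * (skew (\<theta> $ 3 - 1) (ln (\<theta> $ 2 * \<bar>u\<bar>)) + skew_L (\<theta> $ 3 - 1) (ln (\<theta> $ 2 * \<bar>u\<bar>))) * h $ 2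
       - \<theta> $ 4 * \<theta> $ 2 * u * skew_d (\<theta> $ 3 - 1) (ln (\<theta> $ 2 * \<bar>u\<bar>)) * h $ 3
       - \<theta> $ 2 * u * skew (\<theta> $ 3 - 1) (ln (\<theta> $ 2 * \<bar>u\<bar>)) * h $ 4)"

lemma open_stable_param_interior: "open stable_param_interior"
  unfolding stable_param_interior_def
  by (intro open_Collect_conj open_Collect_less continuous_intros)

lemma has_derivative_stable_exponent:
  assumes "\<theta> \<in> stable_param_interior" "u \<noteq> 0"
  shows "((\<lambda>\<theta>. stable_exponent \<theta> u) has_derivative stable_exponent_partial \<theta> u) (at \<theta>)"
proof -
  have \<sigma>: "\<theta> $ 2 > 0" and pos: "\<theta> $ 2 * \<bar>u\<bar> > 0" and d: "\<bar>\<theta> $ 3 - 1\<bar> < 1"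
    using assms by (auto simp: stable_param_interior_def)
  note [derivative_intros] = bounded_linear.has_derivative[OF bounded_linear_vec_nth]
  have L: "((\<lambda>\<theta>::real^4. ln (\<theta> $ 2 * \<bar>u\<bar>)) has_derivative (\<lambda>h. h $ 2 / \<theta> $ 2)) (at \<theta>)"
    using pos \<sigma> assms(2) by (auto intro!: derivative_eq_intros simp: fun_eq_iff field_simps)
  have a: "((\<lambda>\<theta>::real^4. \<theta> $ 3 * ln (\<theta> $ 2 * \<bar>u\<bar>)) has_derivative
       (\<lambda>h. \<theta> $ 3 * (h $ 2 / \<theta> $ 2) + h $ 3 * ln (\<theta> $ 2 * \<bar>u\<bar>))) (at \<theta>)"
    by (intro has_derivative_mult L derivative_intros)
  have 1: "((\<lambda>\<theta>::real^4. - exp (\<theta> $ 3 * ln (\<theta> $ 2 * \<bar>u\<bar>))) has_derivative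
       (\<lambda>h. Re (stable_exponent_partial \<theta> u h))) (at \<theta>)"
    using has_derivative_minus[OF has_derivative_exp[OF a]]
    by (simp add: stable_exponent_partial_def Let_def algebra_simps)
  have d': "((\<lambda>\<theta>::real^4. \<theta> $ 3 - 1) has_derivative (\<lambda>h. h $ 3)) (at \<theta>)"
    by (auto intro!: derivative_eq_intros)
  note sk = has_derivative_skew[OF d' L d]
  let ?s = "skew (\<theta> $ 3 - 1) (ln (\<theta> $ 2 * \<bar>u\<bar>))"
  let ?sd = "skew_d (\<theta> $ 3 - 1) (ln (\<theta> $ 2 * \<bar>u\<bar>))"
  let ?sL = "skew_L (\<theta> $ 3 - 1) (ln (\<theta> $ 2 * \<bar>u\<bar>))"
  have "((\<lambda>\<theta>::real^4. \<theta> $ 1 * u - \<theta> $ 4 * \<theta> $ 2 * u * skew (\<theta> $ 3 - 1) (ln (\<theta> $ 2 * \<bar>u\<bar>))) has_derivative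
       (\<lambda>h. h $ 1 * u - (\<theta> $ 4 * \<theta> $ 2 * u * (h $ 3 * ?sd + h $ 2 / \<theta> $ 2 * ?sL) + (\<theta> $ 4 * h $ 2 + h $ 4 * \<theta> $ 2) * u * ?s))) (at \<theta>)"
    by (intro has_derivative_diff has_derivative_mult has_derivative_mult_left sk derivative_intros)
  moreover have "h $ 1 * u - (\<theta> $ 4 * \<theta> $ 2 * u * (h $ 3 * ?sd + h $ 2 / \<theta> $ 2 * ?sL) + (\<theta> $ 4 * h $ 2 + h $ 4 * \<theta> $ 2) * u * ?s)
     = Im (stable_exponent_partial \<theta> u h)" for h
  proof -
    have alg: "a * s * w * (c * d + y * l) = a * w * (s * c * d + (s * y) * l)" for a s w c d y l :: real
      by (simp add: algebra_simps)
    have "\<theta> $ 2 * (h $ 2 / \<theta> $ 2) = h $ 2" using \<sigma> by simp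
    then have "\<theta> $ 4 * \<theta> $ 2 * u * (h $ 3 * ?sd + h $ 2 / \<theta> $ 2 * ?sL) = \<theta> $ 4 * u * (\<theta> $ 2 * h $ 3 * ?sd + h $ 2 * ?sL)"
      using alg[of "\<theta> $ 4" "\<theta> $ 2" u "h $ 3" ?sd "h $ 2 / \<theta> $ 2" ?sL] by simp
    then show ?thesis
      by (simp add: stable_exponent_partial_def Let_def algebra_simps)
  qed
  ultimately have 2: "((\<lambda>\<theta>::real^4. \<theta> $ 1 * u - \<theta> $ 4 * \<theta> $ 2 * u * skew (\<theta> $ 3 - 1) (ln (\<theta> $ 2 * \<bar>u\<bar>))) has_derivative
       (\<lambda>h. Im (stable_exponent_partial \<theta> u h))) (at \<theta>)" by simp
  show ?thesis
    unfolding stable_exponent_def Complex_eq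
    using has_derivative_add[OF has_derivative_of_real[OF 1] has_derivative_mult_right[OF has_derivative_of_real[OF 2], of "\<i>"]]
    by (simp add: complex_eq[symmetric])
qed

lemma stable_cf_zero: "stable_cf \<theta> 0 = 1"
  by (simp add: stable_cf_def Let_def)

lemma norm_stable_cf_le_one:
  assumes "\<theta> \<in> stable_param_interior" shows "norm (stable_cf \<theta> u) \<le> 1"
  by (cases "u = 0") (auto simp: stable_cf_zero stable_cf_eq_exponent[OF assms] stable_exponent_def)

lemma has_derivative_stable_cf:
  assumes "\<theta> \<in> stable_param_interior" "u \<noteq> 0"
  shows "((\<lambda>\<theta>. stable_cf \<theta> u) has_derivative (\<lambda>h. stable_cf \<theta> u * stable_exponent_partial \<theta> u h)) (at \<theta>)"
proof (rule has_derivative_transform_within_open[OF _ open_stable_param_interior assms(1)])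
  show "((\<lambda>\<theta>. exp (stable_exponent \<theta> u)) has_derivative (\<lambda>h. stable_cf \<theta> u * stable_exponent_partial \<theta> u h)) (at \<theta>)"
    using has_derivative_compose[OF has_derivative_stable_exponent[OF assms] DERIV_exp[unfolded has_field_derivative_def]]
    by (simp add: stable_cf_eq_exponent[OF assms] mult.commute)
qed (use assms(2) in \<open>simp add: stable_cf_eq_exponent\<close>)

text \<open>The value \<open>u = 0\<close> is covered on purpose: second moments involve the
  frequency u_i - u_i.\<close>

lemma continuous_on_stable_cf [continuous_intros]:
  "continuous_on stable_param_interior (\<lambda>\<theta>. stable_cf \<theta> u)"
proof (cases "u = 0")
  case False
  then show ?thesis
    using has_derivative_stable_cf has_derivative_continuous
    by (intro continuous_at_imp_continuous_on) blast
qed (simp add: stable_cf_zero)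

lemma continuous_on_skew [continuous_intros]:
  fixes f g :: "'a::t2_space \<Rightarrow> real"
  assumes "continuous_on S f" "continuous_on S g" "\<And>x. x \<in> S \<Longrightarrow> \<bar>f x\<bar> < 1"
  shows "continuous_on S (\<lambda>x. skew (f x) (g x))" "continuous_on S (\<lambda>x. skew_d (f x) (g x))"
    "continuous_on S (\<lambda>x. skew_L (f x) (g x))"
proof -
  have ne: "pi / 2 * sin_quot (pi * f x / 2) \<noteq> 0" if "x \<in> S" for x
    using sin_quot_ne[OF assms(3)[OF that]] by simp
  show s: "continuous_on S (\<lambda>x. skew (f x) (g x))"
    unfolding skew_def by (intro continuous_intros assms(1,2)) (use ne in auto)
  show "continuous_on S (\<lambda>x. skew_d (f x) (g x))" "continuous_on S (\<lambda>x. skew_L (f x) (g x))"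
    unfolding skew_d_def skew_L_def by (intro continuous_intros assms(1,2) s; use ne in auto)+
qed

lemma continuous_on_Complex [continuous_intros]:
  assumes "continuous_on S f" "continuous_on S g"
  shows "continuous_on S (\<lambda>x. Complex (f x) (g x))"
  unfolding Complex_eq by (intro continuous_intros assms)

lemma continuous_on_stable_exponent_partial [continuous_intros]:
  assumes "u \<noteq> 0"
  shows "continuous_on stable_param_interior (\<lambda>\<theta>. stable_exponent_partial \<theta> u h)"
  unfolding stable_exponent_partial_def
  by (intro continuous_intros) (use assms in \<open>auto simp: stable_param_interior_def\<close>)

section \<open>Jacobian of the moment map and its rank\<close>

lemma partial_deriv_eq:
  assumes "(F has_derivative F') (at \<theta>)"
  shows "partial_deriv l F \<theta> = F' (axis l 1)"
proof -
  have lin: "linear F'" using assms has_derivative_linear by blast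
  have eq: "(\<lambda>t. F' (t *\<^sub>R axis l 1)) = (*) (F' (axis l 1))"
    by (simp add: fun_eq_iff linear_scale[OF lin] mult.commute)
  have "((\<lambda>t. F (\<theta> + t *\<^sub>R axis l 1)) has_derivative (\<lambda>t. F' (t *\<^sub>R axis l 1))) (at 0)"
  proof (rule has_derivative_compose[where g = F])
    show "((\<lambda>t. \<theta> + t *\<^sub>R axis l 1) has_derivative (\<lambda>t. t *\<^sub>R axis l 1)) (at (0::real))"
      by (auto intro!: derivative_eq_intros)
    show "(F has_derivative F') (at (\<theta> + 0 *\<^sub>R axis l 1))" using assms by simp
  qed
  then have "((\<lambda>t. F (\<theta> + t *\<^sub>R axis l 1)) has_real_derivative F' (axis l 1)) (at 0)"
    by (simp add: has_field_derivative_def eq)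
  then show ?thesis unfolding partial_deriv_def by (rule DERIV_imp_deriv)
qed

text \<open>The moment map read off from the characteristic function, which allows its calculus to
  precede the existence of densities; \<open>trig_mean_eq\<close> makes the identification.\<close>

definition trig_cf :: "real ^ 'k \<Rightarrow> real ^ 4 \<Rightarrow> real ^ ('k::finite + 'k)" where
  "trig_cf u \<theta> = (\<chi> i. case i of Inl j \<Rightarrow> Re (stable_cf \<theta> (u $ j)) | Inr j \<Rightarrow> Im (stable_cf \<theta> (u $ j)))"

lemma has_derivative_Re_Im_stable_cf:
  assumes "\<theta> \<in> stable_param_interior" "u \<noteq> 0"
  shows "((\<lambda>\<theta>. Re (stable_cf \<theta> u)) has_derivative (\<lambda>h. Re (stable_cf \<theta> u * stable_exponent_partial \<theta> u h))) (at \<theta>)"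
    and "((\<lambda>\<theta>. Im (stable_cf \<theta> u)) has_derivative (\<lambda>h. Im (stable_cf \<theta> u * stable_exponent_partial \<theta> u h))) (at \<theta>)"
  using bounded_linear.has_derivative[OF bounded_linear_Re has_derivative_stable_cf[OF assms]]
    bounded_linear.has_derivative[OF bounded_linear_Im has_derivative_stable_cf[OF assms]] by auto

lemma trig_mean_deriv_entries:
  fixes u :: "real ^ 'k::finite"
  assumes "\<theta> \<in> stable_param_interior" "\<And>j. u $ j \<noteq> 0"
  shows "trig_mean_deriv u \<theta> $ l $ Inl j = Re (stable_cf \<theta> (u $ j) * stable_exponent_partial \<theta> (u $ j) (axis l 1))"
    and "trig_mean_deriv u \<theta> $ l $ Inr j = Im (stable_cf \<theta> (u $ j) * stable_exponent_partial \<theta> (u $ j) (axis l 1))"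
  using partial_deriv_eq[OF has_derivative_Re_Im_stable_cf(1)[OF assms]]
    partial_deriv_eq[OF has_derivative_Re_Im_stable_cf(2)[OF assms]]
  unfolding trig_mean_deriv_def by simp_all

lemma linear_sum_axis:
  fixes f :: "real ^ 'n \<Rightarrow> 'b::real_vector"
  assumes "linear f"
  shows "(\<Sum>l\<in>UNIV. h $ l *\<^sub>R f (axis l 1)) = f h"
proof -
  have "f h = f (\<Sum>l\<in>UNIV. h $ l *\<^sub>R axis l 1)"
    using basis_expansion[of h] by (simp add: scalar_mult_eq_scaleR)
  also have "\<dots> = (\<Sum>l\<in>UNIV. h $ l *\<^sub>R f (axis l 1))"
    by (simp add: linear_sum[OF assms] linear_scale[OF assms])
  finally show ?thesis by simp
qed

text \<open>The combination of the four partial derivatives with weights \<open>h\<close> is a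
  directional derivative, by linearity of the differential.\<close>

lemma trig_mean_deriv_transpose_mult:
  fixes u :: "real ^ 'k::finite"
  assumes "\<theta> \<in> stable_param_interior" "\<And>j. u $ j \<noteq> 0"
  shows "(transpose (trig_mean_deriv u \<theta>) *v h) $ Inl j = Re (stable_cf \<theta> (u $ j) * stable_exponent_partial \<theta> (u $ j) h)"
    and "(transpose (trig_mean_deriv u \<theta>) *v h) $ Inr j = Im (stable_cf \<theta> (u $ j) * stable_exponent_partial \<theta> (u $ j) h)"
proof -
  note lin = has_derivative_linear[OF has_derivative_Re_Im_stable_cf(1)[OF assms]]
    has_derivative_linear[OF has_derivative_Re_Im_stable_cf(2)[OF assms]]
  show "(transpose (trig_mean_deriv u \<theta>) *v h) $ Inl j = Re (stable_cf \<theta> (u $ j) * stable_exponent_partial \<theta> (u $ j) h)"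
    using linear_sum_axis[OF lin(1)[of j], of h]
    by (simp only: matrix_vector_mult_def vec_lambda_beta transpose_def trig_mean_deriv_entries[OF assms] real_scaleR_def mult.commute)
  show "(transpose (trig_mean_deriv u \<theta>) *v h) $ Inr j = Im (stable_cf \<theta> (u $ j) * stable_exponent_partial \<theta> (u $ j) h)"
    using linear_sum_axis[OF lin(2)[of j], of h]
    by (simp only: matrix_vector_mult_def vec_lambda_beta transpose_def trig_mean_deriv_entries[OF assms] real_scaleR_def mult.commute)
qed

lemma has_derivative_trig_cf:
  fixes u :: "real ^ 'k::finite"
  assumes "\<theta> \<in> stable_param_interior" "\<And>j. u $ j \<noteq> 0"
  shows "(trig_cf u has_derivative (\<lambda>h. transpose (trig_mean_deriv u \<theta>) *v h)) (at \<theta>)"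
proof (subst has_derivative_componentwise_within, intro ballI)
  fix b :: "real ^ ('k + 'k)" assume "b \<in> Basis"
  then obtain i where b: "b = axis i 1" by (auto simp: Basis_vec_def)
  show "((\<lambda>\<theta>. trig_cf u \<theta> \<bullet> b) has_derivative (\<lambda>h. (transpose (trig_mean_deriv u \<theta>) *v h) \<bullet> b)) (at \<theta>)"
    unfolding b cart_eq_inner_axis[symmetric]
    by (cases i) (simp_all only: trig_cf_def vec_lambda_beta sum.case trig_mean_deriv_transpose_mult[OF assms] has_derivative_Re_Im_stable_cf[OF assms])
qed

lemma continuous_on_trig_mean_deriv:
  fixes u :: "real ^ 'k::finite"
  assumes "\<And>j. u $ j \<noteq> 0"
  shows "continuous_on stable_param_interior (trig_mean_deriv u)"
proof -
  have "continuous_on stable_param_interior (\<lambda>\<theta>. trig_mean_deriv u \<theta> $ l $ i)" for l i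
  proof (cases i)
    case (Inl j)
    have "continuous_on stable_param_interior (\<lambda>\<theta>. Re (stable_cf \<theta> (u $ j) * stable_exponent_partial \<theta> (u $ j) (axis l 1)))"
      using assms by (intro continuous_intros) auto
    then show ?thesis unfolding Inl
      by (rule continuous_on_eq) (simp only: trig_mean_deriv_entries[OF _ assms])
  next
    case (Inr j)
    have "continuous_on stable_param_interior (\<lambda>\<theta>. Im (stable_cf \<theta> (u $ j) * stable_exponent_partial \<theta> (u $ j) (axis l 1)))"
      using assms by (intro continuous_intros) auto
    then show ?thesis unfolding Inr
      by (rule continuous_on_eq) (simp only: trig_mean_deriv_entries[OF _ assms])
  qed
  then have "continuous_on stable_param_interior (\<lambda>\<theta>. \<chi> l i. trig_mean_deriv u \<theta> $ l $ i)"
    by (intro continuous_on_vec_lambda)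
  then show ?thesis by (simp add: vec_lambda_eta)
qed

text \<open>For \<open>d = 0\<close> the function is linear in L, otherwise a nonzero multiple of
  exp (d L) - 1; the bound on \<open>d\<close> keeps the cosine in that multiple away from
  0.\<close>

lemma skew_inj_L:
  assumes "\<bar>d\<bar> < 1" "L \<noteq> L'" shows "skew d L \<noteq> skew d L'"
proof (cases "d = 0")
  case True
  then show ?thesis using assms by (simp add: skew_zero)
next
  case False
  have "cos (pi * d / 2) > 0"
  proof (rule cos_gt_zero_pi)
    have "pi * d < pi * 1" "pi * (-1) < pi * d"
      using assms(1) pi_gt_zero mult_strict_left_mono[of "- 1" d pi] mult_strict_left_mono[of d 1 pi] by auto
    then show "- (pi / 2) < pi * d / 2" "pi * d / 2 < pi / 2" by auto
  qed
  moreover have "sin (pi * d / 2) \<noteq> 0"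
    using sin_quot_ne[OF assms(1)] False by (auto simp: sin_quot_def)
  ultimately have "tan (pi * (d + 1) / 2) \<noteq> 0" by (simp add: tan_shifted)
  moreover have "exp (d * L) \<noteq> exp (d * L')" using False assms(2) by simp
  ultimately show ?thesis using False by (simp add: skew_nonzero)
qed

text \<open>The characteristic function has no zeros, so the differential of the exponent vanishes
  at every frequency. Its real part is affine in L; two different values of L force the \<alpha> and
  then the \<sigma> component to be 0. In the imaginary part there remain \<mu> and \<beta>,
  separated by injectivity of \<open>skew\<close> in L.\<close>

lemma trig_mean_deriv_rank:
  fixes u :: "real ^ 'k::finite"
  assumes "\<theta> \<in> stable_param_interior" "\<And>j. u $ j \<noteq> 0" "i \<noteq> j" "\<bar>u $ i\<bar> \<noteq> \<bar>u $ j\<bar>"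
    and zero: "transpose (trig_mean_deriv u \<theta>) *v h = 0"
  shows "h = 0"
proof -
  have \<sigma>: "\<theta> $ 2 > 0" and d: "\<bar>\<theta> $ 3 - 1\<bar> < 1" and a: "\<theta> $ 3 > 0" using assms(1) by (auto simp: stable_param_interior_def)
  have z: "stable_exponent_partial \<theta> (u $ j) h = 0" for j
  proof -
    have "stable_cf \<theta> (u $ j) * stable_exponent_partial \<theta> (u $ j) h = 0"
      using trig_mean_deriv_transpose_mult[OF assms(1,2), of h j] unfolding zero
      by (simp add: complex_eq_iff)
    then show ?thesis using assms(1,2) by (simp add: stable_cf_eq_exponent)
  qed
  define L where "L j = ln (\<theta> $ 2 * \<bar>u $ j\<bar>)" for j
  have ne: "L i \<noteq> L j" unfolding L_def using \<sigma> assms(2,4) by (subst ln_inj_iff) auto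
  have re: "\<theta> $ 3 / \<theta> $ 2 * h $ 2 + L j * h $ 3 = 0" for j
    using z[of j] by (simp add: stable_exponent_partial_def complex_eq_iff L_def)
  have "(L i - L j) * h $ 3 = 0" unfolding left_diff_distrib using re[of i] re[of j] by linarith
  then have h3: "h $ 3 = 0" using ne by simp
  then have h2: "h $ 2 = 0" using re[of i] \<sigma> a by simp
  have im: "h $ 1 - \<theta> $ 2 * skew (\<theta> $ 3 - 1) (L j) * h $ 4 = 0" for j
  proof -
    have "u $ j * h $ 1 - \<theta> $ 2 * u $ j * skew (\<theta> $ 3 - 1) (L j) * h $ 4 = 0"
      using z[of j] h2 h3 by (simp add: stable_exponent_partial_def complex_eq_iff L_def)
    then have "u $ j * (h $ 1 - \<theta> $ 2 * skew (\<theta> $ 3 - 1) (L j) * h $ 4) = 0"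
      by (simp add: algebra_simps)
    then show ?thesis using assms(2)[of j] by (simp only: mult_eq_0_iff simp_thms)
  qed
  have "\<theta> $ 2 * (skew (\<theta> $ 3 - 1) (L i) - skew (\<theta> $ 3 - 1) (L j)) * h $ 4 = 0"
    unfolding right_diff_distrib left_diff_distrib using im[of i] im[of j] by linarith
  then have h4: "h $ 4 = 0" using skew_inj_L[OF d ne] \<sigma> by simp
  then have h1: "h $ 1 = 0" using im[of i] by simp
  show ?thesis using h1 h2 h3 h4 by (simp add: vec_eq_iff forall_4)
qed

section \<open>Existence of the stable density\<close>

text \<open>The principal logarithm of -i x is ln |x| - i (pi / 2) sgn x.\<close>

lemma minus_ii_powr:
  fixes x a :: real
  assumes "x \<noteq> 0"
  shows "(- \<i> * of_real x) powr of_real a = of_real (\<bar>x\<bar> powr a) * cis (- (pi * a / 2) * sgn x)"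
proof -
  define z where "z = Complex (ln \<bar>x\<bar>) (- (pi / 2) * sgn x)"
  have "exp z = - \<i> * of_real x"
    using assms by (cases "x > 0") (auto simp: z_def complex_eq_iff Re_exp Im_exp)
  moreover have "Ln (exp z) = z"
    using assms pi_gt_zero order_trans[of "- (pi / 2)" 0 pi] by (intro Ln_exp) (auto simp: z_def sgn_if)
  ultimately have "(- \<i> * of_real x) powr of_real a = exp (of_real a * z)"
    using assms by (metis exp_not_eq_zero powr_def)
  also have "\<dots> = of_real (\<bar>x\<bar> powr a) * cis (- (pi * a / 2) * sgn x)"
    using assms by (simp add: z_def complex_eq_iff Re_exp Im_exp powr_def algebra_simps)
  finally show ?thesis .
qed

text \<open>The sign of cos (pi a / 2) changes at a = 1, matching the opposite signs of the
  exponents in \<open>fourier_multiplier_lower\<close> and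
  \<open>fourier_multiplier_upper\<close>.\<close>

lemma fourier_multiplier_one_sided:
  fixes a c s :: real
  assumes a: "0 < a" "a < 2" "a \<noteq> 1" and c: "c \<ge> 0"
  shows "fourier_multiplier (\<lambda>u. exp (- of_real (c / cos (pi * a / 2)) * (- \<i> * of_real (s * u)) powr of_real a))"
proof (cases "a < 1")
  case True
  have "pi * a < pi * 1" using True pi_gt_zero by (intro mult_strict_left_mono) auto
  then have "cos (pi * a / 2) > 0" using a by (intro cos_gt_zero) auto
  then show ?thesis using fourier_multiplier_lower[OF a(1) True, of "c / cos (pi * a / 2)" s] c by simp
next
  case False
  have "pi * 1 < pi * a" "pi * a < pi * 2" using False a pi_gt_zero by (auto intro!: mult_strict_left_mono)
  then have "cos (pi - pi * a / 2) > 0" by (intro cos_gt_zero) auto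
  then have "cos (pi * a / 2) < 0" by simp
  then show ?thesis using fourier_multiplier_upper[of a "- c / cos (pi * a / 2)" s] c False a
    by (simp add: divide_nonneg_neg)
qed

text \<open>The law is a convolution of two totally skewed laws in opposite directions, with weights
  (1 + \<beta>)/2 and (1 - \<beta>)/2, and a shift. The part -\<beta> \<sigma> tan (pi \<alpha> / 2)
  of the shift stems from the term |\<sigma> u|^(1 - \<alpha>) of the continuous
  parametrisation.\<close>

lemma fourier_multiplier_stable_cf_ne_one:
  assumes "\<theta> \<in> stable_param_interior" "\<theta> $ 3 \<noteq> 1"
  shows "fourier_multiplier (stable_cf \<theta>)"
proof -
  define \<mu> \<sigma> \<alpha> \<beta> where p: "\<mu> = \<theta> $ 1" "\<sigma> = \<theta> $ 2" "\<alpha> = \<theta> $ 3" "\<beta> = \<theta> $ 4"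
  have r: "\<sigma> > 0" "0 < \<alpha>" "\<alpha> < 2" "\<alpha> \<noteq> 1" "-1 < \<beta>" "\<beta> < 1"
    using assms by (auto simp: stable_param_interior_def p)
  define C where "C = cos (pi * \<alpha> / 2)"
  define T where "T = tan (pi * \<alpha> / 2)"
  have C: "C \<noteq> 0"
  proof (cases "\<alpha> < 1")
    case True
    have "pi * \<alpha> < pi * 1" using True pi_gt_zero by (intro mult_strict_left_mono) auto
    then have "C > 0" unfolding C_def using r by (intro cos_gt_zero) auto
    then show ?thesis by simp
  next
    case False
    have "pi * 1 < pi * \<alpha>" "pi * \<alpha> < pi * 2" using False r pi_gt_zero by (auto intro!: mult_strict_left_mono)
    then have "cos (pi - pi * \<alpha> / 2) > 0" by (intro cos_gt_zero) auto
    then show ?thesis by (simp add: C_def)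
  qed
  have S: "sin (pi * \<alpha> / 2) = T * C" using C by (simp add: T_def C_def tan_def)
  define c where "c s = \<sigma> powr \<alpha> * (1 + s * \<beta>) / 2" for s
  have c: "c 1 \<ge> 0" "c (-1) \<ge> 0" using r by (auto simp: c_def)
  have eq: "stable_cf \<theta> u = exp (- of_real (c 1 / C) * (- \<i> * of_real (1 * u)) powr of_real \<alpha>)
       * exp (- of_real (c (-1) / C) * (- \<i> * of_real (- 1 * u)) powr of_real \<alpha>)
       * cis ((\<mu> - \<beta> * T * \<sigma>) * u)" for u
  proof (cases "u = 0")
    case False
    define P where "P = \<bar>u\<bar> powr \<alpha>"
    define Q where "Q = \<sigma> powr \<alpha> * P"
    have ab: "\<bar>\<sigma> * u\<bar> powr \<alpha> = Q" using r by (simp add: abs_mult powr_mult P_def Q_def)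
    have ab1: "\<bar>\<sigma> * u\<bar> powr (1 - \<alpha>) = \<sigma> * \<bar>u\<bar> / Q"
      using r False ab by (simp add: powr_diff abs_mult)
    have Q: "Q > 0" using r False by (simp add: Q_def P_def)
    have m: "(- \<i> * of_real (1 * u)) powr of_real \<alpha> = of_real P * (of_real C - \<i> * of_real (sgn u * T * C))"
      "(- \<i> * of_real (- 1 * u)) powr of_real \<alpha> = of_real P * (of_real C + \<i> * of_real (sgn u * T * C))"
      using False minus_ii_powr[of "1 * u" \<alpha>] minus_ii_powr[of "- 1 * u" \<alpha>] S
      by (auto simp: P_def C_def complex_eq_iff sgn_if)
    have "stable_cf \<theta> u = exp (- of_real Q * (1 + \<i> * of_real (\<beta> * sgn u * T * (\<sigma> * \<bar>u\<bar> / Q - 1))) + \<i> * of_real (\<mu> * u))"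
      using r(4) unfolding stable_cf_def Let_def p[symmetric] ab ab1 T_def by simp
    also have "- of_real Q * (1 + \<i> * of_real (\<beta> * sgn u * T * (\<sigma> * \<bar>u\<bar> / Q - 1))) + \<i> * of_real (\<mu> * u)
       = - of_real (c 1 / C) * (of_real P * (of_real C - \<i> * of_real (sgn u * T * C)))
         + - of_real (c (-1) / C) * (of_real P * (of_real C + \<i> * of_real (sgn u * T * C)))
         + \<i> * of_real ((\<mu> - \<beta> * T * \<sigma>) * u)" (is "?l = ?r")
    proof (rule complex_eqI)
      have re: "c 1 + c (-1) = \<sigma> powr \<alpha>" and im: "c 1 - c (-1) = \<sigma> powr \<alpha> * \<beta>" by (auto simp: c_def field_simps)
      have "Re ?r = - (c 1 + c (-1)) * P" using C by (simp add: algebra_simps)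
      then show "Re ?l = Re ?r" unfolding re by (simp add: Q_def)
      have d: "sgn u * \<bar>u\<bar> = u" by (simp add: sgn_if)
      have "Im ?l = - (\<beta> * T * \<sigma>) * (sgn u * \<bar>u\<bar>) + Q * \<beta> * sgn u * T + \<mu> * u"
        using Q by (simp add: field_simps)
      also have "\<dots> = (\<sigma> powr \<alpha> * \<beta>) * P * sgn u * T + (\<mu> - \<beta> * T * \<sigma>) * u"
        unfolding d Q_def by (simp add: algebra_simps)
      also have "\<dots> = Im ?r"
        unfolding im[symmetric] using C by (simp add: field_simps)
      finally show "Im ?l = Im ?r" .
    qed
    finally show ?thesis unfolding m by (simp only: exp_add cis_conv_exp)
  qed (simp add: stable_cf_zero)
  have "fourier_multiplier (\<lambda>u. exp (- of_real (c 1 / C) * (- \<i> * of_real (1 * u)) powr of_real \<alpha>)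
       * exp (- of_real (c (-1) / C) * (- \<i> * of_real (- 1 * u)) powr of_real \<alpha>)
       * cis ((\<mu> - \<beta> * T * \<sigma>) * u))"
    unfolding C_def by (intro fourier_multiplier_mult fourier_multiplier_one_sided fourier_multiplier_cis r c)
  then show ?thesis unfolding eq[symmetric] .
qed

lemma fourier_multiplier_stable_cf:
  assumes \<theta>: "\<theta> \<in> stable_param_interior"
  shows "fourier_multiplier (stable_cf \<theta>)"
proof (cases "\<theta> $ 3 = 1")
  case True
  \<comment> \<open>The factor 2 keeps the third component at most 3/2, hence the sequence inside
    the parameter set.\<close>
  define t where "t n = \<theta> + (1 / (2 * real (Suc n))) *\<^sub>R axis 3 1" for n
  have t_nth: "t n $ 3 = 1 + 1 / (2 * real (Suc n))" "i \<noteq> 3 \<Longrightarrow> t n $ i = \<theta> $ i" for n i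
    using True by (auto simp: t_def axis_def)
  have sm: "1 / (2 * real (Suc n)) < 1" "0 < 1 / (2 * real (Suc n))" for n by (auto simp: field_simps)
  have t_in: "t n \<in> stable_param_interior" for n
    using \<theta> sm[of n] unfolding stable_param_interior_def mem_Collect_eq t_nth(1)
    by (simp add: t_nth(2) add_pos_pos del: of_nat_Suc)
  have "(\<lambda>n. 1 / 2 * (1 / real (Suc n))) \<longlonglongrightarrow> 1 / 2 * 0"
    by (intro tendsto_mult tendsto_const LIMSEQ_Suc[OF lim_1_over_n])
  then have "(\<lambda>n. 1 / (2 * real (Suc n))) \<longlonglongrightarrow> 0" by simp
  then have "(\<lambda>n. \<theta> + (1 / (2 * real (Suc n))) *\<^sub>R axis 3 1) \<longlonglongrightarrow> \<theta> + 0 *\<^sub>R axis 3 1"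
    by (intro tendsto_intros)
  then have "t \<longlonglongrightarrow> \<theta>" by (simp add: t_def[abs_def])
  then have "(\<lambda>n. stable_cf (t n) u) \<longlonglongrightarrow> stable_cf \<theta> u" for u
    by (rule continuous_on_tendsto_compose[OF continuous_on_stable_cf _ \<theta>]) (simp add: t_in)
  then show ?thesis
  proof (rule fourier_multiplier_lim[rotated 2])
    show "fourier_multiplier (stable_cf (t n))" for n
    proof (rule fourier_multiplier_stable_cf_ne_one[OF t_in])
      show "t n $ 3 \<noteq> 1" using sm(2)[of n] t_nth(1)[of n] by linarith
    qed
    show "norm (stable_cf (t n) u) \<le> 1" for n u
      by (rule norm_stable_cf_le_one[OF t_in])
  qed
qed (use fourier_multiplier_stable_cf_ne_one \<theta> in blast)

text \<open>Only u = 0 is delicate, since L tends to minus infinity there. Besides linear terms the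
  imaginary part contains u ln (\<sigma> |u|) if \<alpha> = 1, and otherwise a multiple of a term of
  modulus |\<sigma> u|^\<alpha>; both vanish in the limit.\<close>

lemma continuous_on_stable_cf_u:
  assumes \<theta>: "\<theta> \<in> stable_param_interior"
  shows "continuous_on UNIV (stable_cf \<theta>)"
proof -
  have r: "\<theta> $ 2 > 0" "0 < \<theta> $ 3" "\<theta> $ 3 < 2" using \<theta> by (auto simp: stable_param_interior_def)
  have "isCont (stable_cf \<theta>) u" for u
  proof (cases "u = 0")
    case False
    have "continuous_on (- {0}) (\<lambda>u. exp (stable_exponent \<theta> u))"
      unfolding stable_exponent_def using r by (intro continuous_intros) auto
    then have "continuous_on (- {0}) (stable_cf \<theta>)"
      by (rule continuous_on_eq) (simp add: stable_cf_eq_exponent[OF \<theta>])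
    then show ?thesis using False by (simp add: continuous_on_eq_continuous_at open_Compl)
  next
    case True
    have a: "((\<lambda>u. \<bar>\<theta> $ 2 * u\<bar> powr \<theta> $ 3) \<longlongrightarrow> 0) (at 0)"
    proof -
      have "((\<lambda>u. \<bar>\<theta> $ 2 * u\<bar> powr \<theta> $ 3) \<longlongrightarrow> \<bar>\<theta> $ 2 * 0\<bar> powr \<theta> $ 3) (at 0)"
        using r by (intro tendsto_powr' tendsto_intros) auto
      then show ?thesis using r by simp
    qed
    have pw: "exp (\<theta> $ 3 * ln (\<theta> $ 2 * \<bar>u\<bar>)) = \<bar>\<theta> $ 2 * u\<bar> powr \<theta> $ 3" if "u \<noteq> 0" for u
      using r that by (simp add: powr_def abs_mult)
    have re: "((\<lambda>u. - exp (\<theta> $ 3 * ln (\<theta> $ 2 * \<bar>u\<bar>))) \<longlongrightarrow> - 0) (at 0)"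
      by (rule tendsto_minus, rule Lim_transform_eventually[OF a]) (auto simp: eventually_at_filter pw)
    have "((\<lambda>u. \<theta> $ 1 * u - \<theta> $ 4 * \<theta> $ 2 * u * skew (\<theta> $ 3 - 1) (ln (\<theta> $ 2 * \<bar>u\<bar>))) \<longlongrightarrow> 0) (at 0)"
    proof (cases "\<theta> $ 3 = 1")
      case True
      have "((\<lambda>u. u * ln (\<theta> $ 2 * \<bar>u\<bar>)) \<longlongrightarrow> 0) (at 0)"
        using r(1) by real_asymp
      then have "((\<lambda>u. \<theta> $ 1 * u - \<theta> $ 4 * \<theta> $ 2 * (2 / pi) * (u * ln (\<theta> $ 2 * \<bar>u\<bar>))) \<longlongrightarrow> \<theta> $ 1 * 0 - \<theta> $ 4 * \<theta> $ 2 * (2 / pi) * 0) (at 0)"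
        by (intro tendsto_intros)
      then show ?thesis using True by (simp add: skew_zero mult_ac)
    next
      case False
      have "((\<lambda>u. \<theta> $ 2 * u * exp ((\<theta> $ 3 - 1) * ln (\<theta> $ 2 * \<bar>u\<bar>))) \<longlongrightarrow> 0) (at 0)"
      proof (rule Lim_null_comparison[OF _ a])
        have "norm (\<theta> $ 2 * u * exp ((\<theta> $ 3 - 1) * ln (\<theta> $ 2 * \<bar>u\<bar>))) \<le> \<bar>\<theta> $ 2 * u\<bar> powr \<theta> $ 3" if "u \<noteq> 0" for u
        proof -
          have "norm (\<theta> $ 2 * u * exp ((\<theta> $ 3 - 1) * ln (\<theta> $ 2 * \<bar>u\<bar>))) = exp (ln (\<theta> $ 2 * \<bar>u\<bar>)) * exp ((\<theta> $ 3 - 1) * ln (\<theta> $ 2 * \<bar>u\<bar>))"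
            using r that by (simp add: abs_mult)
          also have "\<dots> = exp (\<theta> $ 3 * ln (\<theta> $ 2 * \<bar>u\<bar>))"
            by (simp add: algebra_simps flip: exp_add)
          finally show ?thesis using pw[OF that] by simp
        qed
        then show "\<forall>\<^sub>F u in at 0. norm (\<theta> $ 2 * u * exp ((\<theta> $ 3 - 1) * ln (\<theta> $ 2 * \<bar>u\<bar>))) \<le> \<bar>\<theta> $ 2 * u\<bar> powr \<theta> $ 3"
          by (simp add: eventually_at_filter)
      qed
      then have "((\<lambda>u. \<theta> $ 1 * u + \<theta> $ 4 * tan (pi * \<theta> $ 3 / 2) * (\<theta> $ 2 * u * exp ((\<theta> $ 3 - 1) * ln (\<theta> $ 2 * \<bar>u\<bar>)) - \<theta> $ 2 * u))
          \<longlongrightarrow> \<theta> $ 1 * 0 + \<theta> $ 4 * tan (pi * \<theta> $ 3 / 2) * (0 - \<theta> $ 2 * 0)) (at 0)"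
        by (intro tendsto_intros)
      moreover have "\<theta> $ 1 * u + \<theta> $ 4 * tan (pi * \<theta> $ 3 / 2) * (\<theta> $ 2 * u * exp ((\<theta> $ 3 - 1) * ln (\<theta> $ 2 * \<bar>u\<bar>)) - \<theta> $ 2 * u)
        = \<theta> $ 1 * u - \<theta> $ 4 * \<theta> $ 2 * u * skew (\<theta> $ 3 - 1) (ln (\<theta> $ 2 * \<bar>u\<bar>))" for u
        using False skew_nonzero[of "\<theta> $ 3 - 1" "ln (\<theta> $ 2 * \<bar>u\<bar>)"] by (simp add: right_diff_distrib mult_ac)
      ultimately show ?thesis by simp
    qed
    then have "((\<lambda>u. stable_exponent \<theta> u) \<longlongrightarrow> Complex (- 0) 0) (at 0)"
      unfolding stable_exponent_def by (intro tendsto_Complex re)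
    then have "((\<lambda>u. stable_exponent \<theta> u) \<longlongrightarrow> 0) (at 0)" by (simp add: zero_complex.code)
    then have "((\<lambda>u. exp (stable_exponent \<theta> u)) \<longlongrightarrow> exp 0) (at 0)" by (rule tendsto_exp)
    moreover have "\<forall>\<^sub>F u in at 0. exp (stable_exponent \<theta> u) = stable_cf \<theta> u"
      using stable_cf_eq_exponent[OF \<theta>] by (auto simp: eventually_at_filter)
    ultimately have "(stable_cf \<theta> \<longlongrightarrow> 1) (at 0)"
      by (simp add: tendsto_cong)
    then show ?thesis using True by (simp add: isCont_def stable_cf_zero)
  qed
  then show ?thesis by (simp add: continuous_at_imp_continuous_on)
qed


lemma power_over_fact_le_exp:
  fixes y :: real
  assumes "0 \<le> y"
  shows "y ^ m / fact m \<le> exp y"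
proof -
  have "(\<Sum>n\<in>{m}. y ^ n /\<^sub>R fact n) \<le> (\<Sum>n. y ^ n /\<^sub>R fact n)"
    using assms by (intro sum_le_suminf summable_exp_generic) auto
  then show ?thesis by (simp add: exp_def divide_inverse mult.commute)
qed

lemma norm_stable_cf:
  assumes "\<theta> \<in> stable_param_interior"
  shows "norm (stable_cf \<theta> u) = exp (- (\<bar>\<theta> $ 2 * u\<bar> powr \<theta> $ 3))"
proof (cases "u = 0")
  case False
  then have "norm (stable_cf \<theta> u) = exp (- exp (\<theta> $ 3 * ln (\<theta> $ 2 * \<bar>u\<bar>)))"
    by (simp add: stable_cf_eq_exponent[OF assms] stable_exponent_def)
  moreover have "exp (\<theta> $ 3 * ln (\<theta> $ 2 * \<bar>u\<bar>)) = \<bar>\<theta> $ 2 * u\<bar> powr \<theta> $ 3"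
    using assms False by (simp add: powr_def abs_mult stable_param_interior_def)
  ultimately show ?thesis by simp
qed (simp add: stable_cf_zero)

text \<open>The modulus exp (-|\<sigma> u|^\<alpha>) decays faster than every power and is dominated
  by a multiple of 1 / (1 + (\<sigma> u)^2).\<close>

lemma integrable_stable_cf:
  assumes \<theta>: "\<theta> \<in> stable_param_interior"
  shows "integrable lborel (stable_cf \<theta>)"
proof -
  have r: "\<theta> $ 2 > 0" "0 < \<theta> $ 3" using \<theta> by (auto simp: stable_param_interior_def)
  \<comment> \<open>Chosen so that \<alpha> m \<ge> 2: for v > 1 the m-th term of the exponential
    series of v^\<alpha> is then at least v^2 / m!.\<close>
  define m where "m = nat \<lceil>2 / \<theta> $ 3\<rceil>"
  have m: "2 / \<theta> $ 3 \<le> real m" unfolding m_def by linarith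
  then have m2: "2 \<le> \<theta> $ 3 * real m" using r by (simp add: field_simps)
  have bound: "norm (stable_cf \<theta> u) \<le> 2 * fact m * inverse (1 + (0 + \<theta> $ 2 * u)\<^sup>2)" for u
  proof -
    define v where "v = \<bar>\<theta> $ 2 * u\<bar>"
    have v: "v \<ge> 0" by (simp add: v_def)
    have f1: "(1::real) \<le> fact m" by (rule fact_ge_1)
    have "exp (- (v powr \<theta> $ 3)) \<le> 2 * fact m / (1 + v\<^sup>2)"
    proof (cases "v \<le> 1")
      case True
      have "exp (- (v powr \<theta> $ 3)) \<le> 1" by simp
      also have "\<dots> \<le> 2 * fact m / (1 + v\<^sup>2)"
      proof -
        have "1 + v\<^sup>2 \<le> 2 * fact m" using f1 power_le_one[OF v True, of 2] by linarith
        then show ?thesis by (simp add: pos_le_divide_eq add_pos_nonneg)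
      qed
      finally show ?thesis .
    next
      case False
      have "v\<^sup>2 = v powr 2" using False by simp
      also have "\<dots> \<le> v powr (\<theta> $ 3 * real m)" using False m2 by (intro powr_mono) auto
      also have "\<dots> = (v powr \<theta> $ 3) ^ m" using False by (simp add: powr_powr[symmetric] powr_realpow)
      also have "\<dots> \<le> fact m * exp (v powr \<theta> $ 3)"
        using power_over_fact_le_exp[of "v powr \<theta> $ 3" m] by (simp add: field_simps)
      finally have *: "v\<^sup>2 \<le> fact m * exp (v powr \<theta> $ 3)" .
      have "1 + v\<^sup>2 \<le> 2 * v\<^sup>2" using False by simp
      then have "1 + v\<^sup>2 \<le> 2 * fact m * exp (v powr \<theta> $ 3)" using * by linarith
      then have "exp (- (v powr \<theta> $ 3)) * (1 + v\<^sup>2) \<le> exp (- (v powr \<theta> $ 3)) * (2 * fact m * exp (v powr \<theta> $ 3))"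
        by (intro mult_left_mono) auto
      also have "\<dots> = 2 * fact m" by (simp add: exp_minus)
      finally show ?thesis by (simp add: pos_le_divide_eq add_pos_nonneg)
    qed
    then show ?thesis by (simp add: norm_stable_cf[OF \<theta>] v_def divide_inverse)
  qed
  have "set_integrable lborel (einterval (-\<infinity>) \<infinity>) (\<lambda>x::real. inverse (1 + x\<^sup>2))"
    by (rule integrable_inverse_1_plus_square)
  then have "integrable lborel (\<lambda>x::real. inverse (1 + x\<^sup>2))"
    by (simp add: set_integrable_def)
  from lborel_integrable_real_affine[OF this, of "\<theta> $ 2" 0]
  have "integrable lborel (\<lambda>u. 2 * fact m * inverse (1 + (0 + \<theta> $ 2 * u)\<^sup>2))"
    using r by (intro integrable_mult_right) auto
  moreover have "stable_cf \<theta> \<in> borel_measurable lborel"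
    using borel_measurable_continuous_onI[OF continuous_on_stable_cf_u[OF \<theta>]] by simp
  ultimately show ?thesis
    by (rule Bochner_Integration.integrable_bound) (use bound in \<open>auto intro!: AE_I2 order.trans[OF _ abs_ge_self]\<close>)
qed

lemma stable_density:
  assumes \<theta>: "\<theta> \<in> stable_param_interior"
  shows "stable_density \<theta> \<in> borel_measurable borel" "0 \<le> stable_density \<theta> x"
    "real_distribution (density lborel (\<lambda>x. ennreal (stable_density \<theta> x)))"
    "char (density lborel (\<lambda>x. ennreal (stable_density \<theta> x))) = stable_cf \<theta>"
  using someI_ex[OF fourier_nonneg_density[OF integrable_stable_cf[OF \<theta>] continuous_on_stable_cf_u[OF \<theta>] stable_cf_zero
    fourier_multiplier_imp_nonneg[OF fourier_multiplier_stable_cf[OF \<theta>]]]]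
  unfolding stable_density_def by auto

section \<open>The multivariate normal distribution\<close>

lemma matrix_inv_mult:
  fixes A :: "real ^ 'n::finite ^ 'n"
  assumes "invertible A"
  shows "A ** matrix_inv A = mat 1" "matrix_inv A ** A = mat 1"
  using someI_ex[OF assms[unfolded invertible_def]] unfolding matrix_inv_def by auto

lemma matrix_inv_eqI:
  fixes A B :: "real ^ 'n::finite ^ 'n"
  assumes "A ** B = mat 1"
  shows "invertible A" "matrix_inv A = B"
proof -
  show i: "invertible A" using assms matrix_left_right_inverse by (auto simp: invertible_def)
  show "matrix_inv A = B"
    by (metis assms i matrix_inv_mult(2) matrix_mul_assoc matrix_mul_lid matrix_mul_rid)
qed

lemma matrix_inv_inv:
  fixes A :: "real ^ 'n::finite ^ 'n"
  assumes "invertible A"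
  shows "matrix_inv (matrix_inv A) = A" "invertible (matrix_inv A)"
  using matrix_inv_eqI[OF matrix_inv_mult(2)[OF assms]] by auto

lemma transpose_matrix_inv:
  fixes A :: "real ^ 'n::finite ^ 'n"
  assumes "invertible A"
  shows "transpose (matrix_inv A) = matrix_inv (transpose A)"
proof -
  have "transpose A ** transpose (matrix_inv A) = mat 1"
    using matrix_inv_mult(2)[OF assms] by (simp flip: matrix_transpose_mul)
  then show ?thesis using matrix_inv_eqI(2) by metis
qed

lemma inner_matrix_vector_transpose:
  fixes A :: "real ^ 'n::finite ^ 'm::finite"
  shows "x \<bullet> (A *v y) = (transpose A *v x) \<bullet> y"
  by (simp add: dot_lmul_matrix)

definition pos_def_matrix :: "real ^ 'n::finite ^ 'n \<Rightarrow> bool" where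
  "pos_def_matrix W \<longleftrightarrow> transpose W = W \<and> (\<forall>x. x \<noteq> 0 \<longrightarrow> x \<bullet> (W *v x) > 0)"

lemma pos_def_invertible:
  assumes "pos_def_matrix W" shows "invertible W"
proof -
  have "W *v x = 0 \<Longrightarrow> x = 0" for x
    using assms by (metis inner_zero_right less_irrefl pos_def_matrix_def)
  then show ?thesis by (simp add: invertible_left_inverse matrix_left_invertible_ker)
qed

lemma pos_def_matrix_inv:
  assumes "pos_def_matrix W" shows "pos_def_matrix (matrix_inv W)"
  unfolding pos_def_matrix_def
proof (intro conjI allI impI)
  have i: "invertible W" using pos_def_invertible[OF assms] .
  show "transpose (matrix_inv W) = matrix_inv W"
    using transpose_matrix_inv[OF i] assms by (simp add: pos_def_matrix_def)
  fix x :: "real ^ 'a" assume "x \<noteq> 0"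
  define y where "y = matrix_inv W *v x"
  have x: "x = W *v y" by (simp add: y_def matrix_vector_mul_assoc matrix_inv_mult[OF i])
  then have "y \<noteq> 0" using \<open>x \<noteq> 0\<close> by auto
  then show "x \<bullet> (matrix_inv W *v x) > 0"
    using assms unfolding y_def[symmetric] by (subst x) (simp add: pos_def_matrix_def inner_commute)
qed

text \<open>Gram--Schmidt for the inner product defined by \<open>W\<close>.\<close>

lemma pos_def_orthonormal_basis:
  fixes W :: "real ^ 'd::finite ^ 'd"
  assumes "pos_def_matrix W"
  shows "\<exists>P :: real ^ 'd ^ 'd. transpose P ** (W ** P) = mat 1"
proof -
  have sym: "x \<bullet> (W *v y) = y \<bullet> (W *v x)" for x y
    using assms by (metis inner_commute inner_matrix_vector_transpose pos_def_matrix_def)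
  have pos: "x \<noteq> 0 \<Longrightarrow> x \<bullet> (W *v x) > 0" for x using assms by (simp add: pos_def_matrix_def)
  have "\<exists>b. \<forall>i\<in>S. \<forall>j\<in>S. b i \<bullet> (W *v b j) = (if i = j then 1 else 0)" if "finite S" for S :: "'d set"
    using that
  proof induction
    case (insert k S)
    then obtain b where b: "\<And>i j. i \<in> S \<Longrightarrow> j \<in> S \<Longrightarrow> b i \<bullet> (W *v b j) = (if i = j then 1 else 0)" by blast
    \<comment> \<open>Since \<open>S\<close> omits the index \<open>k\<close>, its vectors are too
      few to span the space, and a vector outside their span can be orthogonalised.\<close>
    have "dim (b ` S) \<le> card (b ` S)" using insert by (intro dim_le_card') auto
    also have "\<dots> \<le> card S" using insert card_image_le by blast
    also have "\<dots> < card (insert k S)" using insert by simp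
    also have "\<dots> \<le> CARD('d)" by (intro card_mono) auto
    finally have "dim (b ` S) < DIM(real ^ 'd)" by simp
    then have "span (b ` S) \<noteq> UNIV" by (metis dim_eq_full nat_less_le)
    then obtain v where v: "v \<notin> span (b ` S)" by blast
    define w where "w = v - (\<Sum>i\<in>S. (b i \<bullet> (W *v v)) *\<^sub>R b i)"
    have "w \<noteq> 0"
    proof
      assume "w = 0"
      then have "v = (\<Sum>i\<in>S. (b i \<bullet> (W *v v)) *\<^sub>R b i)" by (simp add: w_def)
      also have "\<dots> \<in> span (b ` S)" by (intro span_sum span_scale span_base) auto
      finally show False using v by simp
    qed
    have orth: "b j \<bullet> (W *v w) = 0" if "j \<in> S" for j
    proof -
      have "b j \<bullet> (W *v w) = b j \<bullet> (W *v v) - (\<Sum>i\<in>S. (b i \<bullet> (W *v v)) * (b j \<bullet> (W *v b i)))"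
        by (simp add: w_def matrix_vector_mult_diff_distrib linear_sum[OF matrix_vector_mul_linear]
             inner_diff_right inner_sum_right matrix_vector_mult_scaleR)
      also have "(\<Sum>i\<in>S. (b i \<bullet> (W *v v)) * (b j \<bullet> (W *v b i))) = (\<Sum>i\<in>S. if i = j then b j \<bullet> (W *v v) else 0)"
        using that b by (intro sum.cong) auto
      also have "\<dots> = b j \<bullet> (W *v v)" using that insert by simp
      finally show ?thesis by simp
    qed
    define q where "q = w \<bullet> (W *v w)"
    have q: "q > 0" using pos[OF \<open>w \<noteq> 0\<close>] by (simp add: q_def)
    define b' where "b' = b(k := (1 / sqrt q) *\<^sub>R w)"
    have "b' i \<bullet> (W *v b' j) = (if i = j then 1 else 0)" if "i \<in> insert k S" "j \<in> insert k S" for i j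
    proof (cases "i = k"; cases "j = k")
      assume "i = k" "j = k"
      then show ?thesis using q by (simp add: b'_def matrix_vector_mult_scaleR q_def[symmetric] field_simps)
    next
      assume "i = k" "j \<noteq> k"
      then show ?thesis using that orth[of j] sym[of w "b j"] by (simp add: b'_def)
    next
      assume "i \<noteq> k" "j = k"
      then show ?thesis using that orth[of i] by (simp add: b'_def matrix_vector_mult_scaleR)
    next
      assume "i \<noteq> k" "j \<noteq> k"
      then show ?thesis using that b[of i j] by (simp add: b'_def)
    qed
    then show ?case by blast
  qed auto
  from this[of UNIV] obtain b :: "'d \<Rightarrow> real ^ 'd" where b: "\<forall>i j. b i \<bullet> (W *v b j) = (if i = j then 1 else 0)" by auto
  define P where "P = (\<chi> i j. b j $ i)"
  have "transpose P ** (W ** P) = mat 1"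
  proof -
    have "(transpose P ** (W ** P)) $ i $ j = b i \<bullet> (W *v b j)" for i j
      by (simp add: P_def matrix_matrix_mult_def transpose_def matrix_vector_mult_def inner_vec_def)
    then show ?thesis by (simp add: vec_eq_iff b mat_def)
  qed
  then show ?thesis by blast
qed

section \<open>Gaussian integrals in several variables\<close>

lemma lborel_integral_prod:
  fixes g :: "'a::euclidean_space \<Rightarrow> real \<Rightarrow> 'b::{real_normed_field,banach,second_countable_topology}"
  assumes g: "\<And>b. b \<in> Basis \<Longrightarrow> integrable lborel (g b)"
  shows "integrable lborel (\<lambda>y. \<Prod>b\<in>Basis. g b (y \<bullet> b))"
    and "(\<integral>y. (\<Prod>b\<in>Basis. g b (y \<bullet> b)) \<partial>lborel) = (\<Prod>b\<in>Basis. \<integral>x. g b x \<partial>lborel)"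
proof -
  interpret product_sigma_finite "\<lambda>_::'a. lborel :: real measure" ..
  have [measurable]: "\<And>b. b \<in> Basis \<Longrightarrow> g b \<in> borel_measurable borel" using g by auto
  have m: "(\<lambda>f. \<Sum>b\<in>Basis. f b *\<^sub>R b) \<in> measurable (\<Pi>\<^sub>M b\<in>(Basis::'a set). lborel) borel" by measurable
  have in1: "(\<Sum>b'\<in>Basis. f b' *\<^sub>R b') \<bullet> b = f b" if "b \<in> Basis" for f and b :: 'a
    using that by (simp add: inner_sum_left inner_Basis if_distrib[of "(*) _"] sum.delta cong: if_cong)
  have eq: "(\<Prod>b\<in>Basis. g b ((\<Sum>b'\<in>Basis. f b' *\<^sub>R b') \<bullet> b)) = (\<Prod>b\<in>Basis. g b (f b))" for f
    by (intro prod.cong refl) (simp add: in1)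
  have mg: "(\<lambda>y. \<Prod>b\<in>Basis. g b (y \<bullet> b)) \<in> borel_measurable borel" by measurable
  show "integrable lborel (\<lambda>y. \<Prod>b\<in>Basis. g b (y \<bullet> b))"
    by (subst lborel_eq, subst integrable_distr_eq[OF m mg]) (simp only: eq, intro product_integrable_prod g, auto)
  show "(\<integral>y. (\<Prod>b\<in>Basis. g b (y \<bullet> b)) \<partial>lborel) = (\<Prod>b\<in>Basis. \<integral>x. g b x \<partial>lborel)"
    by (subst lborel_eq, subst integral_distr[OF m mg]) (simp only: eq, intro product_integral_prod g, auto)
qed

lemma gaussian_fourier_euclidean:
  fixes s :: "'a::euclidean_space"
  shows "integrable lborel (\<lambda>y. of_real (exp (- (y \<bullet> y) / 2)) * cis (s \<bullet> y))"
    and "(\<integral>y. of_real (exp (- (y \<bullet> y) / 2)) * cis (s \<bullet> y) \<partial>lborel)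
           = of_real (sqrt (2 * pi) ^ DIM('a) * exp (- (s \<bullet> s) / 2))"
proof -
  let ?g = "\<lambda>b x. cis (s \<bullet> b * x) * complex_of_real (exp (- (1 * x)\<^sup>2 / 2))"
  have eq: "of_real (exp (- (y \<bullet> y) / 2)) * cis (s \<bullet> y) = (\<Prod>b\<in>Basis. ?g b (y \<bullet> b))" for y
  proof -
    have "exp (- (y \<bullet> y) / 2) = (\<Prod>b\<in>Basis. exp (- (y \<bullet> b)\<^sup>2 / 2))"
      by (subst exp_sum[symmetric]) (auto simp: euclidean_inner[of y y] power2_eq_square sum_negf sum_divide_distrib)
    moreover have "cis (s \<bullet> y) = (\<Prod>b\<in>Basis. cis (s \<bullet> b * (y \<bullet> b)))"
      by (simp add: euclidean_inner[of s y] cis_conv_exp sum_distrib_left flip: exp_sum)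
    ultimately show ?thesis by (simp add: prod.distrib mult.commute)
  qed
  have int: "integrable lborel (?g b)" for b
    using fourier_integrable[of "\<lambda>_. 1" 1 1 "s \<bullet> b"] by simp
  show "integrable lborel (\<lambda>y. of_real (exp (- (y \<bullet> y) / 2)) * cis (s \<bullet> y))"
    unfolding eq by (rule lborel_integral_prod(1)[OF int])
  have "(\<integral>y. of_real (exp (- (y \<bullet> y) / 2)) * cis (s \<bullet> y) \<partial>lborel) = (\<Prod>b\<in>Basis. \<integral>x. ?g b x \<partial>lborel)"
    unfolding eq by (rule lborel_integral_prod(2)[OF int])
  also have "\<dots> = (\<Prod>b\<in>Basis. of_real (sqrt (2 * pi) * exp (- (s \<bullet> b)\<^sup>2 / 2)))"
    by (subst gaussian_fourier(2)) simp_all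
  also have "\<dots> = of_real (sqrt (2 * pi) ^ DIM('a) * (\<Prod>b\<in>Basis. exp (- (s \<bullet> b)\<^sup>2 / 2)))"
    by (simp add: prod.distrib)
  also have "(\<Prod>b\<in>Basis. exp (- (s \<bullet> b)\<^sup>2 / 2)) = exp (- (s \<bullet> s) / 2)"
    by (subst exp_sum[symmetric]) (auto simp: euclidean_inner[of s s] power2_eq_square sum_negf sum_divide_distrib)
  finally show "(\<integral>y. of_real (exp (- (y \<bullet> y) / 2)) * cis (s \<bullet> y) \<partial>lborel)
           = of_real (sqrt (2 * pi) ^ DIM('a) * exp (- (s \<bullet> s) / 2))" .
qed

text \<open>Lebesgue measure is determined by boxes. The preimage of a box under \<open>P\<close> is
  its image under the inverse matrix, with volume scaled by the absolute value of the inverse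
  determinant, and the constant density compensates this.\<close>

lemma lborel_linear_image:
  fixes P :: "real ^ 'd::{finite,wellorder} ^ 'd::{finite,wellorder}"
  assumes P: "invertible P"
  shows "lborel = density (distr lborel borel (\<lambda>y. P *v y)) (\<lambda>_. ennreal \<bar>det P\<bar>)"
proof (rule lborel_eqI)
  let ?Q = "matrix_inv P"
  have PQ: "P *v (?Q *v z) = z" "?Q *v (P *v z) = z" for z
    by (simp_all add: matrix_vector_mul_assoc matrix_inv_mult[OF P])
  have dd: "\<bar>det P\<bar> * \<bar>det ?Q\<bar> = 1"
    using matrix_inv_mult(1)[OF P] by (metis abs_mult abs_one det_I det_mul)
  have m[measurable]: "(\<lambda>y. P *v y) \<in> borel_measurable borel"
    by (intro borel_measurable_continuous_onI linear_continuous_on linear_linear[THEN iffD2] matrix_vector_mul_linear)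
  fix l u :: "real ^ 'd::{finite,wellorder}" assume lu: "\<And>b. b \<in> Basis \<Longrightarrow> l \<bullet> b \<le> u \<bullet> b"
  have vim: "(\<lambda>y. P *v y) -` box l u = (\<lambda>z. ?Q *v z) ` box l u"
  proof (intro equalityI subsetI)
    fix y assume "y \<in> (\<lambda>y. P *v y) -` box l u"
    then show "y \<in> (\<lambda>z. ?Q *v z) ` box l u" by (intro image_eqI[of _ _ "P *v y"]) (simp_all only: PQ vimage_eq)
  qed (auto simp only: PQ vimage_eq)
  have "emeasure lborel ((\<lambda>y. P *v y) -` box l u) = ennreal (measure lebesgue ((\<lambda>z. ?Q *v z) ` box l u))"
  proof -
    have "(\<lambda>z. ?Q *v z) ` box l u \<in> lmeasurable"
      by (intro measurable_linear_image matrix_vector_mul_linear) simp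
    then have "emeasure lebesgue ((\<lambda>z. ?Q *v z) ` box l u) = ennreal (measure lebesgue ((\<lambda>z. ?Q *v z) ` box l u))"
      by (intro emeasure_eq_measure2)
    moreover have "(\<lambda>z. ?Q *v z) ` box l u \<in> sets borel"
      unfolding vim[symmetric] using measurable_sets[OF m, of "box l u"] by simp
    ultimately show ?thesis unfolding vim by simp
  qed
  also have "measure lebesgue ((\<lambda>z. ?Q *v z) ` box l u) = \<bar>det ?Q\<bar> * measure lebesgue (box l u)"
    by (subst measure_linear_image) auto
  also have "measure lebesgue (box l u) = (\<Prod>b\<in>Basis. (u - l) \<bullet> b)"
    using lu by (simp add: measure_lborel_box)
  finally have e: "emeasure lborel ((\<lambda>y. P *v y) -` box l u) = ennreal (\<bar>det ?Q\<bar> * (\<Prod>b\<in>Basis. (u - l) \<bullet> b))" .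
  have "emeasure (density (distr lborel borel (\<lambda>y. P *v y)) (\<lambda>_. ennreal \<bar>det P\<bar>)) (box l u)
      = ennreal \<bar>det P\<bar> * emeasure lborel ((\<lambda>y. P *v y) -` box l u)"
    by (subst emeasure_density_const) (auto simp: emeasure_distr)
  also have "\<dots> = ennreal (\<Prod>b\<in>Basis. (u - l) \<bullet> b)"
    unfolding e using dd by (simp add: ennreal_mult'[symmetric] mult.assoc[symmetric])
  finally show "emeasure (density (distr lborel borel (\<lambda>y. P *v y)) (\<lambda>_. ennreal \<bar>det P\<bar>)) (box l u) = (\<Prod>b\<in>Basis. (u - l) \<bullet> b)" .
qed simp

text \<open>In coordinates z = P y, where the columns of P are orthonormal for W, the quadratic form
  becomes y . y and everything reduces to the standard Gaussian. From V = P P^T follow both the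
  normalisation det V = (det P)^2 and the exponent t . V t = |P^T t|^2.\<close>

lemma mv_normal_char:
  fixes W :: "real ^ 'd::{finite,wellorder} ^ 'd::{finite,wellorder}"
  assumes W: "pos_def_matrix W"
  defines "V \<equiv> matrix_inv W"
  shows "prob_space (mv_normal 0 V)" "sets (mv_normal 0 V) = sets borel"
    and "(\<integral>z. cis (t \<bullet> z) \<partial>mv_normal 0 V) = of_real (exp (- (t \<bullet> (V *v t)) / 2))"
proof -
  obtain P :: "real ^ 'd::{finite,wellorder} ^ 'd::{finite,wellorder}" where P: "transpose P ** (W ** P) = mat 1" using pos_def_orthonormal_basis[OF W] by blast
  \<comment> \<open>For square matrices the left inverse P^T of W P is also a right inverse, which
    identifies P P^T as the inverse of W.\<close>
  have "W ** P ** transpose P = mat 1" by (rule matrix_left_right_inverse1[OF P])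
  then have WPP: "W ** (P ** transpose P) = mat 1" by (simp add: matrix_mul_assoc)
  have V: "V = P ** transpose P" unfolding V_def by (rule matrix_inv_eqI(2)[OF WPP])
  have Wi: "invertible W" by (rule matrix_inv_eqI(1)[OF WPP])
  have Vi: "matrix_inv V = W" unfolding V_def by (rule matrix_inv_inv(1)[OF Wi])
  have Pi: "invertible P"
    using P unfolding invertible_left_inverse matrix_mul_assoc by blast
  then have dP: "det P \<noteq> 0" by (simp add: invertible_det_nz)
  have detV: "det V = (det P)\<^sup>2" by (simp add: V det_mul power2_eq_square)
  have quad: "(P *v y) \<bullet> (W *v (P *v y)) = y \<bullet> y" for y
  proof -
    have "(P *v y) \<bullet> (W *v (P *v y)) = y \<bullet> (transpose P *v (W *v (P *v y)))"
      by (metis inner_commute inner_matrix_vector_transpose)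
    also have "\<dots> = y \<bullet> y" using P by (simp only: matrix_vector_mul_assoc matrix_vector_mul_lid matrix_mul_assoc)
    finally show ?thesis .
  qed
  define N where "N = sqrt (2 * pi) ^ CARD('d)"
  have N: "N > 0" by (simp add: N_def)
  have NV: "sqrt ((2 * pi) ^ CARD('d) * det V) = N * \<bar>det P\<bar>"
    by (simp only: N_def detV real_sqrt_mult[of "(2 * pi) ^ CARD('d)"] real_sqrt_power[of "2 * pi"] real_sqrt_abs)
  define dn where "dn z = exp (- (z \<bullet> (W *v z)) / 2) / (N * \<bar>det P\<bar>)" for z
  have dn0: "dn z \<ge> 0" for z using N by (simp add: dn_def)
  have mv: "mv_normal 0 V = density lborel (\<lambda>z. ennreal (dn z))"
    unfolding mv_normal_def NV by (simp add: Vi dn_def)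
  have mm [measurable]: "(\<lambda>y. A *v y) \<in> borel_measurable borel" for A :: "real ^ 'd::{finite,wellorder} ^ 'd::{finite,wellorder}"
    by (intro borel_measurable_continuous_onI linear_continuous_on linear_linear[THEN iffD2] matrix_vector_mul_linear)
  have [measurable]: "dn \<in> borel_measurable borel" unfolding dn_def[abs_def] by measurable
  have dnP: "\<bar>det P\<bar> * dn (P *v y) = exp (- (y \<bullet> y) / 2) / N" for y
    using dP by (simp add: dn_def quad)
  note lin = lborel_linear_image[OF Pi]
  show "sets (mv_normal 0 V) = sets borel" by (simp add: mv)
  have g0: "integrable lborel (\<lambda>y::real^'d::{finite,wellorder}. exp (- (y \<bullet> y) / 2))" "(\<integral>y. exp (- ((y::real^'d::{finite,wellorder}) \<bullet> y) / 2) \<partial>lborel) = N"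
  proof -
    have i: "integrable lborel (\<lambda>y::real^'d::{finite,wellorder}. complex_of_real (exp (- (y \<bullet> y) / 2)))"
      using gaussian_fourier_euclidean(1)[of "0 :: real ^ 'd::{finite,wellorder}"] by simp
    show "integrable lborel (\<lambda>y::real^'d::{finite,wellorder}. exp (- (y \<bullet> y) / 2))" using integrable_Re[OF i] by simp
    have "complex_of_real (\<integral>y. exp (- ((y::real^'d::{finite,wellorder}) \<bullet> y) / 2) \<partial>lborel) = of_real N"
      using gaussian_fourier_euclidean(2)[of "0 :: real ^ 'd::{finite,wellorder}"] by (simp add: N_def flip: integral_complex_of_real)
    then show "(\<integral>y. exp (- ((y::real^'d::{finite,wellorder}) \<bullet> y) / 2) \<partial>lborel) = N" by (simp only: of_real_eq_iff)
  qed
  have "emeasure (mv_normal 0 V) (space (mv_normal 0 V)) = (\<integral>\<^sup>+z. ennreal (dn z) \<partial>lborel)"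
    by (simp add: mv emeasure_density)
  also have "\<dots> = (\<integral>\<^sup>+y. ennreal \<bar>det P\<bar> * ennreal (dn (P *v y)) \<partial>lborel)"
    by (subst lin, subst nn_integral_density, simp, simp, subst nn_integral_distr) (simp_all)
  also have "\<dots> = (\<integral>\<^sup>+y. ennreal (exp (- ((y::real^'d::{finite,wellorder}) \<bullet> y) / 2) / N) \<partial>lborel)"
    by (simp add: ennreal_mult'[symmetric] dnP)
  also have "\<dots> = ennreal (\<integral>y. exp (- ((y::real^'d::{finite,wellorder}) \<bullet> y) / 2) / N \<partial>lborel)"
    using g0 N by (intro nn_integral_eq_integral) auto
  also have "\<dots> = 1" using g0 N by simp
  finally show "prob_space (mv_normal 0 V)" by (rule prob_spaceI)
  have "(\<integral>z. cis (t \<bullet> z) \<partial>mv_normal 0 V) = (\<integral>z. dn z *\<^sub>R cis (t \<bullet> z) \<partial>lborel)"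
    unfolding mv by (subst integral_density) (use dn0 in auto)
  also have "\<dots> = (\<integral>y. \<bar>det P\<bar> *\<^sub>R (dn (P *v y) *\<^sub>R cis (t \<bullet> (P *v y))) \<partial>lborel)"
    by (subst lin, subst integral_density, simp, simp, simp, subst integral_distr) simp_all
  also have "\<dots> = (\<integral>y. of_real (1 / N) * (of_real (exp (- (y \<bullet> y) / 2)) * cis ((transpose P *v t) \<bullet> y)) \<partial>lborel)"
    by (intro Bochner_Integration.integral_cong)
       (simp_all only: scaleR_scaleR dnP inner_matrix_vector_transpose, simp_all add: scaleR_conv_of_real)
  also have "\<dots> = of_real (exp (- ((transpose P *v t) \<bullet> (transpose P *v t)) / 2))"
    unfolding integral_mult_right_zero gaussian_fourier_euclidean(2) using N by (simp add: N_def)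
  also have "(transpose P *v t) \<bullet> (transpose P *v t) = t \<bullet> (V *v t)"
    by (simp only: V matrix_vector_mul_assoc[symmetric] inner_matrix_vector_transpose[of t P])
  finally show "(\<integral>z. cis (t \<bullet> z) \<partial>mv_normal 0 V) = of_real (exp (- (t \<bullet> (V *v t)) / 2))" .
qed

section \<open>Weak convergence from characteristic functions\<close>

lemma prob_tail_small:
  fixes N :: "'a measure" and f :: "'a \<Rightarrow> real"
  assumes "prob_space N" and [measurable]: "f \<in> borel_measurable N" and "e > 0"
  shows "\<exists>K>0. measure N {z \<in> space N. K < \<bar>f z\<bar>} < e"
proof -
  interpret prob_space N by fact
  have "(\<lambda>n. measure N {z \<in> space N. real n < \<bar>f z\<bar>}) \<longlonglongrightarrow> measure N (\<Inter>n. {z \<in> space N. real n < \<bar>f z\<bar>})"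
    by (intro finite_Lim_measure_decseq) (auto simp: decseq_def)
  moreover have "(\<Inter>n. {z \<in> space N. real n < \<bar>f z\<bar>}) = {}"
  proof -
    have "\<exists>n. \<bar>f z\<bar> \<le> real n" for z using reals_Archimedean2[of "\<bar>f z\<bar>"] less_imp_le by blast
    then show ?thesis by auto (meson not_le)
  qed
  ultimately have "(\<lambda>n. measure N {z \<in> space N. real n < \<bar>f z\<bar>}) \<longlonglongrightarrow> 0" by simp
  then have "\<forall>\<^sub>F n in sequentially. measure N {z \<in> space N. real n < \<bar>f z\<bar>} < e"
    using \<open>e > 0\<close> by (rule order_tendstoD)
  then have "\<forall>\<^sub>F n in sequentially. measure N {z \<in> space N. real n < \<bar>f z\<bar>} < e \<and> n > 0"
    using eventually_gt_at_top[of 0] by (rule eventually_conj)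
  then obtain n :: nat where "measure N {z \<in> space N. real n < \<bar>f z\<bar>} < e" "n > 0"
    using eventually_happens trivial_limit_sequentially by blast
  then show ?thesis by (intro exI[of _ "real n"]) auto
qed

text \<open>The characteristic function of a coordinate is that of the vector along multiples of a
  basis vector, so Levy's theorem on the line applies to each coordinate. Each one is allotted the
  share e / dimension of the tail probability.\<close>

lemma char_convergence_tight:
  fixes Y :: "nat \<Rightarrow> 'w \<Rightarrow> 'a::euclidean_space" and N :: "'a measure"
  assumes M: "prob_space M" and Y [measurable]: "\<And>n. Y n \<in> borel_measurable M"
    and N: "prob_space N" "sets N = sets borel"
    and lim: "\<And>t. (\<lambda>n. \<integral>\<omega>. cis (t \<bullet> Y n \<omega>) \<partial>M) \<longlonglongrightarrow> (\<integral>z. cis (t \<bullet> z) \<partial>N)"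
    and e: "e > 0"
  shows "\<exists>K>0. measure N {z. K < norm z} \<le> e \<and>
     (\<forall>\<^sub>F n in sequentially. measure M {\<omega> \<in> space M. K < norm (Y n \<omega>)} \<le> e)"
proof -
  interpret M: prob_space M by fact
  interpret N: prob_space N by fact
  have [measurable_cong]: "sets N = sets borel" by fact
  have spN: "space N = UNIV" using sets_eq_imp_space_eq[OF N(2)] by simp
  define d where "d = e / DIM('a)"
  have d: "d > 0" using e by (simp add: d_def)
  have "\<exists>K>0. measure N {z \<in> space N. K < \<bar>z \<bullet> b\<bar>} \<le> d \<and>
     (\<forall>\<^sub>F n in sequentially. measure M {\<omega> \<in> space M. K < \<bar>Y n \<omega> \<bullet> b\<bar>} \<le> d)" for b :: 'a
  proof -
    have [measurable]: "(\<lambda>z. z \<bullet> b) \<in> borel_measurable N" by measurable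
    obtain K where K: "K > 0" "measure N {z \<in> space N. K < \<bar>z \<bullet> b\<bar>} < d"
      using prob_tail_small[OF N(1) _ d, of "\<lambda>z. z \<bullet> b"] by auto
    let ?m = "\<lambda>n. distr M borel (\<lambda>\<omega>. Y n \<omega> \<bullet> b)" and ?m' = "distr N borel (\<lambda>z. z \<bullet> b)"
    have rd: "real_distribution (?m n)" "real_distribution ?m'" for n
      by (auto intro!: M.real_distribution_distr N.real_distribution_distr)
    have "weak_conv_m ?m ?m'"
    proof (rule levy_continuity[OF rd])
      fix t
      have "char (?m n) t = (\<integral>\<omega>. cis ((t *\<^sub>R b) \<bullet> Y n \<omega>) \<partial>M)" for n
        unfolding char_def by (subst integral_distr) (auto simp: cis_conv_exp inner_commute)
      moreover have "char ?m' t = (\<integral>z. cis ((t *\<^sub>R b) \<bullet> z) \<partial>N)"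
        unfolding char_def by (subst integral_distr) (auto simp: cis_conv_exp inner_commute)
      ultimately show "(\<lambda>n. char (?m n) t) \<longlonglongrightarrow> char ?m' t"
        using lim[of "t *\<^sub>R b"] by (simp only:)
    qed
    \<comment> \<open>A continuous ramp between the indicators of |x| > K + 1 and |x| > K. Weak
      convergence carries the tail bound over at the price of replacing K by K + 1.\<close>
    let ?f = "\<lambda>x::real. min 1 (max 0 (\<bar>x\<bar> - K))"
    have fc: "isCont ?f x" for x by (intro continuous_intros)
    have fb: "norm (?f x) \<le> 1" for x by auto
    have [measurable]: "?f \<in> borel_measurable borel" by measurable
    have "(\<lambda>n. \<integral>x. ?f x \<partial>?m n) \<longlonglongrightarrow> (\<integral>x. ?f x \<partial>?m')"
      by (rule weak_conv_imp_integral_bdd_continuous_conv[OF rd \<open>weak_conv_m ?m ?m'\<close> fc fb])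
    then have li: "(\<lambda>n. \<integral>\<omega>. ?f (Y n \<omega> \<bullet> b) \<partial>M) \<longlonglongrightarrow> (\<integral>z. ?f (z \<bullet> b) \<partial>N)"
      by (simp add: integral_distr)
    have bounded_int: "integrable M (\<lambda>\<omega>. ?f (Y n \<omega> \<bullet> b))" "integrable N (\<lambda>z. ?f (z \<bullet> b))" for n
      by (rule M.integrable_const_bound[of _ 1] N.integrable_const_bound[of _ 1]; use fb in simp)+
    have "(\<integral>z. ?f (z \<bullet> b) \<partial>N) \<le> (\<integral>z. indicator {z \<in> space N. K < \<bar>z \<bullet> b\<bar>} z \<partial>N)"
      using bounded_int
      by (intro integral_mono integrable_real_indicator) (auto simp: indicator_def spN N.emeasure_eq_measure)
    also have "\<dots> < d" using K(2) by simp
    finally have "\<forall>\<^sub>F n in sequentially. (\<integral>\<omega>. ?f (Y n \<omega> \<bullet> b) \<partial>M) < d"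
      by (rule order_tendstoD[OF li])
    moreover have "measure M {\<omega> \<in> space M. K + 1 < \<bar>Y n \<omega> \<bullet> b\<bar>} \<le> (\<integral>\<omega>. ?f (Y n \<omega> \<bullet> b) \<partial>M)" for n
    proof -
      have "measure M {\<omega> \<in> space M. K + 1 < \<bar>Y n \<omega> \<bullet> b\<bar>} = (\<integral>\<omega>. indicator {\<omega> \<in> space M. K + 1 < \<bar>Y n \<omega> \<bullet> b\<bar>} \<omega> \<partial>M)"
        by simp
      also have "\<dots> \<le> (\<integral>\<omega>. ?f (Y n \<omega> \<bullet> b) \<partial>M)"
        using bounded_int
        by (intro integral_mono integrable_real_indicator) (auto simp: indicator_def M.emeasure_eq_measure)
      finally show ?thesis .
    qed
    ultimately have "\<forall>\<^sub>F n in sequentially. measure M {\<omega> \<in> space M. K + 1 < \<bar>Y n \<omega> \<bullet> b\<bar>} \<le> d"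
      by (auto elim!: eventually_mono intro: order.trans less_imp_le)
    moreover have "measure N {z \<in> space N. K + 1 < \<bar>z \<bullet> b\<bar>} \<le> measure N {z \<in> space N. K < \<bar>z \<bullet> b\<bar>}"
      by (intro N.finite_measure_mono) auto
    ultimately show ?thesis using K by (intro exI[of _ "K + 1"]) auto
  qed
  then have "\<forall>b. \<exists>K>0. measure N {z \<in> space N. K < \<bar>z \<bullet> b\<bar>} \<le> d \<and>
     (\<forall>\<^sub>F n in sequentially. measure M {\<omega> \<in> space M. K < \<bar>Y n \<omega> \<bullet> b\<bar>} \<le> d)" by blast
  from choice[OF this] obtain K where K': "\<forall>b. 0 < K b \<and> measure N {z \<in> space N. K b < \<bar>z \<bullet> b\<bar>} \<le> d \<and>
     (\<forall>\<^sub>F n in sequentially. measure M {\<omega> \<in> space M. K b < \<bar>Y n \<omega> \<bullet> b\<bar>} \<le> d)" by blast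
  then have K: "\<And>b. K b > (0::real)" "\<And>b. measure N {z \<in> space N. K b < \<bar>z \<bullet> b\<bar>} \<le> d"
    "\<And>b. \<forall>\<^sub>F n in sequentially. measure M {\<omega> \<in> space M. K b < \<bar>Y n \<omega> \<bullet> b\<bar>} \<le> d" by simp_all
  define L where "L = (\<Sum>b\<in>(Basis::'a set). K b)"
  have L: "L > 0" unfolding L_def using K(1) by (intro sum_pos) auto
  have big: "\<exists>b\<in>Basis. K b < \<bar>z \<bullet> b\<bar>" if "L < norm z" for z :: 'a
  proof (rule ccontr)
    assume "\<not> ?thesis"
    then have "(\<Sum>b\<in>Basis. \<bar>z \<bullet> b\<bar>) \<le> L" unfolding L_def by (intro sum_mono) (auto simp: not_less)
    then show False using norm_le_l1[of z] that by simp
  qed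
  have DIMd: "real DIM('a) * d = e" by (simp add: d_def)
  have "measure N {z. L < norm z} \<le> measure N (\<Union>b\<in>Basis. {z \<in> space N. K b < \<bar>z \<bullet> b\<bar>})"
    using big by (intro N.finite_measure_mono) (auto simp: spN)
  also have "\<dots> \<le> (\<Sum>b\<in>Basis. measure N {z \<in> space N. K b < \<bar>z \<bullet> b\<bar>})"
    by (intro N.finite_measure_subadditive_finite) auto
  also have "\<dots> \<le> (\<Sum>b\<in>(Basis::'a set). d)" using K(2) by (intro sum_mono) auto
  finally have 1: "measure N {z. L < norm z} \<le> e" by (simp add: DIMd)
  have "\<forall>\<^sub>F n in sequentially. \<forall>b\<in>Basis. measure M {\<omega> \<in> space M. K b < \<bar>Y n \<omega> \<bullet> b\<bar>} \<le> d"
    using K(3) by (intro eventually_ball_finite) auto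
  then have "\<forall>\<^sub>F n in sequentially. measure M {\<omega> \<in> space M. L < norm (Y n \<omega>)} \<le> e"
  proof eventually_elim
    case (elim n)
    have "measure M {\<omega> \<in> space M. L < norm (Y n \<omega>)} \<le> measure M (\<Union>b\<in>Basis. {\<omega> \<in> space M. K b < \<bar>Y n \<omega> \<bullet> b\<bar>})"
      using big by (intro M.finite_measure_mono) auto
    also have "\<dots> \<le> (\<Sum>b\<in>Basis. measure M {\<omega> \<in> space M. K b < \<bar>Y n \<omega> \<bullet> b\<bar>})"
      by (intro M.finite_measure_subadditive_finite) auto
    also have "\<dots> \<le> (\<Sum>b\<in>(Basis::'a set). d)" using elim by (intro sum_mono) auto
    finally show ?case by (simp add: DIMd)
  qed
  then show ?thesis using L 1 by blast
qed

section \<open>Trigonometric polynomials and their density\<close>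

inductive trig_poly :: "('a::euclidean_space \<Rightarrow> complex) \<Rightarrow> bool" where
  cis: "trig_poly (\<lambda>z. c * cis (t \<bullet> z))"
| add: "trig_poly f \<Longrightarrow> trig_poly g \<Longrightarrow> trig_poly (\<lambda>z. f z + g z)"

lemma trig_poly_const: "trig_poly (\<lambda>_. c)"
  using trig_poly.cis[of c 0] by simp

lemma trig_poly_mult:
  assumes "trig_poly f" "trig_poly g"
  shows "trig_poly (\<lambda>z. f z * g z)"
  using assms
proof (induction f)
  case (cis c t)
  show ?case using cis
  proof (induction g)
    case (cis c' t')
    have "(\<lambda>z. c * cis (t \<bullet> z) * (c' * cis (t' \<bullet> z))) = (\<lambda>z. (c * c') * cis ((t + t') \<bullet> z))"
      by (auto simp: inner_add_left cis_mult[symmetric])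
    then show ?case by (simp only: trig_poly.cis)
  next
    case (add f g)
    then show ?case by (simp add: distrib_left trig_poly.add)
  qed
next
  case (add f f')
  then show ?case by (simp add: distrib_right trig_poly.add)
qed

lemma trig_poly_bounded: "trig_poly f \<Longrightarrow> \<exists>B. \<forall>z. norm (f z) \<le> B"
proof (induction rule: trig_poly.induct)
  case (cis c t)
  then show ?case by (auto simp: norm_mult)
next
  case (add f g)
  then obtain B B' where "\<forall>z. norm (f z) \<le> B" "\<forall>z. norm (g z) \<le> B'" by blast
  then show ?case by (intro exI[of _ "B + B'"]) (auto intro: norm_triangle_le add_mono)
qed

lemma trig_poly_continuous: "trig_poly f \<Longrightarrow> continuous_on UNIV f"
  by (induction rule: trig_poly.induct) (auto intro!: continuous_intros)

lemma trig_poly_convergence: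
  fixes Y :: "nat \<Rightarrow> 'w \<Rightarrow> 'a::euclidean_space" and N :: "'a measure"
  assumes "trig_poly f"
    and M: "prob_space M" and Y [measurable]: "\<And>n. Y n \<in> borel_measurable M"
    and N: "prob_space N" "sets N = sets borel"
    and lim: "\<And>t. (\<lambda>n. \<integral>\<omega>. cis (t \<bullet> Y n \<omega>) \<partial>M) \<longlonglongrightarrow> (\<integral>z. cis (t \<bullet> z) \<partial>N)"
  shows "(\<forall>n. integrable M (\<lambda>\<omega>. f (Y n \<omega>))) \<and> integrable N f \<and>
     (\<lambda>n. \<integral>\<omega>. f (Y n \<omega>) \<partial>M) \<longlonglongrightarrow> (\<integral>z. f z \<partial>N)"
  using assms(1)
proof (induction rule: trig_poly.induct)
  case (cis c t)
  interpret M: prob_space M by fact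
  interpret N: prob_space N by fact
  have [measurable_cong]: "sets N = sets borel" by fact
  have "integrable M (\<lambda>\<omega>. c * cis (t \<bullet> Y n \<omega>))" for n
    by (rule M.integrable_const_bound[of _ "norm c"]) (auto simp: norm_mult)
  moreover have "integrable N (\<lambda>z. c * cis (t \<bullet> z))"
    by (rule N.integrable_const_bound[of _ "norm c"]) (auto simp: norm_mult)
  ultimately show ?case using lim[of t] by (auto intro: tendsto_mult_left)
next
  case (add f g)
  then show ?case by (auto intro!: tendsto_add simp: Bochner_Integration.integral_add)
qed

text \<open>Polynomials of a real variable arise from linear maps and constants by sums and
  products, all available in the algebra of trigonometric polynomials. The lemma serves to truncate
  without leaving that algebra.\<close>

lemma trig_poly_polynomial:
  assumes "real_polynomial_function r" "trig_poly (\<lambda>z. of_real (p z))"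
  shows "trig_poly (\<lambda>z. of_real (r (p z :: real)))"
  using assms(1)
proof (induction rule: real_polynomial_function.induct)
  case (linear f)
  then have "f x = f 1 * x" for x :: real
    using linear_scale[OF bounded_linear.linear[OF linear], of x 1] by simp
  then have "(\<lambda>z. complex_of_real (f (p z))) = (\<lambda>z. of_real (f 1) * of_real (p z))"
    by (metis of_real_mult)
  then show ?case using trig_poly_mult[OF trig_poly_const assms(2)] by simp
next
  case (const c)
  then show ?case by (rule trig_poly_const)
next
  case (add f g)
  then show ?case using trig_poly.add by fastforce
next
  case (mult f g)
  then show ?case using trig_poly_mult by fastforce
qed

lemma trig_poly_approx:
  fixes h :: "'a::euclidean_space \<Rightarrow> real"
  assumes h: "continuous_on UNIV h" and B: "\<And>z. \<bar>h z\<bar> \<le> B" and e: "e > 0"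
  shows "\<exists>q. trig_poly (\<lambda>z. of_real (q z)) \<and> (\<forall>z\<in>cball 0 K. \<bar>q z - h z\<bar> \<le> 2 * e) \<and> (\<forall>z. \<bar>q z\<bar> \<le> B + e)"
proof -
  interpret function_ring_on "{p :: 'a \<Rightarrow> real. trig_poly (\<lambda>z. of_real (p z))}" "cball 0 K"
  proof
    fix f :: "'a \<Rightarrow> real" assume "f \<in> {p. trig_poly (\<lambda>z. of_real (p z))}"
    then have "continuous_on UNIV (\<lambda>z. Re (of_real (f z)))"
      using trig_poly_continuous continuous_on_Re by blast
    then show "continuous_on (cball 0 K) f" by (auto intro: continuous_on_subset)
  next
    fix f g :: "'a \<Rightarrow> real" assume "f \<in> {p. trig_poly (\<lambda>z. of_real (p z))}" "g \<in> {p. trig_poly (\<lambda>z. of_real (p z))}"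
    then show "(\<lambda>x. f x + g x) \<in> {p. trig_poly (\<lambda>z. of_real (p z))}" "(\<lambda>x. f x * g x) \<in> {p. trig_poly (\<lambda>z. of_real (p z))}"
      using trig_poly.add[of "\<lambda>z. of_real (f z)" "\<lambda>z. of_real (g z)"] trig_poly_mult[of "\<lambda>z. of_real (f z)" "\<lambda>z. of_real (g z)"] by auto
  next
    fix x y :: 'a assume "x \<noteq> y"
    \<comment> \<open>With t . (x - y) = pi the function cos (t . (z - y)) takes the values -1 at
      \<open>x\<close> and 1 at \<open>y\<close>.\<close>
    define t where "t = (pi / ((x - y) \<bullet> (x - y))) *\<^sub>R (x - y)"
    have "(x - y) \<bullet> (x - y) \<noteq> 0" using \<open>x \<noteq> y\<close> by simp
    then have t: "t \<bullet> (x - y) = pi" unfolding t_def inner_scaleR_left by simp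
    define f where "f z = cos (t \<bullet> (z - y))" for z
    have "(\<lambda>z. (cis (- (t \<bullet> y)) / 2) * cis (t \<bullet> z) + (cis (t \<bullet> y) / 2) * cis ((- t) \<bullet> z)) = (\<lambda>z. of_real (f z))"
      by (rule ext) (simp add: f_def complex_eq_iff inner_diff_right cos_diff diff_divide_distrib add_divide_distrib mult.commute)
    then have "trig_poly (\<lambda>z. of_real (f z))"
      using trig_poly.add[OF trig_poly.cis trig_poly.cis] by metis
    moreover have "f x \<noteq> f y" by (simp add: f_def t)
    ultimately show "\<exists>f\<in>{p. trig_poly (\<lambda>z. of_real (p z))}. f x \<noteq> f y" by blast
  qed (auto intro: trig_poly_const)
  obtain p where p: "trig_poly (\<lambda>z. of_real (p z))" "\<And>z. z \<in> cball 0 K \<Longrightarrow> \<bar>h z - p z\<bar> < e"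
    using Stone_Weierstrass_basic[OF continuous_on_subset[OF h subset_UNIV] e] by blast
  \<comment> \<open>A trigonometric polynomial is bounded on the whole space, so a polynomial close
    to the truncation on [-P, P] controls the composition everywhere, not only on the ball.\<close>
  obtain P where P: "\<And>z. \<bar>p z\<bar> \<le> P" using trig_poly_bounded[OF p(1)] by auto
  let ?cl = "\<lambda>x::real. max (- B) (min B x)"
  have "continuous_on {-P..P} ?cl" by (intro continuous_intros)
  then obtain r where r: "real_polynomial_function r" "\<And>x. x \<in> {-P..P} \<Longrightarrow> \<bar>?cl x - r x\<bar> < e"
    using Stone_Weierstrass_real_polynomial_function[of "{-P..P}" ?cl e] e by auto
  have rp: "\<bar>?cl (p z) - r (p z)\<bar> < e" for z using r(2)[of "p z"] P[of z] by (simp add: abs_le_iff minus_le_iff)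
  have B0: "B \<ge> 0" using B[of 0] by linarith
  show ?thesis
  proof (intro exI[of _ "\<lambda>z. r (p z)"] conjI allI ballI)
    show "trig_poly (\<lambda>z. of_real (r (p z)))" by (rule trig_poly_polynomial[OF r(1) p(1)])
    show "\<bar>r (p z)\<bar> \<le> B + e" for z using rp[of z] B0 by (simp add: abs_le_iff abs_less_iff max_def min_def split: if_splits)
    fix z :: 'a assume "z \<in> cball 0 K"
    then have "\<bar>h z - p z\<bar> < e" by (rule p(2))
    \<comment> \<open>Truncating at level B moves \<open>p z\<close> no further away from
      \<open>h z\<close>, whose modulus is at most B.\<close>
    then have "\<bar>?cl (p z) - h z\<bar> \<le> e" using B[of z] by (auto simp: abs_le_iff abs_less_iff max_def min_def)
    then show "\<bar>r (p z) - h z\<bar> \<le> 2 * e" using rp[of z] by linarith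
  qed
qed

lemma integral_diff_bound_tail:
  fixes f g :: "'b \<Rightarrow> 'c::{banach,second_countable_topology}"
  assumes "prob_space M" and int: "integrable M f" "integrable M g" and [measurable]: "A \<in> sets M"
    and close: "\<And>x. x \<in> space M \<Longrightarrow> x \<notin> A \<Longrightarrow> norm (f x - g x) \<le> a"
    and far: "\<And>x. x \<in> space M \<Longrightarrow> norm (f x - g x) \<le> b" and "a \<ge> 0" "b \<ge> 0"
  shows "norm ((\<integral>x. f x \<partial>M) - (\<integral>x. g x \<partial>M)) \<le> a + b * measure M A"
proof -
  interpret prob_space M by fact
  have "norm ((\<integral>x. f x \<partial>M) - (\<integral>x. g x \<partial>M)) = norm (\<integral>x. f x - g x \<partial>M)" using int by simp
  also have "\<dots> \<le> (\<integral>x. norm (f x - g x) \<partial>M)" by (rule integral_norm_bound)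
  also have "\<dots> \<le> (\<integral>x. a + b * indicator A x \<partial>M)"
    using int close far \<open>a \<ge> 0\<close> \<open>b \<ge> 0\<close>
    by (intro integral_mono integrable_norm Bochner_Integration.integrable_diff Bochner_Integration.integrable_add
         integrable_mult_right integrable_real_indicator)
       (auto simp: indicator_def emeasure_eq_measure intro: order.trans add_increasing)
  also have "\<dots> = a + b * measure M A" by (simp add: prob_space emeasure_eq_measure)
  finally show ?thesis .
qed

lemmas integral_diff_bound_tail_real = integral_diff_bound_tail[where 'c = real, unfolded real_norm_def]

text \<open>
  Only functions close to \<open>h\<close> on a large ball are needed because of tightness. Trigonometric polynomials
  obtained from Stone--Weierstrass may be large off the ball; composing with a polynomial that
  approximates the truncation at \<open>\<plusminus>B\<close> keeps them bounded without leaving the algebra.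
\<close>

theorem char_convergence_imp_tendsto_in_distribution:
  fixes Y :: "nat \<Rightarrow> 'w \<Rightarrow> 'a::euclidean_space" and N :: "'a measure"
  assumes M: "prob_space M" and Y [measurable]: "\<And>n. Y n \<in> borel_measurable M"
    and N: "prob_space N" "sets N = sets borel"
    and lim: "\<And>t. (\<lambda>n. \<integral>\<omega>. cis (t \<bullet> Y n \<omega>) \<partial>M) \<longlonglongrightarrow> (\<integral>z. cis (t \<bullet> z) \<partial>N)"
  shows "tendsto_in_distribution M Y N"
  unfolding tendsto_in_distribution_def
proof (intro allI impI, elim conjE)
  interpret M: prob_space M by fact
  interpret N: prob_space N by fact
  have [measurable_cong]: "sets N = sets borel" by fact
  have spN: "space N = UNIV" using sets_eq_imp_space_eq[OF N(2)] by simp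
  fix h :: "'a \<Rightarrow> real"
  assume h: "continuous_on UNIV h" and "bounded (range h)"
  then obtain B where B: "\<And>z. \<bar>h z\<bar> \<le> B" by (auto simp: bounded_iff)
  have B0: "B \<ge> 0" using B[of 0] by linarith
  have [measurable]: "h \<in> borel_measurable borel" using h by (rule borel_measurable_continuous_onI)
  have hi: "integrable M (\<lambda>\<omega>. h (Y n \<omega>))" "integrable N h" for n
    by (rule M.integrable_const_bound[of _ B] N.integrable_const_bound[of _ B]; use B in simp)+
  show "(\<lambda>n. \<integral>\<omega>. h (Y n \<omega>) \<partial>M) \<longlonglongrightarrow> (\<integral>z. h z \<partial>N)"
  proof (rule tendstoI)
    fix e0 :: real assume "e0 > 0"
    \<comment> \<open>With c = 2 e + (2 B + 1) e, the total error is below 2 c + e = (7 + 4 B) e,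
      and the denominator is 8 + 4 B. The bound e \<le> 1 replaces 2 B + e by 2 B + 1.\<close>
    define e where "e = min 1 (e0 / (6 + 4 * B + 2))"
    have e: "e > 0" "e \<le> 1" using \<open>e0 > 0\<close> B0 by (auto simp: e_def)
    have "e \<le> e0 / (8 + 4 * B)" by (simp add: e_def)
    then have ee: "e * (8 + 4 * B) \<le> e0" using B0 by (simp add: pos_le_divide_eq)
    obtain K where K: "measure N {z. K < norm z} \<le> e"
      "\<forall>\<^sub>F n in sequentially. measure M {\<omega> \<in> space M. K < norm (Y n \<omega>)} \<le> e"
      using char_convergence_tight[OF M Y N lim e(1)] by blast
    obtain q where q: "trig_poly (\<lambda>z. of_real (q z))" "\<And>z. z \<in> cball 0 K \<Longrightarrow> \<bar>q z - h z\<bar> \<le> 2 * e" "\<And>z. \<bar>q z\<bar> \<le> B + e"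
      using trig_poly_approx[OF h B e(1)] by blast
    note qc = trig_poly_convergence[OF q(1) M Y N lim]
    have "continuous_on UNIV (\<lambda>z. Re (of_real (q z)))"
      using trig_poly_continuous[OF q(1)] continuous_on_Re by blast
    then have [measurable]: "q \<in> borel_measurable borel" by (intro borel_measurable_continuous_onI) simp
    have qi: "integrable M (\<lambda>\<omega>. q (Y n \<omega>))" "integrable N q" for n
      by (rule M.integrable_const_bound[of _ "B + e"] N.integrable_const_bound[of _ "B + e"]; use q(3) in simp)+
    have "(\<lambda>n. \<integral>\<omega>. q (Y n \<omega>) \<partial>M) \<longlonglongrightarrow> (\<integral>z. q z \<partial>N)"
      using qc by (auto simp: integral_complex_of_real tendsto_of_real_iff)
    then have ql: "\<forall>\<^sub>F n in sequentially. dist (\<integral>\<omega>. q (Y n \<omega>) \<partial>M) (\<integral>z. q z \<partial>N) < e"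
      using e(1) by (rule tendstoD)
    have b: "\<bar>q z - h z\<bar> \<le> 2 * B + e" for z using q(3)[of z] B[of z] by linarith
    have ne: "(2 * B + e) * m \<le> (2 * B + 1) * e" if "0 \<le> m" "m \<le> e" for m
      using that e B0 by (intro mult_mono) auto
    have Nb: "\<bar>(\<integral>z. q z \<partial>N) - (\<integral>z. h z \<partial>N)\<bar> \<le> 2 * e + (2 * B + e) * measure N {z. K < norm z}"
      using q(2) b e B0 by (intro integral_diff_bound_tail_real N qi hi) auto
    show "\<forall>\<^sub>F n in sequentially. dist (\<integral>\<omega>. h (Y n \<omega>) \<partial>M) (\<integral>z. h z \<partial>N) < e0"
      using K(2) ql
    proof eventually_elim
      case (elim n)
      define c where "c = 2 * e + (2 * B + 1) * e"
      have "\<bar>(\<integral>\<omega>. q (Y n \<omega>) \<partial>M) - (\<integral>\<omega>. h (Y n \<omega>) \<partial>M)\<bar>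
          \<le> 2 * e + (2 * B + e) * measure M {\<omega> \<in> space M. K < norm (Y n \<omega>)}"
        using q(2) b e B0 by (intro integral_diff_bound_tail_real M qi hi) auto
      also have "\<dots> \<le> c"
        unfolding c_def using ne[OF measure_nonneg elim(1)] by (intro add_left_mono)
      finally have a1: "\<bar>(\<integral>\<omega>. q (Y n \<omega>) \<partial>M) - (\<integral>\<omega>. h (Y n \<omega>) \<partial>M)\<bar> \<le> c" .
      have a2: "\<bar>(\<integral>z. q z \<partial>N) - (\<integral>z. h z \<partial>N)\<bar> \<le> c"
        unfolding c_def using ne[OF measure_nonneg K(1)] by (intro order.trans[OF Nb] add_left_mono)
      have a3: "\<bar>(\<integral>\<omega>. q (Y n \<omega>) \<partial>M) - (\<integral>z. q z \<partial>N)\<bar> < e"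
        using elim(2) by (simp add: dist_real_def)
      have "\<bar>(\<integral>\<omega>. h (Y n \<omega>) \<partial>M) - (\<integral>z. h z \<partial>N)\<bar> < 2 * c + e"
        using a1 a2 a3 unfolding abs_le_iff abs_less_iff by linarith
      also have "\<dots> = 2 * (2 * e + (2 * B + 1) * e) + e" by (simp add: c_def)
      also have "\<dots> \<le> e * (8 + 4 * B)" using e by (simp add: algebra_simps)
      finally show ?case using ee by (simp add: dist_real_def)
    qed
  qed
qed

section \<open>Roots of estimating equations\<close>

lemma bounded_bilinear_matrix_vector_mult:
  "bounded_bilinear ((*v) :: real ^ 'm::finite ^ 'p::finite \<Rightarrow> real ^ 'm \<Rightarrow> real ^ 'p)"
proof
  show "\<exists>K. \<forall>(A :: real ^ 'm ^ 'p) x. norm (A *v x) \<le> norm A * norm x * K"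
  proof (intro exI[of _ "real CARD('p)"] allI)
    fix A :: "real ^ 'm ^ 'p" and x :: "real ^ 'm"
    have "norm (A *v x) \<le> (\<Sum>i\<in>UNIV. \<bar>(A *v x) $ i\<bar>)" by (rule norm_le_l1_cart)
    also have "\<dots> \<le> (\<Sum>i\<in>(UNIV :: 'p set). norm A * norm x)"
    proof (rule sum_mono)
      fix i
      have "\<bar>(A *v x) $ i\<bar> = \<bar>A $ i \<bullet> x\<bar>" by (simp add: matrix_vector_mul_component)
      also have "\<dots> \<le> norm (A $ i) * norm x" by (rule Cauchy_Schwarz_ineq2)
      also have "\<dots> \<le> norm A * norm x" by (intro mult_right_mono Finite_Cartesian_Product.norm_nth_le) simp
      finally show "\<bar>(A *v x) $ i\<bar> \<le> norm A * norm x" .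
    qed
    finally show "norm (A *v x) \<le> norm A * norm x * real CARD('p)" by (simp add: mult.commute)
  qed
qed (simp_all add: matrix_vector_mult_add_rdistrib matrix_vector_right_distrib matrix_vector_mult_scaleR scaleR_matrix_vector_assoc)

lemmas continuous_on_matrix_vector_mult [continuous_intros] =
  bounded_bilinear.continuous_on[OF bounded_bilinear_matrix_vector_mult]

lemma matrix_vector_mult_bound:
  obtains K where "K > 0" "\<And>(A :: real ^ 'm::finite ^ 'p::finite) x. norm (A *v x) \<le> K * norm A * norm x"
  using bounded_bilinear.pos_bounded[OF bounded_bilinear_matrix_vector_mult] by (metis mult.commute mult.assoc)

text \<open>The deterministic part of the argument: \<open>y\<close> stands for the sample mean of
  the trigonometric vectors. Differentiability of \<open>\<gamma>\<close> is asked for at the single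
  point \<open>\<theta>0\<close>, continuity on all of \<open>C\<close>.\<close>

locale z_estimator =
  fixes A :: "real ^ 'p::finite \<Rightarrow> real ^ 'm::finite ^ 'p" and \<gamma> :: "real ^ 'p \<Rightarrow> real ^ 'm"
    and C :: "(real ^ 'p) set" and \<theta>0 :: "real ^ 'p" and D :: "real ^ 'p ^ 'm"
  assumes A_cont: "continuous_on C A" and \<gamma>_cont: "continuous_on C \<gamma>"
    and \<theta>0: "\<theta>0 \<in> interior C"
    and deriv: "(\<gamma> has_derivative (\<lambda>h. D *v h)) (at \<theta>0)"
    and J: "invertible (A \<theta>0 ** D)"
begin

definition score :: "real ^ 'p \<Rightarrow> real ^ 'm \<Rightarrow> real ^ 'p" where
  "score \<theta> y = A \<theta> *v (y - \<gamma> \<theta>)"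

abbreviation "Ji \<equiv> matrix_inv (A \<theta>0 ** D)"

lemma \<theta>0_in: "\<theta>0 \<in> C" using \<theta>0 interior_subset by blast

text \<open>Continuity of \<open>A\<close> is enough for a first-order expansion, because the
  variation of \<open>A\<close> is multiplied by y - \<gamma> \<theta>, itself of first order. The
  neighbourhood of \<open>\<theta>0\<close> does not depend on \<open>y\<close>.\<close>

lemma score_expansion:
  assumes "\<eta> > 0"
  shows "\<exists>\<delta>>0. \<forall>\<theta>\<in>C. norm (\<theta> - \<theta>0) < \<delta> \<longrightarrow> (\<forall>y.
    norm (score \<theta> y - (A \<theta>0 *v (y - \<gamma> \<theta>0) - (A \<theta>0 ** D) *v (\<theta> - \<theta>0)))
      \<le> \<eta> * (norm (y - \<gamma> \<theta>0) + norm (\<theta> - \<theta>0)))"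
proof -
  obtain K where K: "K > 0" "\<And>(A :: real ^ 'm ^ 'p) x. norm (A *v x) \<le> K * norm A * norm x"
    using matrix_vector_mult_bound by blast
  obtain K' where K': "K' > 0" "\<And>(A :: real ^ 'p ^ 'm) x. norm (A *v x) \<le> K' * norm A * norm x"
    using matrix_vector_mult_bound by blast
  define d where "d = K' * norm D"
  have d: "d \<ge> 0" using K' by (simp add: d_def)
  define a where "a = norm (A \<theta>0) + 1"
  have a: "a > 0" by (simp add: a_def add_nonneg_pos)
  \<comment> \<open>The bound \<open>\<epsilon>\<close> is for the variation of \<open>A\<close> and
    \<open>\<epsilon>'\<close> for the remainder of \<open>\<gamma>\<close>. Each contributes at
    most half of \<eta> to the coefficient of norm (\<theta> - \<theta>0).\<close>
  define \<epsilon> where "\<epsilon> = min 1 (\<eta> / (2 * K * (1 + d)))"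
  have \<epsilon>: "\<epsilon> > 0" using assms K d by (auto simp: \<epsilon>_def)
  have \<epsilon>2: "K * \<epsilon> * (1 + d) \<le> \<eta> / 2"
  proof -
    have "\<epsilon> \<le> \<eta> / (2 * K * (1 + d))" by (simp add: \<epsilon>_def)
    then show ?thesis using K d by (simp add: pos_le_divide_eq mult_ac)
  qed
  define \<epsilon>' where "\<epsilon>' = \<eta> / (2 * K * a)"
  have \<epsilon>': "\<epsilon>' > 0" using assms K a by (simp add: \<epsilon>'_def)
  have \<epsilon>'2: "K * a * \<epsilon>' = \<eta> / 2" using K a by (simp add: \<epsilon>'_def)
  obtain \<delta>1 where \<delta>1: "\<delta>1 > 0" "\<And>\<theta>. \<theta> \<in> C \<Longrightarrow> dist \<theta> \<theta>0 < \<delta>1 \<Longrightarrow> dist (A \<theta>) (A \<theta>0) < \<epsilon>"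
    using A_cont \<theta>0_in \<epsilon> unfolding continuous_on_iff by metis
  obtain \<delta>2 where \<delta>2: "\<delta>2 > 0" "\<And>\<theta>. norm (\<theta> - \<theta>0) < \<delta>2 \<Longrightarrow> norm (\<gamma> \<theta> - \<gamma> \<theta>0 - D *v (\<theta> - \<theta>0)) \<le> \<epsilon>' * norm (\<theta> - \<theta>0)"
    using deriv \<epsilon>' unfolding has_derivative_at_alt by blast
  show ?thesis
  proof (intro exI[of _ "min \<delta>1 \<delta>2"] conjI ballI impI allI)
    show "min \<delta>1 \<delta>2 > 0" using \<delta>1 \<delta>2 by simp
    fix \<theta> y assume \<theta>: "\<theta> \<in> C" "norm (\<theta> - \<theta>0) < min \<delta>1 \<delta>2"
    define r where "r = \<gamma> \<theta> - \<gamma> \<theta>0 - D *v (\<theta> - \<theta>0)"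
    define E where "E = A \<theta> - A \<theta>0"
    have E: "norm E \<le> \<epsilon>" using \<delta>1(2)[OF \<theta>(1)] \<theta>(2) by (simp add: E_def dist_norm)
    have Aa: "norm (A \<theta>) \<le> a"
    proof -
      have "norm (A \<theta>0 + E) \<le> norm (A \<theta>0) + 1"
        using E by (intro order.trans[OF norm_triangle_ineq] add_left_mono) (simp add: \<epsilon>_def)
      then show ?thesis by (simp add: E_def a_def)
    qed
    have r: "norm r \<le> \<epsilon>' * norm (\<theta> - \<theta>0)" using \<delta>2(2) \<theta>(2) by (simp add: r_def)
    have "score \<theta> y = A \<theta> *v (y - \<gamma> \<theta>0) - A \<theta> *v (D *v (\<theta> - \<theta>0)) - A \<theta> *v r"
      unfolding score_def r_def by (simp flip: matrix_vector_mult_diff_distrib)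
    also have "A \<theta> = A \<theta>0 + E" by (simp add: E_def)
    finally have eq: "score \<theta> y - (A \<theta>0 *v (y - \<gamma> \<theta>0) - (A \<theta>0 ** D) *v (\<theta> - \<theta>0))
       = E *v (y - \<gamma> \<theta>0) - E *v (D *v (\<theta> - \<theta>0)) - A \<theta> *v r"
      by (simp add: E_def matrix_vector_mul_assoc[symmetric] bounded_bilinear.diff_left[OF bounded_bilinear_matrix_vector_mult])
    have "norm (E *v (y - \<gamma> \<theta>0)) \<le> K * \<epsilon> * norm (y - \<gamma> \<theta>0)"
      using K E by (intro order.trans[OF K(2)] mult_right_mono mult_left_mono) auto
    moreover have "norm (E *v (D *v (\<theta> - \<theta>0))) \<le> K * \<epsilon> * (d * norm (\<theta> - \<theta>0))"
      unfolding d_def using K E K'(2)[of D "\<theta> - \<theta>0"] \<epsilon> by (intro order.trans[OF K(2)] mult_mono) auto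
    moreover have "norm (A \<theta> *v r) \<le> K * a * (\<epsilon>' * norm (\<theta> - \<theta>0))"
      using K Aa r a by (intro order.trans[OF K(2)] mult_mono) auto
    ultimately have "norm (E *v (y - \<gamma> \<theta>0) - E *v (D *v (\<theta> - \<theta>0)) - A \<theta> *v r)
       \<le> K * \<epsilon> * norm (y - \<gamma> \<theta>0) + K * \<epsilon> * (d * norm (\<theta> - \<theta>0)) + K * a * (\<epsilon>' * norm (\<theta> - \<theta>0))"
      by (intro order.trans[OF norm_triangle_ineq4] add_mono)
    also have "\<dots> \<le> \<eta> * (norm (y - \<gamma> \<theta>0) + norm (\<theta> - \<theta>0))"
    proof -
      have "K * \<epsilon> * 1 \<le> K * \<epsilon> * (1 + d)" using K \<epsilon> d by (intro mult_left_mono) auto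
      then have "K * \<epsilon> \<le> \<eta>" using \<epsilon>2 assms by linarith
      then have 1: "K * \<epsilon> * norm (y - \<gamma> \<theta>0) \<le> \<eta> * norm (y - \<gamma> \<theta>0)" by (intro mult_right_mono) auto
      have "K * \<epsilon> * d \<le> K * \<epsilon> * (1 + d)" using K \<epsilon> d by (intro mult_left_mono) auto
      then have "K * \<epsilon> * d \<le> \<eta> / 2" using \<epsilon>2 by linarith
      then have "(K * \<epsilon> * d + K * a * \<epsilon>') * norm (\<theta> - \<theta>0) \<le> \<eta> * norm (\<theta> - \<theta>0)"
        unfolding \<epsilon>'2 by (intro mult_right_mono) auto
      with 1 show ?thesis by (simp add: algebra_simps)
    qed
    finally show "norm (score \<theta> y - (A \<theta>0 *v (y - \<gamma> \<theta>0) - (A \<theta>0 ** D) *v (\<theta> - \<theta>0)))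
      \<le> \<eta> * (norm (y - \<gamma> \<theta>0) + norm (\<theta> - \<theta>0))" unfolding eq .
  qed
qed

text \<open>The simplified Newton map \<theta> + Ji score is nearly constant near
  \<open>\<theta>0\<close>: its value is \<open>\<theta>0\<close> plus a linear function of
  \<open>y\<close> up to a small relative error. Existence of roots and their linearisation both
  follow from this single estimate.\<close>

lemma newton_expansion:
  assumes "\<kappa> > 0"
  shows "\<exists>\<delta>>0. \<forall>\<theta>\<in>C. norm (\<theta> - \<theta>0) < \<delta> \<longrightarrow> (\<forall>y.
    norm (\<theta> - \<theta>0 + Ji *v score \<theta> y - Ji *v (A \<theta>0 *v (y - \<gamma> \<theta>0)))
      \<le> \<kappa> * (norm (y - \<gamma> \<theta>0) + norm (\<theta> - \<theta>0)))"
proof -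
  obtain K where K: "K > 0" "\<And>(A :: real ^ 'p ^ 'p) x. norm (A *v x) \<le> K * norm A * norm x"
    using matrix_vector_mult_bound by blast
  define c where "c = K * norm Ji + 1"
  have c: "c > 0" "\<And>x. norm (Ji *v x) \<le> c * norm x"
  proof -
    show "c > 0" using K by (simp add: c_def add_nonneg_pos)
    fix x
    have "norm (Ji *v x) \<le> K * norm Ji * norm x" by (rule K(2))
    also have "\<dots> \<le> c * norm x" unfolding c_def by (intro mult_right_mono) auto
    finally show "norm (Ji *v x) \<le> c * norm x" .
  qed
  obtain \<delta> where \<delta>: "\<delta> > 0" "\<And>\<theta> y. \<theta> \<in> C \<Longrightarrow> norm (\<theta> - \<theta>0) < \<delta> \<Longrightarrow>
    norm (score \<theta> y - (A \<theta>0 *v (y - \<gamma> \<theta>0) - (A \<theta>0 ** D) *v (\<theta> - \<theta>0))) \<le> \<kappa> / c * (norm (y - \<gamma> \<theta>0) + norm (\<theta> - \<theta>0))"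
    using score_expansion[of "\<kappa> / c"] c(1) assms by (meson divide_pos_pos)
  show ?thesis
  proof (intro exI[of _ \<delta>] conjI ballI impI allI \<delta>(1))
    fix \<theta> y assume \<theta>: "\<theta> \<in> C" "norm (\<theta> - \<theta>0) < \<delta>"
    have "Ji *v ((A \<theta>0 ** D) *v (\<theta> - \<theta>0)) = \<theta> - \<theta>0"
      by (simp only: matrix_vector_mul_assoc matrix_inv_mult(2)[OF J] matrix_vector_mul_lid)
    then have "\<theta> - \<theta>0 + Ji *v score \<theta> y - Ji *v (A \<theta>0 *v (y - \<gamma> \<theta>0))
       = Ji *v (score \<theta> y - (A \<theta>0 *v (y - \<gamma> \<theta>0) - (A \<theta>0 ** D) *v (\<theta> - \<theta>0)))"
      by (simp add: matrix_vector_mult_diff_distrib)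
    also have "norm \<dots> \<le> c * (\<kappa> / c * (norm (y - \<gamma> \<theta>0) + norm (\<theta> - \<theta>0)))"
      using c(1) by (intro order.trans[OF c(2)] mult_left_mono \<delta>(2) \<theta>) auto
    also have "\<dots> = \<kappa> * (norm (y - \<gamma> \<theta>0) + norm (\<theta> - \<theta>0))" using c(1) by simp
    finally show "norm (\<theta> - \<theta>0 + Ji *v score \<theta> y - Ji *v (A \<theta>0 *v (y - \<gamma> \<theta>0))) \<le> \<kappa> * (norm (y - \<gamma> \<theta>0) + norm (\<theta> - \<theta>0))" .
  qed
qed

lemma linear_part_bound:
  obtains B where "B > 0" "\<And>y. norm (Ji *v (A \<theta>0 *v y)) \<le> B * norm y"
proof -
  obtain K where K: "K > 0" "\<And>(A :: real ^ 'm ^ 'p) x. norm (A *v x) \<le> K * norm A * norm x"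
    using matrix_vector_mult_bound by blast
  show ?thesis
  proof (rule that[of "K * norm (Ji ** A \<theta>0) + 1"])
    show "K * norm (Ji ** A \<theta>0) + 1 > 0" using K by (simp add: add_nonneg_pos)
    fix y
    have "norm (Ji *v (A \<theta>0 *v y)) \<le> K * norm (Ji ** A \<theta>0) * norm y"
      unfolding matrix_vector_mul_assoc by (rule K(2))
    also have "\<dots> \<le> (K * norm (Ji ** A \<theta>0) + 1) * norm y" by (intro mult_right_mono) auto
    finally show "norm (Ji *v (A \<theta>0 *v y)) \<le> (K * norm (Ji ** A \<theta>0) + 1) * norm y" .
  qed
qed

text \<open>At a root the Newton correction vanishes. A relative error of at most 1/2 lets the term
  in norm (\<theta> - \<theta>0) be absorbed on the left, which bounds the deviation of the root by
  a multiple of the deviation of \<open>y\<close>.\<close>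

lemma root_linearization:
  assumes "\<eta> > 0"
  shows "\<exists>\<delta>>0. \<forall>\<theta>\<in>C. norm (\<theta> - \<theta>0) < \<delta> \<longrightarrow> (\<forall>y. score \<theta> y = 0 \<longrightarrow>
    norm (\<theta> - \<theta>0 - Ji *v (A \<theta>0 *v (y - \<gamma> \<theta>0))) \<le> \<eta> * norm (y - \<gamma> \<theta>0))"
proof -
  obtain B where B: "B > 0" "\<And>y. norm (Ji *v (A \<theta>0 *v y)) \<le> B * norm y" using linear_part_bound by blast
  \<comment> \<open>After absorption the sum of the two deviations is at most 2 + 2 B times that of
    \<open>y\<close>, whence the second entry.\<close>
  define \<kappa> where "\<kappa> = min (1/2) (\<eta> / (2 + 2 * B))"
  have \<kappa>: "\<kappa> > 0" "\<kappa> \<le> 1/2" using assms B by (simp_all only: \<kappa>_def min.cobounded1) auto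
  have "\<kappa> \<le> \<eta> / (2 + 2 * B)" by (simp add: \<kappa>_def)
  then have \<kappa>2: "\<kappa> * (2 + 2 * B) \<le> \<eta>" using B by (simp add: pos_le_divide_eq)
  obtain \<delta> where \<delta>: "\<delta> > 0" "\<And>\<theta> y. \<theta> \<in> C \<Longrightarrow> norm (\<theta> - \<theta>0) < \<delta> \<Longrightarrow>
    norm (\<theta> - \<theta>0 + Ji *v score \<theta> y - Ji *v (A \<theta>0 *v (y - \<gamma> \<theta>0))) \<le> \<kappa> * (norm (y - \<gamma> \<theta>0) + norm (\<theta> - \<theta>0))"
    using newton_expansion[OF \<kappa>(1)] by blast
  show ?thesis
  proof (intro exI[of _ \<delta>] conjI ballI impI allI \<delta>(1))
    fix \<theta> y assume \<theta>: "\<theta> \<in> C" "norm (\<theta> - \<theta>0) < \<delta>" and root: "score \<theta> y = 0"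
    let ?e = "\<theta> - \<theta>0 - Ji *v (A \<theta>0 *v (y - \<gamma> \<theta>0))"
    have e: "norm ?e \<le> \<kappa> * (norm (y - \<gamma> \<theta>0) + norm (\<theta> - \<theta>0))"
      using \<delta>(2)[OF \<theta>, of y] root by simp
    have "norm (\<theta> - \<theta>0) \<le> norm ?e + norm (Ji *v (A \<theta>0 *v (y - \<gamma> \<theta>0)))"
      using norm_triangle_ineq[of ?e "Ji *v (A \<theta>0 *v (y - \<gamma> \<theta>0))"] by simp
    also have "\<dots> \<le> 1/2 * (norm (y - \<gamma> \<theta>0) + norm (\<theta> - \<theta>0)) + B * norm (y - \<gamma> \<theta>0)"
      using \<kappa>(2) by (intro add_mono order.trans[OF e] mult_right_mono B(2)) auto
    finally have "norm (y - \<gamma> \<theta>0) + norm (\<theta> - \<theta>0) \<le> (2 + 2 * B) * norm (y - \<gamma> \<theta>0)"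
      by (simp add: algebra_simps)
    then have "\<kappa> * (norm (y - \<gamma> \<theta>0) + norm (\<theta> - \<theta>0)) \<le> \<kappa> * ((2 + 2 * B) * norm (y - \<gamma> \<theta>0))"
      using \<kappa> by (intro mult_left_mono) auto
    also have "\<dots> \<le> \<eta> * norm (y - \<gamma> \<theta>0)" using mult_right_mono[OF \<kappa>2, of "norm (y - \<gamma> \<theta>0)"] by (simp add: mult.assoc)
    finally show "norm ?e \<le> \<eta> * norm (y - \<gamma> \<theta>0)" using e by linarith
  qed
qed

text \<open>Brouwer's theorem applied to a simplified Newton step with frozen derivative.\<close>

lemma root_exists:
  assumes "\<epsilon> > 0"
  shows "\<exists>\<delta>>0. \<forall>y. norm (y - \<gamma> \<theta>0) < \<delta> \<longrightarrow> (\<exists>\<theta>\<in>C. norm (\<theta> - \<theta>0) \<le> \<epsilon> \<and> score \<theta> y = 0)"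
proof -
  obtain B where B: "B > 0" "\<And>y. norm (Ji *v (A \<theta>0 *v y)) \<le> B * norm y" using linear_part_bound by blast
  obtain \<delta> where \<delta>: "\<delta> > 0" "\<And>\<theta> y. \<theta> \<in> C \<Longrightarrow> norm (\<theta> - \<theta>0) < \<delta> \<Longrightarrow>
    norm (\<theta> - \<theta>0 + Ji *v score \<theta> y - Ji *v (A \<theta>0 *v (y - \<gamma> \<theta>0))) \<le> 1/2 * (norm (y - \<gamma> \<theta>0) + norm (\<theta> - \<theta>0))"
    using newton_expansion[of "1/2"] by auto
  obtain \<rho> where \<rho>: "\<rho> > 0" "cball \<theta>0 \<rho> \<subseteq> C" using \<theta>0 unfolding mem_interior_cball by blast
  define r where "r = min \<epsilon> (min \<rho> (\<delta> / 2))"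
  have r: "r > 0" "r \<le> \<epsilon>" "r \<le> \<rho>" "r < \<delta>" using assms \<rho> \<delta> by (auto simp: r_def)
  have rC: "cball \<theta>0 r \<subseteq> C" using \<rho> r by auto
  show ?thesis
  \<comment> \<open>The ball is mapped into itself when (d + r) / 2 + B d \<le> r for the deviation
    d of \<open>y\<close>, that is, when (1 + 2 B) d \<le> r.\<close>
  proof (intro exI[of _ "r / (1 + 2 * B)"] conjI allI impI)
    show "r / (1 + 2 * B) > 0" using r B by simp
    fix y assume y: "norm (y - \<gamma> \<theta>0) < r / (1 + 2 * B)"
    then have y2: "norm (y - \<gamma> \<theta>0) * (1 + 2 * B) < r" using B by (simp add: pos_less_divide_eq)
    define \<Phi> where "\<Phi> \<theta> = \<theta> + Ji *v score \<theta> y" for \<theta>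
    have "continuous_on (cball \<theta>0 r) \<Phi>"
      unfolding \<Phi>_def score_def
      by (intro continuous_intros continuous_on_subset[OF A_cont rC] continuous_on_subset[OF \<gamma>_cont rC])
    moreover have "\<Phi> \<in> cball \<theta>0 r \<rightarrow> cball \<theta>0 r"
    proof
      fix \<theta> assume \<theta>: "\<theta> \<in> cball \<theta>0 r"
      then have n: "norm (\<theta> - \<theta>0) \<le> r" by (simp add: dist_norm norm_minus_commute)
      let ?e = "\<theta> - \<theta>0 + Ji *v score \<theta> y - Ji *v (A \<theta>0 *v (y - \<gamma> \<theta>0))"
      have "norm (\<Phi> \<theta> - \<theta>0) \<le> norm ?e + norm (Ji *v (A \<theta>0 *v (y - \<gamma> \<theta>0)))"
        using norm_triangle_ineq[of ?e "Ji *v (A \<theta>0 *v (y - \<gamma> \<theta>0))"] by (simp add: \<Phi>_def algebra_simps)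
      also have "\<dots> \<le> 1/2 * (norm (y - \<gamma> \<theta>0) + r) + B * norm (y - \<gamma> \<theta>0)"
        using \<theta> rC r n by (intro add_mono order.trans[OF \<delta>(2)] B(2)) auto
      also have "\<dots> \<le> r" using y2 by (simp add: algebra_simps)
      finally show "\<Phi> \<theta> \<in> cball \<theta>0 r" by (simp add: dist_norm norm_minus_commute)
    qed
    ultimately obtain \<theta> where \<theta>: "\<theta> \<in> cball \<theta>0 r" "\<Phi> \<theta> = \<theta>"
      using brouwer[of "cball \<theta>0 r" \<Phi>] r by auto
    then have "Ji *v score \<theta> y = 0" by (simp add: \<Phi>_def)
    then have "(A \<theta>0 ** D) *v (Ji *v score \<theta> y) = 0" by simp
    then have "score \<theta> y = 0" by (simp only: matrix_vector_mul_assoc matrix_inv_mult(1)[OF J] matrix_vector_mul_lid)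
    then show "\<exists>\<theta>\<in>C. norm (\<theta> - \<theta>0) \<le> \<epsilon> \<and> score \<theta> y = 0"
      using \<theta>(1) rC r by (intro bexI[of _ \<theta>]) (auto simp: dist_norm norm_minus_commute)
  qed
qed

end

section \<open>Measurable selection of a closest point\<close>

definition argmin_set :: "('a \<Rightarrow> real) \<Rightarrow> 'a set \<Rightarrow> 'a set" where
  "argmin_set h S = {x \<in> S. \<forall>y\<in>S. h x \<le> h y}"

text \<open>Measurability of a set-valued map, tested with closed sets. For singleton values it is
  ordinary Borel measurability, and the selection below ends in that case.\<close>

definition hit_measurable :: "'w measure \<Rightarrow> ('w \<Rightarrow> 'a::topological_space set) \<Rightarrow> bool" where
  "hit_measurable M R \<longleftrightarrow> (\<forall>K. closed K \<longrightarrow> {w \<in> space M. R w \<inter> K \<noteq> {}} \<in> sets M)"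

lemma compact_argmin_set:
  fixes h :: "'a::t2_space \<Rightarrow> real"
  assumes "compact S" "continuous_on UNIV h"
  shows "compact (argmin_set h S)" "S \<noteq> {} \<Longrightarrow> argmin_set h S \<noteq> {}"
proof -
  have "closed {x. \<forall>y\<in>S. h x \<le> h y}"
    unfolding Ball_def Collect_all_eq
    by (intro closed_INT ballI closed_Collect_imp closed_Collect_le open_Collect_const continuous_on_const assms(2))
  then have "compact (S \<inter> {x. \<forall>y\<in>S. h x \<le> h y})" using assms(1) by (rule compact_Int_closed[rotated])
  also have "S \<inter> {x. \<forall>y\<in>S. h x \<le> h y} = argmin_set h S" by (auto simp: argmin_set_def)
  finally show "compact (argmin_set h S)" .
  assume "S \<noteq> {}"
  then obtain x where "x \<in> S" "\<forall>y\<in>S. h x \<le> h y"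
    using continuous_attains_inf[OF assms(1) _ continuous_on_subset[OF assms(2) subset_UNIV]] by blast
  then show "argmin_set h S \<noteq> {}" by (auto simp: argmin_set_def)
qed

text \<open>
  \<open>argmin h S\<close> meets \<open>K\<close> iff for every level \<open>q\<close> reached by \<open>h\<close> on \<open>S\<close>, it is also reached on \<open>S \<inter> K\<close>;
  by compactness rational levels suffice.
\<close>

lemma hit_measurable_argmin_set:
  fixes R :: "'w \<Rightarrow> 'a::t2_space set" and h :: "'a \<Rightarrow> real"
  assumes R: "hit_measurable M R" and comp: "\<And>w. w \<in> space M \<Longrightarrow> compact (R w)"
    and h: "continuous_on UNIV h"
  shows "hit_measurable M (\<lambda>w. argmin_set h (R w))"
  unfolding hit_measurable_def
proof (intro allI impI)
  fix K :: "'a set" assume K: "closed K"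
  have lev: "closed {x. h x \<le> q}" for q by (intro closed_Collect_le h continuous_on_const)
  have hit: "{w \<in> space M. R w \<inter> K' \<noteq> {}} \<in> sets M" if "closed K'" for K'
    using R that by (simp add: hit_measurable_def)
  have "argmin_set h (R w) \<inter> K \<noteq> {} \<longleftrightarrow> R w \<inter> K \<noteq> {} \<and>
     (\<forall>q\<in>\<rat>. R w \<inter> {x. h x \<le> q} \<noteq> {} \<longrightarrow> R w \<inter> (K \<inter> {x. h x \<le> q}) \<noteq> {})"
    (is "?L \<longleftrightarrow> ?P") if w: "w \<in> space M" for w
  proof
    assume ?L
    then obtain x where "x \<in> R w" "x \<in> K" "\<forall>y\<in>R w. h x \<le> h y" by (auto simp: argmin_set_def)
    then show ?P by (blast intro: order.trans)
  next
    assume ?P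
    then have ne: "R w \<inter> K \<noteq> {}" by blast
    have "compact (R w \<inter> K)" using comp[OF w] K by blast
    then obtain x where x: "x \<in> R w" "x \<in> K" "\<And>y. y \<in> R w \<inter> K \<Longrightarrow> h x \<le> h y"
      using continuous_attains_inf[OF _ ne continuous_on_subset[OF h subset_UNIV]] by blast
    have "h x \<le> h y" if y: "y \<in> R w" for y
    proof (rule ccontr)
      assume "\<not> h x \<le> h y"
      then obtain q where q: "q \<in> \<rat>" "h y < q" "q < h x" using Rats_dense_in_real[of "h y" "h x"] by auto
      then have "R w \<inter> {x. h x \<le> q} \<noteq> {}" using y by auto
      then obtain z where "z \<in> R w" "z \<in> K" "h z \<le> q" using \<open>?P\<close> q(1) by blast
      then show False using x(3)[of z] q by auto
    qed
    then show ?L using x by (auto simp: argmin_set_def)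
  qed
  then have "{w \<in> space M. argmin_set h (R w) \<inter> K \<noteq> {}} = {w \<in> space M. R w \<inter> K \<noteq> {}} \<inter>
     {w \<in> space M. \<forall>q\<in>\<rat>. R w \<inter> {x. h x \<le> q} \<noteq> {} \<longrightarrow> R w \<inter> (K \<inter> {x. h x \<le> q}) \<noteq> {}}"
    by blast
  also have "\<dots> \<in> sets M"
    by (intro sets.Int hit K sets.sets_Collect_countable_All' countable_rat sets.sets_Collect_imp lev closed_Int)
  finally show "{w \<in> space M. argmin_set h (R w) \<inter> K \<noteq> {}} \<in> sets M" .
qed

text \<open>Each function is constant on the set of its minimisers, and later minimisations only
  shrink this set; so at the end all functions of the list are constant.\<close>

lemma fold_argmin_set:
  fixes R :: "'w \<Rightarrow> 'a::t2_space set"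
  assumes "hit_measurable M R" "\<And>w. w \<in> space M \<Longrightarrow> compact (R w)" "\<And>h. h \<in> set hs \<Longrightarrow> continuous_on UNIV h"
  shows "hit_measurable M (\<lambda>w. fold argmin_set hs (R w)) \<and>
    (\<forall>w\<in>space M. compact (fold argmin_set hs (R w)) \<and> fold argmin_set hs (R w) \<subseteq> R w \<and>
      (R w \<noteq> {} \<longrightarrow> fold argmin_set hs (R w) \<noteq> {}) \<and>
      (\<forall>h\<in>set hs. \<forall>x\<in>fold argmin_set hs (R w). \<forall>y\<in>fold argmin_set hs (R w). h x = h y))"
  using assms
proof (induction hs arbitrary: R)
  case (Cons h hs)
  let ?R = "\<lambda>w. argmin_set h (R w)"
  have h: "continuous_on UNIV h" using Cons.prems by simp
  have IH: "hit_measurable M (\<lambda>w. fold argmin_set hs (?R w)) \<and>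
    (\<forall>w\<in>space M. compact (fold argmin_set hs (?R w)) \<and> fold argmin_set hs (?R w) \<subseteq> ?R w \<and>
      (?R w \<noteq> {} \<longrightarrow> fold argmin_set hs (?R w) \<noteq> {}) \<and>
      (\<forall>h\<in>set hs. \<forall>x\<in>fold argmin_set hs (?R w). \<forall>y\<in>fold argmin_set hs (?R w). h x = h y))"
    using Cons.prems h by (intro Cons.IH hit_measurable_argmin_set compact_argmin_set(1)) auto
  have sub: "?R w \<subseteq> R w" for w by (auto simp: argmin_set_def)
  have const: "h x = h y" if "x \<in> ?R w" "y \<in> ?R w" for x y w
    using that by (auto simp: argmin_set_def intro: antisym)
  have "compact (fold argmin_set (h # hs) (R w)) \<and> fold argmin_set (h # hs) (R w) \<subseteq> R w \<and>
      (R w \<noteq> {} \<longrightarrow> fold argmin_set (h # hs) (R w) \<noteq> {}) \<and>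
      (\<forall>g\<in>set (h # hs). \<forall>x\<in>fold argmin_set (h # hs) (R w). \<forall>y\<in>fold argmin_set (h # hs) (R w). g x = g y)"
    if w: "w \<in> space M" for w
  proof -
    define Q where "Q = fold argmin_set hs (?R w)"
    have Q: "compact Q" "Q \<subseteq> ?R w" "?R w \<noteq> {} \<Longrightarrow> Q \<noteq> {}" "\<And>g x y. g \<in> set hs \<Longrightarrow> x \<in> Q \<Longrightarrow> y \<in> Q \<Longrightarrow> g x = g y"
      using IH w unfolding Q_def by simp_all
    have ne: "R w \<noteq> {} \<Longrightarrow> Q \<noteq> {}" using Q(3) compact_argmin_set(2)[OF Cons.prems(2)[OF w] h] by blast
    have gc: "g x = g y" if "g \<in> set (h # hs)" "x \<in> Q" "y \<in> Q" for g x y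
      using that Q(2,4) const[of x w y] by auto
    have eq: "fold argmin_set (h # hs) (R w) = Q" by (simp add: Q_def)
    show ?thesis
      unfolding eq by (intro conjI impI ballI Q(1) order.trans[OF Q(2) sub]) (erule ne, rule gc)
  qed
  moreover have "hit_measurable M (\<lambda>w. fold argmin_set (h # hs) (R w))" using IH by (simp only: fold_Cons o_apply)
  ultimately show ?case by blast
qed auto

text \<open>Lexicographic minimisation: the distance to \<open>a\<close>, then the coordinates one
  after another. Points that agree in all coordinates coincide, so exactly one point survives, and
  hitting a closed set turns into membership of this point.\<close>

lemma closest_measurable_selection:
  fixes R :: "'w \<Rightarrow> 'a::euclidean_space set"
  assumes R: "hit_measurable M R" and comp: "\<And>w. w \<in> space M \<Longrightarrow> compact (R w)"
  shows "\<exists>T\<in>borel_measurable M. \<forall>w\<in>space M. R w \<noteq> {} \<longrightarrow>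
     T w \<in> R w \<and> (\<forall>x\<in>R w. dist a (T w) \<le> dist a x)"
proof -
  \<comment> \<open>Empty values are replaced by {a}, so that minimisers exist everywhere and
    \<open>T\<close> is measurable on the whole space.\<close>
  define R' where "R' w = (if R w = {} then {a} else R w)" for w
  have R'_hit: "hit_measurable M R'"
    unfolding hit_measurable_def
  proof (intro allI impI)
    fix K :: "'a set" assume K: "closed K"
    have hit: "{w \<in> space M. R w \<inter> K' \<noteq> {}} \<in> sets M" if "closed K'" for K'
      using R that by (simp add: hit_measurable_def)
    have "{w \<in> space M. R' w \<inter> K \<noteq> {}} = {w \<in> space M. R w \<inter> K \<noteq> {}} \<union>
       (if a \<in> K then space M - {w \<in> space M. R w \<inter> UNIV \<noteq> {}} else {})"
      by (auto simp: R'_def)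
    also have "\<dots> \<in> sets M" using hit[OF K] hit[OF closed_UNIV] by auto
    finally show "{w \<in> space M. R' w \<inter> K \<noteq> {}} \<in> sets M" .
  qed
  have R'_comp: "w \<in> space M \<Longrightarrow> compact (R' w)" for w using comp by (simp add: R'_def)
  obtain bs where bs: "set bs = (Basis :: 'a set)" using finite_list[OF finite_Basis] by blast
  define S where "S w = argmin_set (dist a) (R' w)" for w
  have S_hit: "hit_measurable M S" and S_comp: "w \<in> space M \<Longrightarrow> compact (S w)" for w
    unfolding S_def by (intro hit_measurable_argmin_set compact_argmin_set R'_hit R'_comp continuous_intros; assumption)+
  have S_ne: "S w \<noteq> {}" if "w \<in> space M" for w
    unfolding S_def using that R'_comp by (intro compact_argmin_set(2) continuous_intros) (auto simp: R'_def)
  define Q where "Q w = fold argmin_set (map (\<lambda>b x. x \<bullet> b) bs) (S w)" for w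
  have Q: "hit_measurable M Q" "\<And>w. w \<in> space M \<Longrightarrow> Q w \<subseteq> S w" "\<And>w. w \<in> space M \<Longrightarrow> Q w \<noteq> {}"
    "\<And>w x y b. w \<in> space M \<Longrightarrow> x \<in> Q w \<Longrightarrow> y \<in> Q w \<Longrightarrow> b \<in> Basis \<Longrightarrow> x \<bullet> b = y \<bullet> b"
  proof -
    have c: "continuous_on UNIV h" if "h \<in> set (map (\<lambda>b x. x \<bullet> b) bs)" for h :: "'a \<Rightarrow> real"
      using that by (auto intro!: continuous_intros)
    have f: "hit_measurable M Q \<and> (\<forall>w\<in>space M. compact (Q w) \<and> Q w \<subseteq> S w \<and> (S w \<noteq> {} \<longrightarrow> Q w \<noteq> {}) \<and>
      (\<forall>h\<in>set (map (\<lambda>b x. x \<bullet> b) bs). \<forall>x\<in>Q w. \<forall>y\<in>Q w. h x = h y))"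
      unfolding Q_def by (intro fold_argmin_set S_hit S_comp c)
    then show "hit_measurable M Q" by (rule conjunct1)
    note g = bspec[OF conjunct2[OF f]]
    show "Q w \<subseteq> S w" "Q w \<noteq> {}" if "w \<in> space M" for w
      using g[OF that] S_ne[OF that] by simp_all
    show "x \<bullet> b = y \<bullet> b" if "w \<in> space M" "x \<in> Q w" "y \<in> Q w" "b \<in> Basis" for w x y b
    proof -
      have "(\<lambda>x. x \<bullet> b) \<in> set (map (\<lambda>b x. x \<bullet> b) bs)" using that(4) bs by auto
      from bspec[OF bspec[OF bspec[OF conjunct2[OF conjunct2[OF conjunct2[OF g[OF that(1)]]]] this] that(2)] that(3)]
      show ?thesis .
    qed
  qed
  define T where "T w = (SOME x. x \<in> Q w)" for w
  have TQ: "T w \<in> Q w" if "w \<in> space M" for w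
    unfolding T_def using Q(3)[OF that] by (simp add: some_in_eq)
  have Q_sing: "Q w = {T w}" if "w \<in> space M" for w
  proof -
    have "x = T w" if "x \<in> Q w" for x
      by (rule euclidean_eqI) (rule Q(4)[OF \<open>w \<in> space M\<close> that TQ[OF \<open>w \<in> space M\<close>]])
    then show ?thesis using TQ[OF that] by blast
  qed
  have "T \<in> borel_measurable M"
    unfolding borel_eq_closed
  proof (rule measurable_measure_of)
    fix K :: "'a set" assume "K \<in> Collect closed"
    then have "{w \<in> space M. Q w \<inter> K \<noteq> {}} \<in> sets M" using Q(1) by (simp add: hit_measurable_def)
    also have "{w \<in> space M. Q w \<inter> K \<noteq> {}} = T -` K \<inter> space M" using Q_sing by auto
    finally show "T -` K \<inter> space M \<in> sets M" .
  qed auto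
  moreover have "T w \<in> R w \<and> (\<forall>x\<in>R w. dist a (T w) \<le> dist a x)" if "w \<in> space M" "R w \<noteq> {}" for w
    using Q(2)[OF that(1)] TQ[OF that(1)] that(2) by (auto simp: S_def argmin_set_def R'_def)
  ultimately show ?thesis by blast
qed

section \<open>Asymptotics of roots\<close>

lemma prob_tendsto_zero_iff:
  fixes p :: "nat \<Rightarrow> real"
  assumes "\<And>n. 0 \<le> p n"
  shows "p \<longlonglongrightarrow> 0 \<longleftrightarrow> (\<forall>e>0. \<forall>\<^sub>F n in sequentially. p n \<le> e)"
proof
  assume "p \<longlonglongrightarrow> 0"
  then show "\<forall>e>0. \<forall>\<^sub>F n in sequentially. p n \<le> e"
    using order_tendstoD(2) by (fastforce elim: eventually_mono)
next
  assume r: "\<forall>e>0. \<forall>\<^sub>F n in sequentially. p n \<le> e"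
  show "p \<longlonglongrightarrow> 0"
  proof (rule tendstoI)
    fix e :: real assume "e > 0"
    then have "\<forall>\<^sub>F n in sequentially. p n \<le> e / 2" using r half_gt_zero by blast
    then show "\<forall>\<^sub>F n in sequentially. dist (p n) 0 < e"
      using \<open>e > 0\<close> assms by (auto elim!: eventually_mono simp: dist_real_def)
  qed
qed

text \<open>Measurability comes for free because a nonmeasurable set has \<open>measure\<close> 0.\<close>

lemma (in prob_space) complement_prob_small:
  assumes lim: "(\<lambda>n. measure M {w \<in> space M. P n w}) \<longlonglongrightarrow> 1" and e: "e > 0"
  shows "\<forall>\<^sub>F n in sequentially. {w \<in> space M. \<not> P n w} \<in> events \<and> measure M {w \<in> space M. \<not> P n w} \<le> e"
proof -
  have "\<forall>\<^sub>F n in sequentially. max 0 (1 - e) < measure M {w \<in> space M. P n w}"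
    using lim e by (intro order_tendstoD(1)) auto
  then show ?thesis
  proof eventually_elim
    case (elim n)
    then have m: "{w \<in> space M. P n w} \<in> events" by (metis less_le_trans max.cobounded1 measure_notin_sets less_irrefl)
    have "{w \<in> space M. \<not> P n w} = space M - {w \<in> space M. P n w}" by auto
    then show ?case using m elim prob_compl[OF m] by auto
  qed
qed

context z_estimator
begin

text \<open>The sample enters through measurability and tightness of the normalised deviations; how
  tightness arises is left to the application.\<close>

context
  fixes M :: "'w measure" and Y :: "nat \<Rightarrow> 'w \<Rightarrow> real ^ 'm"
  assumes M: "prob_space M" and C: "compact C"
    and Y [measurable]: "\<And>n. Y n \<in> borel_measurable M"
    and tight: "\<And>e. e > 0 \<Longrightarrow> \<exists>K>0. \<forall>\<^sub>F n in sequentially.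
       measure M {w \<in> space M. K < norm (sqrt (real n) *\<^sub>R (Y n w - \<gamma> \<theta>0))} \<le> e"
begin

interpretation M: prob_space M by (rule M)

text \<open>For large n the number \<delta> sqrt n exceeds the tightness bound K.\<close>

lemma moments_consistent:
  assumes "\<delta> > 0"
  shows "(\<lambda>n. measure M {w \<in> space M. \<delta> \<le> norm (Y n w - \<gamma> \<theta>0)}) \<longlonglongrightarrow> 0"
  unfolding prob_tendsto_zero_iff[OF measure_nonneg]
proof (intro allI impI)
  fix e :: real assume "e > 0"
  then obtain K where K: "K > 0" "\<forall>\<^sub>F n in sequentially.
       measure M {w \<in> space M. K < norm (sqrt (real n) *\<^sub>R (Y n w - \<gamma> \<theta>0))} \<le> e"
    using tight by blast
  have "filterlim (\<lambda>n. sqrt (real n)) at_top sequentially"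
    using filterlim_compose[OF sqrt_at_top filterlim_real_sequentially] .
  then have "\<forall>\<^sub>F n in sequentially. K / \<delta> < sqrt (real n)" by (rule filterlim_at_top_dense[THEN iffD1, rule_format])
  with K(2) show "\<forall>\<^sub>F n in sequentially. measure M {w \<in> space M. \<delta> \<le> norm (Y n w - \<gamma> \<theta>0)} \<le> e"
  proof eventually_elim
    case (elim n)
    have "K < norm (sqrt (real n) *\<^sub>R y)" if "\<delta> \<le> norm y" for y :: "real ^ 'm"
    proof -
      have "K < sqrt (real n) * \<delta>" using elim(2) assms by (simp add: pos_divide_less_eq)
      also have "\<dots> \<le> sqrt (real n) * norm y" using that by (intro mult_left_mono) auto
      finally show ?thesis by simp
    qed
    then have "measure M {w \<in> space M. \<delta> \<le> norm (Y n w - \<gamma> \<theta>0)} \<le>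
       measure M {w \<in> space M. K < norm (sqrt (real n) *\<^sub>R (Y n w - \<gamma> \<theta>0))}"
      by (intro M.finite_measure_mono) auto
    with elim(1) show ?case by linarith
  qed
qed

lemma root_set_compact: "compact {\<theta> \<in> C. score \<theta> y = 0}"
proof -
  have "continuous_on C (\<lambda>\<theta>. score \<theta> y)" unfolding score_def by (intro continuous_intros A_cont \<gamma>_cont)
  then have "closed (C \<inter> (\<lambda>\<theta>. score \<theta> y) -` {0})"
    using compact_imp_closed[OF C] by (intro continuous_closed_preimage) auto
  then have "compact (C \<inter> (C \<inter> (\<lambda>\<theta>. score \<theta> y) -` {0}))" using C by (intro compact_Int_closed)
  moreover have "C \<inter> (C \<inter> (\<lambda>\<theta>. score \<theta> y) -` {0}) = {\<theta> \<in> C. score \<theta> y = 0}" by auto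
  ultimately show ?thesis by simp
qed

text \<open>The values \<open>y\<close> admitting a root in C \<inter> K form the projection of a
  closed set along the compact factor C \<inter> K. Such a projection is closed, so the event is the
  preimage of a closed set.\<close>

lemma root_set_hit_measurable: "hit_measurable M (\<lambda>w. {\<theta> \<in> C. score \<theta> (Y n w) = 0})"
  unfolding hit_measurable_def
proof (intro allI impI)
  fix K :: "(real ^ 'p) set" assume K: "closed K"
  have CK: "compact (C \<inter> K)" using C K by (intro compact_Int_closed)
  have "continuous_on ((C \<inter> K) \<times> UNIV) (\<lambda>p. A (fst p) *v (snd p - \<gamma> (fst p)))"
    by (intro continuous_intros continuous_on_compose2[OF A_cont] continuous_on_compose2[OF \<gamma>_cont]) auto
  then have "closed (((C \<inter> K) \<times> UNIV) \<inter> (\<lambda>p. A (fst p) *v (snd p - \<gamma> (fst p))) -` {0})"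
    using compact_imp_closed[OF CK] by (intro continuous_closed_preimage closed_Times) auto
  from closed_compact_projection[OF CK this]
  have "closed {y. \<exists>\<theta>\<in>C \<inter> K. score \<theta> y = 0}" by (simp add: score_def Bex_def conj_ac)
  then have "{y. \<exists>\<theta>\<in>C \<inter> K. score \<theta> y = 0} \<in> sets borel" by simp
  from measurable_sets[OF Y this, of n]
  show "{w \<in> space M. {\<theta> \<in> C. score \<theta> (Y n w) = 0} \<inter> K \<noteq> {}} \<in> sets M"
    by (rule arg_cong[THEN iffD1, of _ _ "\<lambda>S. S \<in> sets M", rotated]) auto
qed

lemma root_event_measurable: "{w \<in> space M. \<exists>\<theta>\<in>C. score \<theta> (Y n w) = 0} \<in> sets M"
proof -
  have "{w \<in> space M. {\<theta> \<in> C. score \<theta> (Y n w) = 0} \<inter> UNIV \<noteq> {}} \<in> sets M"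
    using root_set_hit_measurable[of n] unfolding hit_measurable_def by blast
  then show ?thesis by (rule arg_cong[THEN iffD1, of _ _ "\<lambda>S. S \<in> sets M", rotated]) auto
qed

lemma root_probability:
  "(\<lambda>n. measure M {w \<in> space M. \<exists>\<theta>\<in>C. score \<theta> (Y n w) = 0}) \<longlonglongrightarrow> 1"
proof -
  obtain \<delta> where \<delta>: "\<delta> > 0" "\<And>y. norm (y - \<gamma> \<theta>0) < \<delta> \<Longrightarrow> \<exists>\<theta>\<in>C. score \<theta> y = 0"
    using root_exists[OF zero_less_one] by meson
  have "(\<lambda>n. 1 - measure M {w \<in> space M. \<delta> \<le> norm (Y n w - \<gamma> \<theta>0)}) \<longlonglongrightarrow> 1 - 0"
    by (intro tendsto_diff tendsto_const moments_consistent \<delta>)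
  then have l: "(\<lambda>n. 1 - measure M {w \<in> space M. \<delta> \<le> norm (Y n w - \<gamma> \<theta>0)}) \<longlonglongrightarrow> 1" by simp
  show ?thesis
  proof (rule real_tendsto_sandwich[OF _ _ l tendsto_const])
    have "1 - measure M {w \<in> space M. \<delta> \<le> norm (Y n w - \<gamma> \<theta>0)} \<le> measure M {w \<in> space M. \<exists>\<theta>\<in>C. score \<theta> (Y n w) = 0}" for n
    proof -
      have "1 - measure M {w \<in> space M. \<delta> \<le> norm (Y n w - \<gamma> \<theta>0)} = measure M (space M - {w \<in> space M. \<delta> \<le> norm (Y n w - \<gamma> \<theta>0)})"
        by (rule M.prob_compl[symmetric]) measurable
      also have "\<dots> \<le> measure M {w \<in> space M. \<exists>\<theta>\<in>C. score \<theta> (Y n w) = 0}"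
        using \<delta>(2) by (intro M.finite_measure_mono root_event_measurable) (auto simp: not_le)
      finally show ?thesis .
    qed
    then show "\<forall>\<^sub>F n in sequentially. 1 - measure M {w \<in> space M. \<delta> \<le> norm (Y n w - \<gamma> \<theta>0)} \<le> measure M {w \<in> space M. \<exists>\<theta>\<in>C. score \<theta> (Y n w) = 0}"
      by simp
  qed simp
qed

text \<open>The selected root is as close to \<open>\<theta>0\<close> as any other one, in
  particular as the root from \<open>root_exists\<close>. Therefore one sequence serves all
  \<epsilon> simultaneously.\<close>

lemma consistent_root_sequence:
  "\<exists>T. (\<forall>n. T n \<in> borel_measurable M) \<and>
     (\<forall>n. \<forall>w\<in>space M. (\<exists>\<theta>\<in>C. score \<theta> (Y n w) = 0) \<longrightarrow> T n w \<in> C \<and> score (T n w) (Y n w) = 0) \<and>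
     tendsto_in_prob M T \<theta>0"
proof -
  have "\<exists>T\<in>borel_measurable M. \<forall>w\<in>space M. {\<theta> \<in> C. score \<theta> (Y n w) = 0} \<noteq> {} \<longrightarrow>
     T w \<in> {\<theta> \<in> C. score \<theta> (Y n w) = 0} \<and> (\<forall>\<theta>\<in>{\<theta> \<in> C. score \<theta> (Y n w) = 0}. dist \<theta>0 (T w) \<le> dist \<theta>0 \<theta>)" for n
    by (intro closest_measurable_selection root_set_hit_measurable root_set_compact)
  then have "\<forall>n. \<exists>T. T \<in> borel_measurable M \<and> (\<forall>w\<in>space M. {\<theta> \<in> C. score \<theta> (Y n w) = 0} \<noteq> {} \<longrightarrow>
     T w \<in> {\<theta> \<in> C. score \<theta> (Y n w) = 0} \<and> (\<forall>\<theta>\<in>{\<theta> \<in> C. score \<theta> (Y n w) = 0}. dist \<theta>0 (T w) \<le> dist \<theta>0 \<theta>))"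
    by blast
  from choice[OF this] obtain T where T': "\<forall>n. T n \<in> borel_measurable M \<and> (\<forall>w\<in>space M. {\<theta> \<in> C. score \<theta> (Y n w) = 0} \<noteq> {} \<longrightarrow>
     T n w \<in> {\<theta> \<in> C. score \<theta> (Y n w) = 0} \<and> (\<forall>\<theta>\<in>{\<theta> \<in> C. score \<theta> (Y n w) = 0}. dist \<theta>0 (T n w) \<le> dist \<theta>0 \<theta>))"
    by blast
  then have Tm [measurable]: "T n \<in> borel_measurable M" for n by blast
  have T: "T n w \<in> C" "score (T n w) (Y n w) = 0" "dist \<theta>0 (T n w) \<le> dist \<theta>0 \<theta>"
    if "w \<in> space M" "\<theta> \<in> C" "score \<theta> (Y n w) = 0" for n w \<theta>
    using T' that by blast+
  have "tendsto_in_prob M T \<theta>0"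
    unfolding tendsto_in_prob_def
  proof (intro allI impI)
    fix \<epsilon> :: real assume "\<epsilon> > 0"
    then obtain \<delta> where \<delta>: "\<delta> > 0" "\<And>y. norm (y - \<gamma> \<theta>0) < \<delta> \<Longrightarrow> \<exists>\<theta>\<in>C. norm (\<theta> - \<theta>0) \<le> \<epsilon> \<and> score \<theta> y = 0"
      using root_exists by blast
    have bad: "\<delta> \<le> norm (Y n w - \<gamma> \<theta>0)" if "w \<in> space M" "\<epsilon> < dist (T n w) \<theta>0" for n w
    proof (rule ccontr)
      assume "\<not> \<delta> \<le> norm (Y n w - \<gamma> \<theta>0)"
      then obtain \<theta> where \<theta>: "\<theta> \<in> C" "norm (\<theta> - \<theta>0) \<le> \<epsilon>" "score \<theta> (Y n w) = 0" using \<delta>(2) not_le by blast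
      have "dist \<theta>0 (T n w) \<le> \<epsilon>"
        using T(3)[OF that(1) \<theta>(1,3)] \<theta>(2) by (simp add: dist_norm norm_minus_commute)
      then show False using that(2) by (simp add: dist_commute)
    qed
    show "(\<lambda>n. measure M {w \<in> space M. \<epsilon> < dist (T n w) \<theta>0}) \<longlonglongrightarrow> 0"
    proof (rule real_tendsto_sandwich[OF _ _ tendsto_const moments_consistent[OF \<delta>(1)]])
      show "\<forall>\<^sub>F n in sequentially. measure M {w \<in> space M. \<epsilon> < dist (T n w) \<theta>0} \<le> measure M {w \<in> space M. \<delta> \<le> norm (Y n w - \<gamma> \<theta>0)}"
        using bad by (intro always_eventually allI M.finite_measure_mono) auto
    qed simp
  qed
  then show ?thesis using T by (intro exI[of _ T]) (auto intro: Tm)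
qed

text \<open>Outside three events of small probability (large normalised deviation, \<open>T\<close>
  far from \<open>\<theta>0\<close>, \<open>T\<close> not a root) the deterministic estimate
  applies.\<close>

lemma root_sequence_linearization:
  assumes Tm [measurable]: "\<And>n. T n \<in> borel_measurable M"
    and root: "(\<lambda>n. measure M {w \<in> space M. T n w \<in> C \<and> score (T n w) (Y n w) = 0}) \<longlonglongrightarrow> 1"
    and cons: "tendsto_in_prob M T \<theta>0"
  shows "tendsto_in_prob M (\<lambda>n w. sqrt (real n) *\<^sub>R (T n w - \<theta>0) - Ji *v (A \<theta>0 *v (sqrt (real n) *\<^sub>R (Y n w - \<gamma> \<theta>0)))) 0"
  unfolding tendsto_in_prob_def prob_tendsto_zero_iff[OF measure_nonneg]
proof (intro allI impI)
  fix \<epsilon> e :: real assume "\<epsilon> > 0" "e > 0"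
  then have e3: "e / 3 > 0" by simp
  let ?Z = "\<lambda>n w. sqrt (real n) *\<^sub>R (Y n w - \<gamma> \<theta>0)"
  let ?R = "\<lambda>n w. sqrt (real n) *\<^sub>R (T n w - \<theta>0) - Ji *v (A \<theta>0 *v ?Z n w)"
  obtain K where K: "K > 0" "\<forall>\<^sub>F n in sequentially. measure M {w \<in> space M. K < norm (?Z n w)} \<le> e / 3"
    using tight[OF e3] by blast
  \<comment> \<open>The slope \<epsilon> / K is made to cancel the bound K on the normalised
    deviation.\<close>
  obtain \<delta> where \<delta>: "\<delta> > 0" "\<And>\<theta> y. \<theta> \<in> C \<Longrightarrow> norm (\<theta> - \<theta>0) < \<delta> \<Longrightarrow> score \<theta> y = 0 \<Longrightarrow>
      norm (\<theta> - \<theta>0 - Ji *v (A \<theta>0 *v (y - \<gamma> \<theta>0))) \<le> \<epsilon> / K * norm (y - \<gamma> \<theta>0)"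
    using root_linearization[of "\<epsilon> / K"] \<open>\<epsilon> > 0\<close> K(1) by (meson divide_pos_pos)
  have "(\<lambda>n. measure M {w \<in> space M. \<delta> / 2 < dist (T n w) \<theta>0}) \<longlonglongrightarrow> 0"
    using cons \<delta>(1) half_gt_zero unfolding tendsto_in_prob_def by blast
  then have c: "\<forall>\<^sub>F n in sequentially. measure M {w \<in> space M. \<delta> / 2 < dist (T n w) \<theta>0} \<le> e / 3"
    using prob_tendsto_zero_iff[where p = "\<lambda>n. measure M {w \<in> space M. \<delta> / 2 < dist (T n w) \<theta>0}"] e3
    by (simp only: measure_nonneg simp_thms)
  show "\<forall>\<^sub>F n in sequentially. measure M {w \<in> space M. \<epsilon> < dist (?R n w) 0} \<le> e"
    \<comment> \<open>For large n this supplies measurability of the third event along with its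
      small probability.\<close>
    using K(2) c M.complement_prob_small[OF root e3]
  proof eventually_elim
    case (elim n)
    let ?B1 = "{w \<in> space M. K < norm (?Z n w)}" and ?B2 = "{w \<in> space M. \<delta> / 2 < dist (T n w) \<theta>0}"
      and ?B3 = "{w \<in> space M. \<not> (T n w \<in> C \<and> score (T n w) (Y n w) = 0)}"
    have meas: "?B1 \<in> sets M" "?B2 \<in> sets M" by measurable
    have "{w \<in> space M. \<epsilon> < dist (?R n w) 0} \<subseteq> ?B1 \<union> ?B2 \<union> ?B3"
    proof (rule subsetI, rule ccontr)
      fix w assume a: "w \<in> {w \<in> space M. \<epsilon> < dist (?R n w) 0}" "w \<notin> ?B1 \<union> ?B2 \<union> ?B3"
      then have w: "w \<in> space M" "\<epsilon> < dist (?R n w) 0" "norm (?Z n w) \<le> K" "dist (T n w) \<theta>0 \<le> \<delta> / 2"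
        "T n w \<in> C" "score (T n w) (Y n w) = 0"
        unfolding mem_Collect_eq Un_iff not_less[symmetric] by blast+
      have "norm (T n w - \<theta>0) < \<delta>" using w(4) \<delta>(1) by (simp add: dist_norm)
      from \<delta>(2)[OF w(5) this w(6)]
      have b: "norm (T n w - \<theta>0 - Ji *v (A \<theta>0 *v (Y n w - \<gamma> \<theta>0))) \<le> \<epsilon> / K * norm (Y n w - \<gamma> \<theta>0)" .
      have "?R n w = sqrt (real n) *\<^sub>R (T n w - \<theta>0 - Ji *v (A \<theta>0 *v (Y n w - \<gamma> \<theta>0)))"
        by (simp only: matrix_vector_mult_scaleR scaleR_diff_right[of _ "T n w - \<theta>0"])
      then have "norm (?R n w) = sqrt (real n) * norm (T n w - \<theta>0 - Ji *v (A \<theta>0 *v (Y n w - \<gamma> \<theta>0)))" by simp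
      also have "\<dots> \<le> sqrt (real n) * (\<epsilon> / K * norm (Y n w - \<gamma> \<theta>0))" by (intro mult_left_mono b) simp
      also have "\<dots> = \<epsilon> / K * norm (?Z n w)" by simp
      also have "\<dots> \<le> \<epsilon> / K * K" using w(3) \<open>\<epsilon> > 0\<close> K(1) by (intro mult_left_mono) auto
      also have "\<dots> = \<epsilon>" using K(1) by simp
      finally show False using w(2) by simp
    qed
    then have "measure M {w \<in> space M. \<epsilon> < dist (?R n w) 0} \<le> measure M (?B1 \<union> ?B2 \<union> ?B3)"
      using meas elim(3) by (intro M.finite_measure_mono sets.Un) simp_all
    also have "\<dots> \<le> measure M (?B1 \<union> ?B2) + measure M ?B3"
      using meas elim(3) by (intro measure_Un_le sets.Un) simp_all
    also have "\<dots> \<le> measure M ?B1 + measure M ?B2 + measure M ?B3"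
      using meas by (intro add_right_mono measure_Un_le)
    also have "\<dots> \<le> e" using elim by linarith
    finally show ?case .
  qed
qed

end

end

section \<open>Moments of the trigonometric vector\<close>

lemma continuous_on_det:
  fixes A :: "'a::topological_space \<Rightarrow> real ^ 'n::finite ^ 'n"
  assumes "continuous_on S A"
  shows "continuous_on S (\<lambda>x. det (A x))"
  unfolding det_def by (intro continuous_intros assms)

text \<open>Cramer's rule applied to each column; it exhibits the entries of the inverse as
  continuous functions of the matrix.\<close>

lemma matrix_inv_nth:
  fixes A :: "real ^ 'n::finite ^ 'n"
  assumes "invertible A"
  shows "matrix_inv A $ i $ j = det (\<chi> r s. if s = i then axis j 1 $ r else A $ r $ s) / det A"
proof -
  have "A *v (matrix_inv A *v axis j 1) = axis j 1"
    by (simp add: matrix_vector_mul_assoc matrix_inv_mult[OF assms])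
  then have "matrix_inv A *v axis j 1 = (\<chi> k. det (\<chi> r s. if s = k then axis j 1 $ r else A $ r $ s) / det A)"
    using cramer[of A "matrix_inv A *v axis j 1" "axis j 1"] assms by (simp add: invertible_det_nz)
  moreover have "(matrix_inv A *v axis j 1) $ i = matrix_inv A $ i $ j"
    by (simp add: matrix_vector_mult_basis column_def)
  ultimately show ?thesis by simp
qed

lemma continuous_on_matrix_inv:
  fixes A :: "'a::topological_space \<Rightarrow> real ^ 'n::finite ^ 'n"
  assumes A: "continuous_on S A" and inv: "\<And>x. x \<in> S \<Longrightarrow> invertible (A x)"
  shows "continuous_on S (\<lambda>x. matrix_inv (A x))"
proof -
  have "continuous_on S (\<lambda>x. (if s = i then axis j 1 $ r else A x $ r $ s))" for i j r s
    using A by (cases "s = i") (auto intro!: continuous_intros)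
  then have "continuous_on S (\<lambda>x. det (\<chi> r s. if s = i then axis j 1 $ r else A x $ r $ s) / det (A x))" for i j
    using inv by (intro continuous_on_divide continuous_on_det continuous_on_vec_lambda A) (auto simp: invertible_det_nz)
  then have "continuous_on S (\<lambda>x. \<chi> i j. det (\<chi> r s. if s = i then axis j 1 $ r else A x $ r $ s) / det (A x))"
    by (intro continuous_on_vec_lambda)
  then show ?thesis
    by (rule continuous_on_eq) (simp add: vec_eq_iff matrix_inv_nth inv)
qed

lemma continuous_on_matrix_mult:
  fixes A :: "'a::topological_space \<Rightarrow> real ^ 'n::finite ^ 'm::finite" and B :: "'a \<Rightarrow> real ^ 'p::finite ^ 'n"
  assumes "continuous_on S A" "continuous_on S B"
  shows "continuous_on S (\<lambda>x. A x ** B x)"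
  unfolding matrix_matrix_mult_def by (intro continuous_on_vec_lambda continuous_intros assms)

text \<open>Translating the relation by s and subtracting it, multiplied by cis (v w s), removes the
  exponential with index \<open>w\<close> and leaves a shorter relation.\<close>

lemma exponentials_independent:
  fixes v :: "'i \<Rightarrow> real" and a :: "'i \<Rightarrow> complex"
  assumes "finite I" "inj_on v I" "\<And>x. (\<Sum>i\<in>I. a i * cis (v i * x)) = 0" "i \<in> I"
  shows "a i = 0"
  using assms
proof (induction I arbitrary: a i rule: finite_induct)
  case (insert w I)
  have a0: "a i = 0" if i: "i \<in> I" for i
  proof -
    \<comment> \<open>The phases of \<open>i\<close> and \<open>w\<close> then differ by pi, so the
      new coefficient of \<open>i\<close> is a nonzero multiple of \<open>a i\<close>.\<close>
    define s where "s = pi / (v i - v w)"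
    have ne: "v i \<noteq> v w" using insert.prems(1) insert.hyps i by (auto simp: inj_on_def)
    have "a i * (cis (v i * s) - cis (v w * s)) = 0"
    proof (rule insert.IH[OF _ _ i])
      show "inj_on v I" using insert.prems(1) by simp
      fix x
      have "(\<Sum>i\<in>I. a i * (cis (v i * s) - cis (v w * s)) * cis (v i * x))
         = (\<Sum>i\<in>I. a i * cis (v i * (x + s))) - cis (v w * s) * (\<Sum>i\<in>I. a i * cis (v i * x))"
        by (simp add: sum_distrib_left sum_subtractf[symmetric] algebra_simps cis_mult[symmetric])
      also have "(\<Sum>i\<in>I. a i * cis (v i * (x + s))) = - a w * cis (v w * (x + s))"
        using insert.prems(2)[of "x + s"] insert.hyps by (simp add: add_eq_0_iff)
      also have "(\<Sum>i\<in>I. a i * cis (v i * x)) = - a w * cis (v w * x)"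
        using insert.prems(2)[of x] insert.hyps by (simp add: add_eq_0_iff)
      finally show "(\<Sum>i\<in>I. a i * (cis (v i * s) - cis (v w * s)) * cis (v i * x)) = 0"
        by (simp add: algebra_simps cis_mult[symmetric])
    qed
    moreover have "cis (v i * s) \<noteq> cis (v w * s)"
    proof
      assume "cis (v i * s) = cis (v w * s)"
      then have "cis (v i * s - v w * s) = 1" by (simp add: cis_divide[symmetric])
      moreover have "v i * s - v w * s = pi" unfolding left_diff_distrib[symmetric] s_def using ne by simp
      ultimately show False by simp
    qed
    ultimately show ?thesis by simp
  qed
  have "a w = 0" using insert.prems(2)[of 0] insert.hyps a0 by simp
  then show ?case using insert.prems(3) a0 by auto
qed simp

text \<open>Through exponentials the identity becomes a relation among the 2k + 1 frequencies 0, u_j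
  and -u_j, which are distinct by the two hypotheses on \<open>u\<close>. The index
  \<open>None\<close> carries the constant.\<close>

lemma trig_poly_constant_imp_zero:
  fixes u :: "real ^ 'k::finite" and c :: "real ^ ('k + 'k)"
  assumes dist: "\<And>i j. i \<noteq> j \<Longrightarrow> \<bar>u $ i\<bar> \<noteq> \<bar>u $ j\<bar>" and nz: "\<And>i. u $ i \<noteq> 0"
    and const: "\<And>x. c \<bullet> trig_vec u x = d"
  shows "c = 0"
proof -
  define v where "v i = (case i of None \<Rightarrow> 0 | Some (Inl j) \<Rightarrow> u $ j | Some (Inr j) \<Rightarrow> - (u $ j))" for i :: "('k + 'k) option"
  define a where "a i = (case i of None \<Rightarrow> - complex_of_real d
     | Some (Inl j) \<Rightarrow> (of_real (c $ Inl j) - \<i> * of_real (c $ Inr j)) / 2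
     | Some (Inr j) \<Rightarrow> (of_real (c $ Inl j) + \<i> * of_real (c $ Inr j)) / 2)" for i :: "('k + 'k) option"
  have sum_split: "(\<Sum>i\<in>UNIV. f i) = (\<Sum>j\<in>UNIV. f (Inl j)) + (\<Sum>j\<in>UNIV. f (Inr j))" for f :: "'k + 'k \<Rightarrow> 'b::comm_monoid_add"
    by (simp add: UNIV_Plus_UNIV[symmetric] sum.Plus del: UNIV_Plus_UNIV)
  have "inj v"
  proof (rule injI)
    fix i i' assume "v i = v i'"
    then show "i = i'"
      using dist nz by (auto simp: v_def split: option.splits sum.splits) (metis abs_minus_cancel equation_minus_iff neg_equal_zero)+
  qed
  moreover have "(\<Sum>i\<in>UNIV. a i * cis (v i * x)) = 0" for x
  proof -
    have "(\<Sum>i\<in>UNIV. a i * cis (v i * x)) = - of_real d + (\<Sum>i\<in>UNIV. a (Some i) * cis (v (Some i) * x))"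
      by (simp add: UNIV_option_conv sum.reindex a_def v_def)
    also have "(\<Sum>i\<in>UNIV. a (Some i) * cis (v (Some i) * x)) =
       (\<Sum>j\<in>UNIV. a (Some (Inl j)) * cis (v (Some (Inl j)) * x) + a (Some (Inr j)) * cis (v (Some (Inr j)) * x))"
      by (simp add: sum_split sum.distrib)
    also have "\<dots> = (\<Sum>j\<in>UNIV. of_real (c $ Inl j * cos (u $ j * x) + c $ Inr j * sin (u $ j * x)))"
      by (intro sum.cong refl) (simp add: a_def v_def complex_eq_iff field_simps)
    also have "\<dots> = of_real (c \<bullet> trig_vec u x)"
      by (simp add: inner_vec_def sum_split trig_vec_def sum.distrib)
    finally show ?thesis using const by simp
  qed
  ultimately have a0: "a i = 0" for i
    using exponentials_independent[of UNIV v a i] by auto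
  have "c $ Inl j = 0 \<and> c $ Inr j = 0" for j
    using a0[of "Some (Inl j)"] by (auto simp: a_def complex_eq_iff)
  then have "c $ i = 0" for i by (cases i) auto
  then show ?thesis by (simp add: vec_eq_iff)
qed

text \<open>The linear form extends to a nonconstant entire function, which takes each value at most
  countably often. Countable level sets are null for every law with a density, wherever that density
  may vanish.\<close>

lemma trig_vec_level_countable:
  fixes u :: "real ^ 'k::finite" and c :: "real ^ ('k + 'k)"
  assumes dist: "\<And>i j. i \<noteq> j \<Longrightarrow> \<bar>u $ i\<bar> \<noteq> \<bar>u $ j\<bar>" and nz: "\<And>i. u $ i \<noteq> 0" and c: "c \<noteq> 0"
  shows "countable {x. c \<bullet> trig_vec u x = d}"
proof -
  have sum_split: "(\<Sum>i\<in>UNIV. f i) = (\<Sum>j\<in>UNIV. f (Inl j)) + (\<Sum>j\<in>UNIV. f (Inr j))" for f :: "'k + 'k \<Rightarrow> 'b::comm_monoid_add"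
    by (simp add: UNIV_Plus_UNIV[symmetric] sum.Plus del: UNIV_Plus_UNIV)
  define F where "F z = (\<Sum>j\<in>UNIV. of_real (c $ Inl j) * cos (of_real (u $ j) * z) + of_real (c $ Inr j) * sin (of_real (u $ j) * z))" for z :: complex
  have F: "F (of_real x) = of_real (c \<bullet> trig_vec u x)" for x
    by (simp add: F_def inner_vec_def sum_split trig_vec_def sum.distrib cos_of_real[symmetric] sin_of_real[symmetric])
  have hol: "F holomorphic_on UNIV" unfolding F_def by (intro holomorphic_intros)
  have "countable {z. F z = of_real d}"
  proof (rule ccontr)
    assume "\<not> countable {z. F z = of_real d}"
    then have "F = (\<lambda>_. of_real d)"
      by (intro holomorphic_countable_equal_UNIV hol holomorphic_on_const)
    then have "c \<bullet> trig_vec u x = d" for x using F[of x] by (simp only: of_real_eq_iff)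
    then show False using trig_poly_constant_imp_zero[OF dist nz] c by blast
  qed
  then have "countable (of_real ` {x. c \<bullet> trig_vec u x = d} :: complex set)"
    by (rule countable_subset[rotated]) (auto simp: F)
  then show ?thesis by (simp add: countable_image_inj_eq inj_on_def)
qed

lemma continuous_on_trig_vec: "continuous_on UNIV (trig_vec u)"
proof -
  have "continuous_on UNIV (\<lambda>x. case i of Inl j \<Rightarrow> cos (u $ j * x) | Inr j \<Rightarrow> sin (u $ j * x))" for i
    by (cases i) (auto intro!: continuous_intros)
  then show ?thesis unfolding trig_vec_def[abs_def] by (rule continuous_on_vec_lambda)
qed

lemma borel_measurable_trig_vec [measurable]: "trig_vec u \<in> borel_measurable borel"
  by (intro borel_measurable_continuous_onI continuous_on_trig_vec)

lemma borel_measurable_trig_vec_nth [measurable]: "(\<lambda>x. trig_vec u x $ i) \<in> borel_measurable borel"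
  by (intro borel_measurable_continuous_onI continuous_on_component continuous_on_trig_vec)

lemma trig_vec_le_one: "\<bar>trig_vec u x $ i\<bar> \<le> 1"
  by (cases i) (auto simp: trig_vec_def)

lemma norm_trig_vec_le:
  fixes u :: "real ^ 'k::finite"
  shows "norm (trig_vec u x) \<le> real CARD('k + 'k)"
proof -
  have "norm (trig_vec u x) \<le> (\<Sum>i\<in>UNIV. \<bar>trig_vec u x $ i\<bar>)" by (rule norm_le_l1_cart)
  also have "\<dots> \<le> (\<Sum>i\<in>(UNIV :: ('k + 'k) set). 1)" by (intro sum_mono trig_vec_le_one)
  finally show ?thesis by simp
qed

section \<open>Stable law: moments and covariance of the trigonometric vector\<close>

context
  fixes \<theta> :: "real ^ 4"
  assumes \<theta>: "\<theta> \<in> stable_param_interior"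
begin

definition "stable_law = density lborel (\<lambda>x. ennreal (stable_density \<theta> x))"

lemma real_distribution_stable_law: "real_distribution stable_law"
  unfolding stable_law_def by (rule stable_density(3)[OF \<theta>])

interpretation S: real_distribution stable_law by (rule real_distribution_stable_law)

lemma stable_expectation_law: "stable_expectation \<theta> h = (\<integral>x. h x \<partial>stable_law)"
  unfolding stable_expectation_def stable_law_def ..

lemma stable_law_integrable_bounded:
  fixes h :: "real \<Rightarrow> 'b::{banach,second_countable_topology}"
  assumes "h \<in> borel_measurable borel" "\<And>x. norm (h x) \<le> B"
  shows "integrable stable_law h"
  using assms by (intro S.integrable_const_bound[of _ B]) auto

lemma stable_expectation_cos: "stable_expectation \<theta> (\<lambda>x. cos (a * x)) = Re (stable_cf \<theta> a)"
  and stable_expectation_sin: "stable_expectation \<theta> (\<lambda>x. sin (a * x)) = Im (stable_cf \<theta> a)"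
proof -
  have cf: "stable_cf \<theta> a = (\<integral>x. cis (a * x) \<partial>stable_law)"
    using stable_density(4)[OF \<theta>] unfolding stable_law_def by (simp add: char_def cis_conv_exp fun_eq_iff)
  have i: "integrable stable_law (\<lambda>x. cis (a * x))"
    by (intro stable_law_integrable_bounded[of _ 1]) auto
  show "stable_expectation \<theta> (\<lambda>x. cos (a * x)) = Re (stable_cf \<theta> a)"
    "stable_expectation \<theta> (\<lambda>x. sin (a * x)) = Im (stable_cf \<theta> a)"
    unfolding stable_expectation_law cf using integral_Re[OF i] integral_Im[OF i] by simp_all
qed

lemma trig_mean_eq: "trig_mean u \<theta> = trig_cf u \<theta>"
proof -
  have i: "integrable stable_law (trig_vec u)"
    by (intro stable_law_integrable_bounded[OF _ norm_trig_vec_le]) auto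
  have "trig_mean u \<theta> $ j = stable_expectation \<theta> (\<lambda>x. trig_vec u x $ j)" for j
    unfolding trig_mean_def stable_expectation_law
    by (rule integral_bounded_linear[OF bounded_linear_vec_nth i, symmetric])
  moreover have "stable_expectation \<theta> (\<lambda>x. trig_vec u x $ j) = trig_cf u \<theta> $ j" for j
    by (cases j) (simp_all add: trig_vec_def trig_cf_def stable_expectation_cos stable_expectation_sin)
  ultimately show ?thesis by (simp add: vec_eq_iff)
qed

lemma trig_cov_entry:
  "trig_cov u \<theta> $ i $ j = stable_expectation \<theta> (\<lambda>x. trig_vec u x $ i * trig_vec u x $ j) - trig_mean u \<theta> $ i * trig_mean u \<theta> $ j"
proof -
  have m: "trig_mean u \<theta> $ j = stable_expectation \<theta> (\<lambda>x. trig_vec u x $ j)" for j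
    unfolding trig_mean_def stable_expectation_law
    by (intro integral_bounded_linear[OF bounded_linear_vec_nth, symmetric]
          stable_law_integrable_bounded[OF _ norm_trig_vec_le]) auto
  have i1: "integrable stable_law (\<lambda>x. trig_vec u x $ i)" for i
    by (intro stable_law_integrable_bounded[of _ 1]) (auto simp: trig_vec_le_one)
  have i2: "integrable stable_law (\<lambda>x. trig_vec u x $ i * trig_vec u x $ j)"
    by (intro stable_law_integrable_bounded[of _ 1]) (auto simp: abs_mult intro!: mult_le_one trig_vec_le_one)
  have "trig_cov u \<theta> $ i $ j = (\<integral>x. trig_vec u x $ i * trig_vec u x $ j - trig_mean u \<theta> $ j * trig_vec u x $ i
      - trig_mean u \<theta> $ i * trig_vec u x $ j + trig_mean u \<theta> $ i * trig_mean u \<theta> $ j \<partial>stable_law)"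
    by (simp add: trig_cov_def stable_expectation_law algebra_simps)
  also have "\<dots> = stable_expectation \<theta> (\<lambda>x. trig_vec u x $ i * trig_vec u x $ j) - trig_mean u \<theta> $ i * trig_mean u \<theta> $ j"
    using i1[of i] i1[of j] i2 S.prob_space by (simp add: stable_expectation_law m)
  finally show ?thesis .
qed

lemma stable_expectation_score_square:
  "stable_expectation \<theta> (\<lambda>x. (c \<bullet> (trig_vec u x - trig_mean u \<theta>))\<^sup>2) = c \<bullet> (trig_cov u \<theta> *v c)"
proof -
  let ?g = "\<lambda>x. trig_vec u x - trig_mean u \<theta>"
  have b: "\<bar>?g x $ i\<bar> \<le> 1 + norm (trig_mean u \<theta>)" for x i
    using trig_vec_le_one[of u x i] component_le_norm_cart[of "trig_mean u \<theta>" i]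
    by (simp add: abs_le_iff)
  have int: "integrable stable_law (\<lambda>x. ?g x $ i * ?g x $ j)" for i j
  proof (rule stable_law_integrable_bounded)
    show "(\<lambda>x. ?g x $ i * ?g x $ j) \<in> borel_measurable borel"
      unfolding vector_minus_component by measurable
    show "norm (?g x $ i * ?g x $ j) \<le> (1 + norm (trig_mean u \<theta>)) * (1 + norm (trig_mean u \<theta>))" for x
      unfolding real_norm_def abs_mult by (intro mult_mono b) (auto intro: add_nonneg_nonneg)
  qed
  have eq: "(c \<bullet> ?g x)\<^sup>2 = (\<Sum>i\<in>UNIV. \<Sum>j\<in>UNIV. (c $ i * c $ j) * (?g x $ i * ?g x $ j))" for x
    unfolding power2_eq_square inner_vec_def sum_product by (simp add: mult_ac)
  have "stable_expectation \<theta> (\<lambda>x. (c \<bullet> ?g x)\<^sup>2) = (\<Sum>i\<in>UNIV. \<Sum>j\<in>UNIV. (c $ i * c $ j) * (\<integral>x. ?g x $ i * ?g x $ j \<partial>stable_law))"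
    unfolding eq stable_expectation_law using int by (simp add: Bochner_Integration.integral_sum integral_mult_right_zero)
  also have "\<dots> = (\<Sum>i\<in>UNIV. \<Sum>j\<in>UNIV. (c $ i * c $ j) * trig_cov u \<theta> $ i $ j)"
    by (simp add: trig_cov_def stable_expectation_law)
  also have "\<dots> = c \<bullet> (trig_cov u \<theta> *v c)"
    by (simp add: inner_vec_def matrix_vector_mult_def sum_distrib_left mult_ac)
  finally show ?thesis .
qed

text \<open>A degenerate direction \<open>c\<close> would concentrate the stable law on one level
  set of the linear form, a countable set; absolute continuity excludes this.\<close>

lemma pos_def_trig_cov:
  assumes dist: "\<And>i j. i \<noteq> j \<Longrightarrow> \<bar>u $ i\<bar> \<noteq> \<bar>u $ j\<bar>" and nz: "\<And>i. u $ i \<noteq> 0"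
  shows "pos_def_matrix (trig_cov u \<theta>)"
  unfolding pos_def_matrix_def
proof (intro conjI allI impI)
  show "transpose (trig_cov u \<theta>) = trig_cov u \<theta>"
    by (simp add: transpose_def trig_cov_def vec_eq_iff mult.commute)
  fix c :: "real ^ ('a + 'a)" assume c: "c \<noteq> 0"
  let ?h = "\<lambda>x. (c \<bullet> (trig_vec u x - trig_mean u \<theta>))\<^sup>2"
  have "\<bar>c \<bullet> (trig_vec u x - trig_mean u \<theta>)\<bar> \<le> norm c * (real CARD('a + 'a) + norm (trig_mean u \<theta>))" for x
    by (intro order.trans[OF Cauchy_Schwarz_ineq2] mult_left_mono order.trans[OF norm_triangle_ineq4] add_mono norm_trig_vec_le) auto
  then have "norm (?h x) \<le> (norm c * (real CARD('a + 'a) + norm (trig_mean u \<theta>)))\<^sup>2" for x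
    using power_mono[OF _ abs_ge_zero, of "c \<bullet> (trig_vec u x - trig_mean u \<theta>)" _ 2] by simp
  then have int: "integrable stable_law ?h"
    by (intro stable_law_integrable_bounded) auto
  have nn: "0 \<le> stable_expectation \<theta> ?h" by (simp add: stable_expectation_law)
  have "stable_expectation \<theta> ?h \<noteq> 0"
  proof
    assume "stable_expectation \<theta> ?h = 0"
    then have "AE x in stable_law. ?h x = 0"
      using integral_nonneg_eq_0_iff_AE[OF int] by (simp add: stable_expectation_law)
    then have ae: "AE x in stable_law. x \<in> {x. c \<bullet> trig_vec u x = c \<bullet> trig_mean u \<theta>}"
      by (auto simp: inner_diff_right elim!: eventually_mono)
    have "countable {x. c \<bullet> trig_vec u x = c \<bullet> trig_mean u \<theta>}"
      by (rule trig_vec_level_countable[OF dist nz c])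
    then have "AE x in lborel. x \<notin> {x. c \<bullet> trig_vec u x = c \<bullet> trig_mean u \<theta>}"
      by (intro AE_not_in) (simp add: countable_imp_null_set_lborel)
    then have "AE x in stable_law. x \<notin> {x. c \<bullet> trig_vec u x = c \<bullet> trig_mean u \<theta>}"
      unfolding stable_law_def using stable_density(1)[OF \<theta>] by (subst AE_density) auto
    with ae have "AE x in stable_law. False" by eventually_elim simp
    then show False using S.AE_False by simp
  qed
  then show "c \<bullet> (trig_cov u \<theta> *v c) > 0" using nn stable_expectation_score_square[of c u] by simp
qed

end

text \<open>Product-to-sum formulas express the expectation through \<open>stable_cf\<close> at the
  sum and the difference of two frequencies, so continuity in \<theta> is inherited from the
  characteristic function.\<close>

lemma continuous_on_trig_moment:
  "continuous_on stable_param_interior (\<lambda>\<theta>. stable_expectation \<theta> (\<lambda>x. trig_vec u x $ i * trig_vec u x $ j))"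
proof -
  let ?P = stable_param_interior
  have int: "integrable (stable_law \<theta>) (\<lambda>x. cos (a * x))" "integrable (stable_law \<theta>) (\<lambda>x. sin (a * x))" if "\<theta> \<in> ?P" for \<theta> a
    by (intro stable_law_integrable_bounded[OF that, of _ 1]; simp)+
  note E = stable_expectation_law stable_expectation_cos[symmetric] stable_expectation_sin[symmetric]
  have cc: "stable_expectation \<theta> (\<lambda>x. cos (a * x) * cos (b * x)) = (Re (stable_cf \<theta> (a - b)) + Re (stable_cf \<theta> (a + b))) / 2"
    if "\<theta> \<in> ?P" for \<theta> a b
  proof -
    have "cos (a * x) * cos (b * x) = (cos ((a - b) * x) + cos ((a + b) * x)) / 2" for x
      by (simp add: cos_times_cos algebra_simps)
    then show ?thesis unfolding E[OF that] by (simp only:) (use int[OF that] in simp)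
  qed
  have ss: "stable_expectation \<theta> (\<lambda>x. sin (a * x) * sin (b * x)) = (Re (stable_cf \<theta> (a - b)) - Re (stable_cf \<theta> (a + b))) / 2"
    if "\<theta> \<in> ?P" for \<theta> a b
  proof -
    have "sin (a * x) * sin (b * x) = (cos ((a - b) * x) - cos ((a + b) * x)) / 2" for x
      by (simp add: sin_times_sin algebra_simps)
    then show ?thesis unfolding E[OF that] by (simp only:) (use int[OF that] in simp)
  qed
  have sc: "stable_expectation \<theta> (\<lambda>x. sin (a * x) * cos (b * x)) = (Im (stable_cf \<theta> (a + b)) + Im (stable_cf \<theta> (a - b))) / 2"
    if "\<theta> \<in> ?P" for \<theta> a b
  proof -
    have "sin (a * x) * cos (b * x) = (sin ((a + b) * x) + sin ((a - b) * x)) / 2" for x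
      using sin_times_cos[of "a * x" "b * x"] by (simp add: algebra_simps)
    then show ?thesis unfolding E[OF that] by (simp only:) (use int[OF that] in simp)
  qed
  have cs: "stable_expectation \<theta> (\<lambda>x. cos (a * x) * sin (b * x)) = (Im (stable_cf \<theta> (b + a)) + Im (stable_cf \<theta> (b - a))) / 2"
    if "\<theta> \<in> ?P" for \<theta> a b
    using sc[OF that, of b a] by (simp add: mult.commute)
  have c: "continuous_on ?P (\<lambda>\<theta>. (Re (stable_cf \<theta> a) + Re (stable_cf \<theta> b)) / 2)"
    "continuous_on ?P (\<lambda>\<theta>. (Re (stable_cf \<theta> a) - Re (stable_cf \<theta> b)) / 2)"
    "continuous_on ?P (\<lambda>\<theta>. (Im (stable_cf \<theta> a) + Im (stable_cf \<theta> b)) / 2)" for a b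
    by (intro continuous_intros; simp)+
  show ?thesis
  proof (cases i; cases j)
    fix a b assume "i = Inl a" "j = Inl b"
    then show ?thesis using continuous_on_eq[OF c(1) cc[symmetric], of "u $ a" "u $ b"] by (simp add: trig_vec_def)
  next
    fix a b assume "i = Inl a" "j = Inr b"
    then show ?thesis using continuous_on_eq[OF c(3) cs[symmetric], of "u $ a" "u $ b"] by (simp add: trig_vec_def)
  next
    fix a b assume "i = Inr a" "j = Inl b"
    then show ?thesis using continuous_on_eq[OF c(3) sc[symmetric], of "u $ a" "u $ b"] by (simp add: trig_vec_def)
  next
    fix a b assume "i = Inr a" "j = Inr b"
    then show ?thesis using continuous_on_eq[OF c(2) ss[symmetric], of "u $ a" "u $ b"] by (simp add: trig_vec_def)
  qed
qed

lemma has_derivative_trig_mean: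
  fixes u :: "real ^ 'k::finite"
  assumes "\<theta> \<in> stable_param_interior" "\<And>j. u $ j \<noteq> 0"
  shows "(trig_mean u has_derivative (\<lambda>h. transpose (trig_mean_deriv u \<theta>) *v h)) (at \<theta>)"
  using has_derivative_transform_within_open[OF has_derivative_trig_cf[OF assms] open_stable_param_interior assms(1)]
  by (simp add: trig_mean_eq)

lemma continuous_on_trig_mean:
  fixes u :: "real ^ 'k::finite"
  assumes "\<And>j. u $ j \<noteq> 0"
  shows "continuous_on stable_param_interior (trig_mean u)"
  using has_derivative_trig_mean[OF _ assms] has_derivative_continuous
  by (intro continuous_at_imp_continuous_on) blast

lemma continuous_on_trig_cov:
  fixes u :: "real ^ 'k::finite"
  assumes "\<And>j. u $ j \<noteq> 0"
  shows "continuous_on stable_param_interior (trig_cov u)"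
proof -
  have "continuous_on stable_param_interior (\<lambda>\<theta>. \<chi> i j. stable_expectation \<theta> (\<lambda>x. trig_vec u x $ i * trig_vec u x $ j)
      - trig_mean u \<theta> $ i * trig_mean u \<theta> $ j)"
    by (intro continuous_on_vec_lambda continuous_intros continuous_on_trig_moment continuous_on_trig_mean assms)
  then show ?thesis
    by (rule continuous_on_eq) (simp add: vec_eq_iff trig_cov_entry)
qed

section \<open>Score matrix and information matrix\<close>

definition score_matrix :: "real ^ 'k \<Rightarrow> real ^ 4 \<Rightarrow> real ^ ('k::finite + 'k) ^ 4" where
  "score_matrix u \<theta> = trig_mean_deriv u \<theta> ** matrix_inv (trig_cov u \<theta>)"

lemma continuous_on_score_matrix:
  fixes u :: "real ^ 'k::finite"
  assumes "\<And>i j. i \<noteq> j \<Longrightarrow> \<bar>u $ i\<bar> \<noteq> \<bar>u $ j\<bar>" "\<And>i. u $ i \<noteq> 0"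
  shows "continuous_on stable_param_interior (score_matrix u)"
  unfolding score_matrix_def[abs_def]
  by (intro continuous_on_matrix_mult continuous_on_trig_mean_deriv continuous_on_matrix_inv continuous_on_trig_cov
       pos_def_invertible pos_def_trig_cov assms)

lemma trig_info_eq: "trig_info u \<theta> = score_matrix u \<theta> ** transpose (trig_mean_deriv u \<theta>)"
  by (simp add: trig_info_def score_matrix_def)

text \<open>This is the covariance of the score: with A = G S^(-1), where G is the Jacobian and S
  the covariance of the moments, the product A S A^T collapses to G S^(-1) G^T.\<close>

lemma score_matrix_cov:
  fixes u :: "real ^ 'k::finite"
  assumes "pos_def_matrix (trig_cov u \<theta>)"
  shows "score_matrix u \<theta> ** (trig_cov u \<theta> ** transpose (score_matrix u \<theta>)) = trig_info u \<theta>"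
proof -
  let ?S = "trig_cov u \<theta>" and ?G = "trig_mean_deriv u \<theta>"
  have i: "invertible ?S" using pos_def_invertible[OF assms] .
  have "transpose (matrix_inv ?S) = matrix_inv ?S" using pos_def_matrix_inv[OF assms] by (simp add: pos_def_matrix_def)
  then have t: "transpose (score_matrix u \<theta>) = matrix_inv ?S ** transpose ?G"
    by (simp add: score_matrix_def matrix_transpose_mul)
  have "?S ** transpose (score_matrix u \<theta>) = transpose ?G"
    unfolding t by (simp add: matrix_mul_assoc matrix_inv_mult[OF i])
  then show ?thesis by (simp add: trig_info_eq)
qed

text \<open>The quadratic form at \<open>h\<close> is that of the inverse covariance at the
  transposed Jacobian applied to \<open>h\<close>. The hypothesis \<open>k\<close> provides two
  frequencies, which make the latter map injective.\<close>

lemma pos_def_trig_info: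
  fixes u :: "real ^ 'k::finite"
  assumes \<theta>: "\<theta> \<in> stable_param_interior" and k: "CARD('k) \<ge> 2"
    and dist: "\<And>i j. i \<noteq> j \<Longrightarrow> \<bar>u $ i\<bar> \<noteq> \<bar>u $ j\<bar>" and nz: "\<And>i. u $ i \<noteq> 0"
  shows "pos_def_matrix (trig_info u \<theta>)"
proof -
  let ?S = "trig_cov u \<theta>" and ?G = "trig_mean_deriv u \<theta>"
  have S: "pos_def_matrix (matrix_inv ?S)" by (intro pos_def_matrix_inv pos_def_trig_cov \<theta> dist nz)
  have "\<not> (\<forall>i j :: 'k. i = j)"
  proof
    assume eq: "\<forall>i j :: 'k. i = j"
    have "card (UNIV :: 'k set) \<le> 1" using eq by (subst card_le_Suc0_iff_eq[simplified One_nat_def[symmetric]]) auto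
    then show False using k by simp
  qed
  then obtain i j :: 'k where ij: "i \<noteq> j" by blast
  have q: "h \<bullet> (trig_info u \<theta> *v h) = (transpose ?G *v h) \<bullet> (matrix_inv ?S *v (transpose ?G *v h))" for h
    by (simp only: trig_info_def matrix_vector_mul_assoc[symmetric] inner_matrix_vector_transpose[of h ?G])
  show ?thesis
    unfolding pos_def_matrix_def
  proof (intro conjI allI impI)
    show "transpose (trig_info u \<theta>) = trig_info u \<theta>"
      using S by (simp add: trig_info_def pos_def_matrix_def matrix_transpose_mul matrix_mul_assoc)
    fix h :: "real ^ 4" assume "h \<noteq> 0"
    then have "transpose ?G *v h \<noteq> 0" using trig_mean_deriv_rank[OF \<theta> nz ij dist[OF ij]] by blast
    then show "h \<bullet> (trig_info u \<theta> *v h) > 0" unfolding q using S by (simp add: pos_def_matrix_def)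
  qed
qed

lemma z_estimator_trig:
  fixes u :: "real ^ 'k::finite"
  assumes C: "C \<subseteq> stable_param_interior" and \<theta>0: "\<theta>0 \<in> interior C" and k: "CARD('k) \<ge> 2"
    and dist: "\<And>i j. i \<noteq> j \<Longrightarrow> \<bar>u $ i\<bar> \<noteq> \<bar>u $ j\<bar>" and nz: "\<And>i. u $ i \<noteq> 0"
  shows "z_estimator (score_matrix u) (trig_mean u) C \<theta>0 (transpose (trig_mean_deriv u \<theta>0))"
proof
  have i: "\<theta>0 \<in> stable_param_interior" using C \<theta>0 interior_subset by blast
  show "continuous_on C (score_matrix u)"
    by (rule continuous_on_subset[OF continuous_on_score_matrix[OF dist nz] C])
  show "continuous_on C (trig_mean u)"
    by (rule continuous_on_subset[OF continuous_on_trig_mean[OF nz] C])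
  show "(trig_mean u has_derivative (*v) (transpose (trig_mean_deriv u \<theta>0))) (at \<theta>0)"
    using has_derivative_trig_mean[OF i nz] .
  show "invertible (score_matrix u \<theta>0 ** transpose (trig_mean_deriv u \<theta>0))"
    unfolding trig_info_eq[symmetric] by (intro pos_def_invertible pos_def_trig_info i k dist nz)
qed (rule \<theta>0)

section \<open>The score equation for a stable sample\<close>

text \<open>The central limit theorem normalises by s sqrt n; evaluating its characteristic
  functions at t * s undoes the division by s.\<close>

lemma iid_char_convergence:
  fixes X :: "nat \<Rightarrow> 'w \<Rightarrow> real" and f :: "real \<Rightarrow> real"
  assumes M: "prob_space M" and indep: "prob_space.indep_vars M (\<lambda>_. borel) X UNIV"
    and distr: "\<And>j. distr M borel (X j) = \<mu>"
    and f [measurable]: "f \<in> borel_measurable borel" and bound: "\<And>x. \<bar>f x\<bar> \<le> B"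
    and mean: "(\<integral>x. f x \<partial>\<mu>) = 0" and var: "(\<integral>x. (f x)\<^sup>2 \<partial>\<mu>) = s\<^sup>2" and s: "s > 0"
  shows "(\<lambda>n. \<integral>w. cis (t * ((1 / sqrt (real n)) * (\<Sum>j<n. f (X j w)))) \<partial>M) \<longlonglongrightarrow> of_real (exp (- (t * s)\<^sup>2 / 2))"
proof -
  interpret prob_space M by (rule M)
  have X [measurable]: "X j \<in> borel_measurable M" for j using indep by (auto simp: indep_vars_def)
  have E: "expectation (\<lambda>w. g (X j w)) = (\<integral>x. g x \<partial>\<mu>)" if [measurable]: "g \<in> borel_measurable borel" for g :: "real \<Rightarrow> real" and j
    by (simp add: integral_distr flip: distr[of j])
  have B0: "0 \<le> B" using bound[of 0] by linarith
  have "weak_conv_m (\<lambda>n. distr M borel (\<lambda>w. (\<Sum>j<n. f (X j w)) / sqrt (real n * s\<^sup>2))) std_normal_distribution"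
  proof (rule central_limit_theorem_zero_mean[where \<mu> = "distr \<mu> borel f"])
    show "indep_vars (\<lambda>_. borel) (\<lambda>j w. f (X j w)) UNIV"
      by (rule indep_vars_compose2[OF indep]) simp
    show "expectation (\<lambda>w. f (X j w)) = 0" for j using E[OF f] mean by simp
    then show "variance (\<lambda>w. f (X j w)) = s\<^sup>2" for j using E[of "\<lambda>x. (f x)\<^sup>2" j] var by simp
    show "integrable M (\<lambda>w. (f (X j w))\<^sup>2)" for j
      using power_mono[OF bound abs_ge_zero, of _ 2] by (intro integrable_const_bound[of _ "B\<^sup>2"]) auto
    show "distr M borel (\<lambda>w. f (X j w)) = distr \<mu> borel f" for j
      unfolding distr[of j, symmetric] by (subst distr_distr) (auto simp: comp_def)
  qed (rule s)
  from levy_continuity1[OF _ real_dist_normal_dist this, of "t * s"]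
  have "(\<lambda>n. char (distr M borel (\<lambda>w. (\<Sum>j<n. f (X j w)) / sqrt (real n * s\<^sup>2))) (t * s)) \<longlonglongrightarrow> of_real (exp (- (t * s)\<^sup>2 / 2))"
    by (simp add: char_std_normal_distribution real_distribution_distr)
  moreover have "char (distr M borel (\<lambda>w. (\<Sum>j<n. f (X j w)) / sqrt (real n * s\<^sup>2))) (t * s)
     = (\<integral>w. cis (t * ((1 / sqrt (real n)) * (\<Sum>j<n. f (X j w)))) \<partial>M)" for n
  proof -
    have "t * s * (S / sqrt (real n * s\<^sup>2)) = t * ((1 / sqrt (real n)) * S)" for S
      using s by (simp add: real_sqrt_mult)
    then show ?thesis
      unfolding char_def by (subst integral_distr) (simp_all add: cis_conv_exp)
  qed
  ultimately show ?thesis by simp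
qed

text \<open>The limit law, normal with standard deviation s, is realised as an image of the standard
  normal law, so that \<open>char_convergence_tight\<close> applies in dimension one.\<close>

lemma iid_sum_tight:
  fixes X :: "nat \<Rightarrow> 'w \<Rightarrow> real" and f :: "real \<Rightarrow> real"
  assumes M: "prob_space M" and indep: "prob_space.indep_vars M (\<lambda>_. borel) X UNIV"
    and distr: "\<And>j. distr M borel (X j) = \<mu>"
    and f [measurable]: "f \<in> borel_measurable borel" and bound: "\<And>x. \<bar>f x\<bar> \<le> B"
    and mean: "(\<integral>x. f x \<partial>\<mu>) = 0" and var: "(\<integral>x. (f x)\<^sup>2 \<partial>\<mu>) = s\<^sup>2" and s: "s > 0" and e: "e > 0"
  shows "\<exists>K>0. \<forall>\<^sub>F n in sequentially.
     measure M {w \<in> space M. K < \<bar>(1 / sqrt (real n)) * (\<Sum>j<n. f (X j w))\<bar>} \<le> e"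
proof -
  interpret prob_space M by (rule M)
  interpret N: real_distribution std_normal_distribution by (rule real_dist_normal_dist)
  have X [measurable]: "X j \<in> borel_measurable M" for j using indep by (auto simp: prob_space.indep_vars_def[OF M])
  let ?N = "distr std_normal_distribution borel (\<lambda>z. s * z)"
  have N: "prob_space ?N" by (intro N.prob_space_distr) simp
  have L: "(\<lambda>n. \<integral>w. cis (t \<bullet> ((1 / sqrt (real n)) * (\<Sum>j<n. f (X j w)))) \<partial>M) \<longlonglongrightarrow> (\<integral>z. cis (t \<bullet> z) \<partial>?N)" for t :: real
  proof -
    have "(\<integral>z. cis (t \<bullet> z) \<partial>?N) = char std_normal_distribution (t * s)"
      unfolding char_def by (subst integral_distr) (auto simp: cis_conv_exp mult.assoc intro!: borel_measurable_continuous_onI continuous_intros)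
    also have "\<dots> = of_real (exp (- (t * s)\<^sup>2 / 2))" by (simp add: char_std_normal_distribution)
    finally show ?thesis using iid_char_convergence[OF M indep distr f bound mean var s, of t] by simp
  qed
  have "\<exists>K>0. measure ?N {z. K < norm z} \<le> e \<and>
     (\<forall>\<^sub>F n in sequentially. measure M {w \<in> space M. K < norm ((1 / sqrt (real n)) * (\<Sum>j<n. f (X j w)))} \<le> e)"
  proof (rule char_convergence_tight[OF M _ N _ L e])
    show "random_variable borel (\<lambda>w. (1 / sqrt (real n)) * (\<Sum>j<n. f (X j w)))" for n by measurable
  qed simp
  then show ?thesis unfolding real_norm_def by blast
qed

text \<open>The norm is at most the sum of the moduli of the components, so beyond the sum of the
  component bounds some component exceeds its own bound.\<close>

lemma tight_components:
  fixes Z :: "nat \<Rightarrow> 'w \<Rightarrow> real ^ 'm::finite"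
  assumes "prob_space M" and [measurable]: "\<And>n. Z n \<in> borel_measurable M"
    and comp: "\<And>i e. e > 0 \<Longrightarrow> \<exists>K>0. \<forall>\<^sub>F n in sequentially. measure M {w \<in> space M. K < \<bar>Z n w $ i\<bar>} \<le> e"
    and e: "e > 0"
  shows "\<exists>K>0. \<forall>\<^sub>F n in sequentially. measure M {w \<in> space M. K < norm (Z n w)} \<le> e"
proof -
  interpret prob_space M by fact
  define d where "d = e / CARD('m)"
  have d: "d > 0" using e by (simp add: d_def)
  have [measurable]: "(\<lambda>w. Z n w $ i) \<in> borel_measurable M" for n i
    by (rule measurable_compose[OF assms(2)]) (intro borel_measurable_continuous_onI continuous_intros)
  have "\<forall>i. \<exists>K>0. \<forall>\<^sub>F n in sequentially. measure M {w \<in> space M. K < \<bar>Z n w $ i\<bar>} \<le> d"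
    using comp[OF d] by blast
  from choice[OF this] obtain K where K: "\<forall>i. 0 < K i \<and> (\<forall>\<^sub>F n in sequentially. measure M {w \<in> space M. K i < \<bar>Z n w $ i\<bar>} \<le> d)"
    by blast
  define L where "L = (\<Sum>i\<in>UNIV. K i)"
  have L: "L > 0" unfolding L_def using K by (intro sum_pos) auto
  have big: "\<exists>i. K i < \<bar>z $ i\<bar>" if "L < norm z" for z :: "real ^ 'm"
  proof (rule ccontr)
    assume "\<not> ?thesis"
    then have "(\<Sum>i\<in>UNIV. \<bar>z $ i\<bar>) \<le> L" unfolding L_def by (intro sum_mono) (auto simp: not_less)
    then show False using norm_le_l1_cart[of z] that by simp
  qed
  have "\<forall>\<^sub>F n in sequentially. \<forall>i\<in>UNIV. measure M {w \<in> space M. K i < \<bar>Z n w $ i\<bar>} \<le> d"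
    using K by (intro eventually_ball_finite) auto
  then have "\<forall>\<^sub>F n in sequentially. measure M {w \<in> space M. L < norm (Z n w)} \<le> e"
  proof eventually_elim
    case (elim n)
    have "measure M {w \<in> space M. L < norm (Z n w)} \<le> measure M (\<Union>i\<in>UNIV. {w \<in> space M. K i < \<bar>Z n w $ i\<bar>})"
      using big by (intro finite_measure_mono) auto
    also have "\<dots> \<le> (\<Sum>i\<in>UNIV. measure M {w \<in> space M. K i < \<bar>Z n w $ i\<bar>})"
      by (intro finite_measure_subadditive_finite) auto
    also have "\<dots> \<le> (\<Sum>i\<in>(UNIV::'m set). d)" using elim by (intro sum_mono) auto
    finally show ?case by (simp add: d_def)
  qed
  then show ?thesis using L by blast
qed

lemma norm_cis_diff: "norm (cis a - cis b) \<le> \<bar>a - b\<bar>"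
proof -
  have "cis a - cis b = cis b * (cis (a - b) - 1)" by (simp add: right_diff_distrib cis_mult)
  then have "norm (cis a - cis b) = norm (cis (a - b) - 1)" by (simp add: norm_mult)
  also have "\<dots> \<le> \<bar>a - b\<bar>" using iexp_approx1[of "a - b" 0] by (simp add: cis_conv_exp)
  finally show ?thesis .
qed

text \<open>Where the two variables are close, so are the integrands, as \<open>cis\<close> is
  Lipschitz; elsewhere they differ by at most 2, on an event of small probability.\<close>

lemma char_slutsky:
  fixes Y Z :: "nat \<Rightarrow> 'w \<Rightarrow> 'a::euclidean_space"
  assumes "prob_space M" and [measurable]: "\<And>n. Y n \<in> borel_measurable M" "\<And>n. Z n \<in> borel_measurable M"
    and diff: "tendsto_in_prob M (\<lambda>n w. Y n w - Z n w) 0"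
    and lim: "(\<lambda>n. \<integral>w. cis (t \<bullet> Z n w) \<partial>M) \<longlonglongrightarrow> L"
  shows "(\<lambda>n. \<integral>w. cis (t \<bullet> Y n w) \<partial>M) \<longlonglongrightarrow> L"
proof -
  interpret prob_space M by fact
  have int: "integrable M (\<lambda>w. cis (t \<bullet> Y n w))" "integrable M (\<lambda>w. cis (t \<bullet> Z n w))" for n
    by (rule integrable_const_bound[of _ 1]; simp)+
  have "(\<lambda>n. (\<integral>w. cis (t \<bullet> Y n w) \<partial>M) - (\<integral>w. cis (t \<bullet> Z n w) \<partial>M)) \<longlonglongrightarrow> 0"
  proof (rule tendsto_norm_zero_cancel, subst prob_tendsto_zero_iff[OF norm_ge_zero], intro allI impI)
    fix e :: real assume e: "e > 0"
    \<comment> \<open>The summand 1 covers \<open>t = 0\<close>. The close part contributes at most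
      e / 2 and the exceptional event, of probability below e / 4, at most twice that
      probability.\<close>
    define \<eta> where "\<eta> = e / (2 * (norm t + 1))"
    have \<eta>: "\<eta> > 0" using e by (simp add: \<eta>_def add_nonneg_pos)
    have "p * (e / (2 * p)) = e / 2" if "p > 0" for p :: real using that by simp
    note p = this[of "norm t + 1", OF add_nonneg_pos[OF norm_ge_zero zero_less_one]]
    have "norm t * \<eta> \<le> (norm t + 1) * \<eta>" using \<eta> by (intro mult_right_mono) auto
    also have "\<dots> = e / 2" unfolding \<eta>_def by (rule p)
    finally have t\<eta>: "norm t * \<eta> \<le> e / 2" .
    have "(\<lambda>n. measure M {w \<in> space M. \<eta> < dist (Y n w - Z n w) 0}) \<longlonglongrightarrow> 0"
      using diff \<eta> unfolding tendsto_in_prob_def by blast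
    then have "\<forall>\<^sub>F n in sequentially. measure M {w \<in> space M. \<eta> < dist (Y n w - Z n w) 0} < e / 4"
      using e by (intro order_tendstoD(2)) auto
    then show "\<forall>\<^sub>F n in sequentially. norm ((\<integral>w. cis (t \<bullet> Y n w) \<partial>M) - (\<integral>w. cis (t \<bullet> Z n w) \<partial>M)) \<le> e"
    proof eventually_elim
      case (elim n)
      have b: "norm (cis (t \<bullet> Y n w) - cis (t \<bullet> Z n w)) \<le> norm t * norm (Y n w - Z n w)" for w
        using norm_cis_diff[of "t \<bullet> Y n w" "t \<bullet> Z n w"] Cauchy_Schwarz_ineq2[of t "Y n w - Z n w"]
        by (simp add: inner_diff_right)
      have "norm ((\<integral>w. cis (t \<bullet> Y n w) \<partial>M) - (\<integral>w. cis (t \<bullet> Z n w) \<partial>M))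
         \<le> norm t * \<eta> + 2 * measure M {w \<in> space M. \<eta> < dist (Y n w - Z n w) 0}"
      proof (rule integral_diff_bound_tail[OF \<open>prob_space M\<close> int])
        show "norm (cis (t \<bullet> Y n w) - cis (t \<bullet> Z n w)) \<le> norm t * \<eta>"
          if "w \<in> space M" "w \<notin> {w \<in> space M. \<eta> < dist (Y n w - Z n w) 0}" for w
          using that by (intro order.trans[OF b] mult_left_mono) auto
        show "norm (cis (t \<bullet> Y n w) - cis (t \<bullet> Z n w)) \<le> 2" for w
          using norm_triangle_ineq4[of "cis (t \<bullet> Y n w)" "cis (t \<bullet> Z n w)"] by simp
      qed (use \<eta> in auto)
      then show ?case using t\<eta> elim by linarith
    qed
  qed
  from tendsto_add[OF this lim] show ?thesis by simp
qed

lemma trig_score_eq: "trig_score u x \<theta> = score_matrix u \<theta> *v (trig_vec u x - trig_mean u \<theta>)"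
  by (simp add: trig_score_def score_matrix_def)

lemma sum_trig_score:
  "(\<Sum>j<n. trig_score u (x j) \<theta>) = score_matrix u \<theta> *v (\<Sum>j<n. trig_vec u (x j) - trig_mean u \<theta>)"
  unfolding trig_score_eq by (simp add: linear_sum[OF matrix_vector_mul_linear])

definition trig_average :: "real ^ 'k \<Rightarrow> (nat \<Rightarrow> real) \<Rightarrow> nat \<Rightarrow> real ^ ('k::finite + 'k)" where
  "trig_average u x n = (1 / real n) *\<^sub>R (\<Sum>j<n. trig_vec u (x j))"

text \<open>For \<open>n = 0\<close> the left side is an empty sum, whereas the right side has
  \<open>trig_mean\<close> subtracted from the zero vector; hence the restriction on
  \<open>n\<close>.\<close>

lemma mean_score_eq:
  fixes u :: "real ^ 'k::finite"
  assumes "n > 0"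
  shows "mean_score u x n \<theta> = score_matrix u \<theta> *v (trig_average u x n - trig_mean u \<theta>)"
proof -
  have "trig_average u x n - trig_mean u \<theta> = (1 / real n) *\<^sub>R (\<Sum>j<n. trig_vec u (x j) - trig_mean u \<theta>)"
    using assms by (simp add: trig_average_def sum_subtractf scaleR_diff_right sum_constant_scaleR del: sum_constant)
  then show ?thesis
    unfolding mean_score_def sum_trig_score by (simp only: matrix_vector_mult_scaleR)
qed

lemma scaled_trig_average:
  fixes u :: "real ^ 'k::finite"
  shows "sqrt (real n) *\<^sub>R (trig_average u x n - m) = (1 / sqrt (real n)) *\<^sub>R (\<Sum>j<n. trig_vec u (x j) - m)"
proof (cases "n = 0")
  case False
  then have "sqrt (real n) * (1 / real n) = 1 / sqrt (real n)" "(1 / sqrt (real n)) * real n = sqrt (real n)"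
    by (simp_all add: real_div_sqrt divide_simps)
  then show ?thesis
    by (simp add: trig_average_def sum_subtractf scaleR_diff_right sum_constant_scaleR del: sum_constant)
qed simp


section \<open>Limit behaviour of moments and roots for the given sample\<close>

context
  fixes C :: "(real ^ 4) set" and \<theta>0 :: "real ^ 4" and u :: "real ^ 'k::finite"
    and M :: "'w measure" and X :: "nat \<Rightarrow> 'w \<Rightarrow> real"
  assumes C: "compact C" "C \<subseteq> stable_param_interior" and \<theta>0: "\<theta>0 \<in> interior C"
    and k: "CARD('k) \<ge> 2"
    and dist: "\<And>i j. i \<noteq> j \<Longrightarrow> \<bar>u $ i\<bar> \<noteq> \<bar>u $ j\<bar>" and nz: "\<And>i. u $ i \<noteq> 0"
    and M: "prob_space M" and indep: "prob_space.indep_vars M (\<lambda>_. borel) X UNIV"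
    and dens: "\<And>j. distributed M lborel (X j) (\<lambda>x. ennreal (stable_density \<theta>0 x))"
begin

interpretation M: prob_space M by (rule M)

lemma true_param: "\<theta>0 \<in> stable_param_interior"
  using C(2) \<theta>0 interior_subset by blast

lemma X_measurable [measurable]: "X j \<in> borel_measurable M"
  using distributed_measurable[OF dens, of j] by simp

lemma X_law: "distr M borel (X j) = stable_law \<theta>0"
proof -
  have "distr M borel (X j) = distr M lborel (X j)" by (rule distr_cong) simp_all
  then show ?thesis
    using distributed_distr_eq_density[OF dens] by (simp add: stable_law_def[OF true_param])
qed

text \<open>These are the properties that \<open>iid_char_convergence\<close> and
  \<open>iid_sum_tight\<close> ask of their summands.\<close>

lemma centred_linear_form:
  fixes c :: "real ^ ('k + 'k)"
  defines "f \<equiv> \<lambda>x. c \<bullet> (trig_vec u x - trig_mean u \<theta>0)"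
  assumes c: "c \<noteq> 0"
  shows "f \<in> borel_measurable borel" "\<exists>B. \<forall>x. \<bar>f x\<bar> \<le> B" "(\<integral>x. f x \<partial>stable_law \<theta>0) = 0"
    "(\<integral>x. (f x)\<^sup>2 \<partial>stable_law \<theta>0) = (sqrt (c \<bullet> (trig_cov u \<theta>0 *v c)))\<^sup>2" "sqrt (c \<bullet> (trig_cov u \<theta>0 *v c)) > 0"
proof -
  interpret S: real_distribution "stable_law \<theta>0" by (rule real_distribution_stable_law[OF true_param])
  show "f \<in> borel_measurable borel" unfolding f_def by measurable
  have "\<bar>f x\<bar> \<le> norm c * (real CARD('k + 'k) + norm (trig_mean u \<theta>0))" for x
    unfolding f_def
    by (intro order.trans[OF Cauchy_Schwarz_ineq2] mult_left_mono order.trans[OF norm_triangle_ineq4] add_mono norm_trig_vec_le) auto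
  then show "\<exists>B. \<forall>x. \<bar>f x\<bar> \<le> B" by blast
  have i: "integrable (stable_law \<theta>0) (trig_vec u)"
    by (intro stable_law_integrable_bounded[OF true_param _ norm_trig_vec_le]) auto
  then have "(\<integral>x. f x \<partial>stable_law \<theta>0) = c \<bullet> (\<integral>x. trig_vec u x - trig_mean u \<theta>0 \<partial>stable_law \<theta>0)"
    unfolding f_def by (intro integral_inner_right) auto
  also have "(\<integral>x. trig_vec u x - trig_mean u \<theta>0 \<partial>stable_law \<theta>0) = 0"
    using i S.prob_space by (simp add: trig_mean_def stable_expectation_law[OF true_param])
  finally show "(\<integral>x. f x \<partial>stable_law \<theta>0) = 0" by simp
  have pos: "c \<bullet> (trig_cov u \<theta>0 *v c) > 0"
    using pos_def_trig_cov[OF true_param dist nz] c by (simp add: pos_def_matrix_def)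
  then show "sqrt (c \<bullet> (trig_cov u \<theta>0 *v c)) > 0" by simp
  show "(\<integral>x. (f x)\<^sup>2 \<partial>stable_law \<theta>0) = (sqrt (c \<bullet> (trig_cov u \<theta>0 *v c)))\<^sup>2"
    using stable_expectation_score_square[OF true_param, of c u] pos
    unfolding f_def by (simp add: stable_expectation_law[OF true_param])
qed

abbreviation "avg \<equiv> \<lambda>n w. trig_average u (\<lambda>j. X j w) n"

lemma avg_measurable [measurable]: "avg n \<in> borel_measurable M"
  unfolding trig_average_def by measurable

lemma scaled_avg_inner:
  "c \<bullet> (sqrt (real n) *\<^sub>R (avg n w - trig_mean u \<theta>0))
     = (1 / sqrt (real n)) * (\<Sum>j<n. c \<bullet> (trig_vec u (X j w) - trig_mean u \<theta>0))"
  unfolding scaled_trig_average by (simp add: inner_sum_right)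

lemma avg_tight:
  assumes "e > 0"
  shows "\<exists>K>0. \<forall>\<^sub>F n in sequentially.
       measure M {w \<in> space M. K < norm (sqrt (real n) *\<^sub>R (avg n w - trig_mean u \<theta>0))} \<le> e"
proof (rule tight_components[OF M _ _ assms])
  show "M.random_variable borel (\<lambda>w. sqrt (real n) *\<^sub>R (avg n w - trig_mean u \<theta>0))" for n by measurable
  fix i :: "'k + 'k" and e :: real assume e: "e > 0"
  define c :: "real ^ ('k + 'k)" where "c = axis i 1"
  have "c \<noteq> 0" by (simp add: c_def axis_eq_0_iff)
  note f = centred_linear_form[OF this]
  obtain B where B: "\<And>x. \<bar>c \<bullet> (trig_vec u x - trig_mean u \<theta>0)\<bar> \<le> B" using f(2) by blast
  have "(sqrt (real n) *\<^sub>R (avg n w - trig_mean u \<theta>0)) $ i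
     = (1 / sqrt (real n)) * (\<Sum>j<n. c \<bullet> (trig_vec u (X j w) - trig_mean u \<theta>0))" for n w
    unfolding scaled_avg_inner[symmetric] by (simp add: c_def inner_axis')
  then show "\<exists>K>0. \<forall>\<^sub>F n in sequentially. measure M {w \<in> space M. K < \<bar>(sqrt (real n) *\<^sub>R (avg n w - trig_mean u \<theta>0)) $ i\<bar>} \<le> e"
    using iid_sum_tight[OF M indep X_law f(1) B f(3,4,5) e] by (simp only:)
qed

text \<open>The Cramer-Wold reduction to one-dimensional sums. The direction \<open>c = 0\<close> is
  separate because the central limit theorem requires positive variance.\<close>

lemma avg_char:
  fixes c :: "real ^ ('k + 'k)"
  shows "(\<lambda>n. \<integral>w. cis (c \<bullet> (sqrt (real n) *\<^sub>R (avg n w - trig_mean u \<theta>0))) \<partial>M)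
     \<longlonglongrightarrow> of_real (exp (- (c \<bullet> (trig_cov u \<theta>0 *v c)) / 2))"
proof (cases "c = 0")
  case True
  then show ?thesis by (simp add: M.prob_space)
next
  case False
  note f = centred_linear_form[OF this]
  obtain B where B: "\<And>x. \<bar>c \<bullet> (trig_vec u x - trig_mean u \<theta>0)\<bar> \<le> B" using f(2) by blast
  have "(sqrt (c \<bullet> (trig_cov u \<theta>0 *v c)))\<^sup>2 = c \<bullet> (trig_cov u \<theta>0 *v c)" using f(5) by simp
  then show ?thesis
    using iid_char_convergence[OF M indep X_law f(1) B f(3,4,5), of 1]
    unfolding scaled_avg_inner by simp
qed

interpretation Z: z_estimator "score_matrix u" "trig_mean u" C \<theta>0 "transpose (trig_mean_deriv u \<theta>0)"
  by (rule z_estimator_trig[OF C(2) \<theta>0 k dist nz])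

lemma mean_score_score: "n > 0 \<Longrightarrow> mean_score u x n \<theta> = Z.score \<theta> (trig_average u x n)"
  by (simp add: mean_score_eq Z.score_def)

lemma linear_term:
  "matrix_inv (trig_info u \<theta>0) *v ((1 / sqrt (real n)) *\<^sub>R (\<Sum>j<n. trig_score u (X j w) \<theta>0))
     = matrix_inv (trig_info u \<theta>0) *v (score_matrix u \<theta>0 *v (sqrt (real n) *\<^sub>R (avg n w - trig_mean u \<theta>0)))"
  unfolding sum_trig_score scaled_trig_average by (simp only: matrix_vector_mult_scaleR)

text \<open>With B the inverse information times the score matrix, the limit covariance B S B^T is
  the inverse information again, since the score has the information as its covariance.\<close>

lemma linear_term_char:
  "(\<lambda>n. \<integral>w. cis (t \<bullet> (matrix_inv (trig_info u \<theta>0) *v (score_matrix u \<theta>0 *v (sqrt (real n) *\<^sub>R (avg n w - trig_mean u \<theta>0))))) \<partial>M)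
     \<longlonglongrightarrow> of_real (exp (- (t \<bullet> (matrix_inv (trig_info u \<theta>0) *v t)) / 2))"
proof -
  let ?J = "trig_info u \<theta>0" and ?A = "score_matrix u \<theta>0" and ?S = "trig_cov u \<theta>0"
  define B where "B = matrix_inv ?J ** ?A"
  have J: "pos_def_matrix ?J" by (rule pos_def_trig_info[OF true_param k dist nz])
  have S: "pos_def_matrix ?S" by (rule pos_def_trig_cov[OF true_param dist nz])
  have Ji: "transpose (matrix_inv ?J) = matrix_inv ?J" using pos_def_matrix_inv[OF J] by (simp add: pos_def_matrix_def)
  have "B ** (?S ** transpose B) = matrix_inv ?J ** (?A ** (?S ** transpose ?A)) ** transpose (matrix_inv ?J)"
    by (simp add: B_def matrix_transpose_mul matrix_mul_assoc)
  also have "\<dots> = matrix_inv ?J"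
    unfolding score_matrix_cov[OF S] Ji
    by (simp add: matrix_inv_mult[OF pos_def_invertible[OF J]])
  finally have BSB: "B ** (?S ** transpose B) = matrix_inv ?J" .
  have "(transpose B *v t) \<bullet> (?S *v (transpose B *v t)) = t \<bullet> (matrix_inv ?J *v t)"
    unfolding BSB[symmetric] by (simp only: matrix_vector_mul_assoc[symmetric] inner_matrix_vector_transpose[of t B])
  moreover have "t \<bullet> (matrix_inv ?J *v (?A *v z)) = (transpose B *v t) \<bullet> z" for z
    by (simp only: B_def matrix_vector_mul_assoc inner_matrix_vector_transpose[of t])
  ultimately show ?thesis using avg_char[of "transpose B *v t"] by simp
qed

lemma roots_exist:
  "(\<lambda>n. measure M {w \<in> space M. \<exists>\<theta>\<in>C. mean_score u (\<lambda>j. X j w) n \<theta> = 0}) \<longlonglongrightarrow> 1"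
proof (rule Lim_transform_eventually[OF Z.root_probability[OF M C(1) avg_measurable avg_tight]])
  show "\<forall>\<^sub>F n in sequentially. measure M {w \<in> space M. \<exists>\<theta>\<in>C. Z.score \<theta> (avg n w) = 0}
      = measure M {w \<in> space M. \<exists>\<theta>\<in>C. mean_score u (\<lambda>j. X j w) n \<theta> = 0}"
    using eventually_gt_at_top[of 0] by eventually_elim (simp add: mean_score_score)
qed

lemma consistent_roots:
  "\<exists>T :: nat \<Rightarrow> 'w \<Rightarrow> real ^ 4.
        (\<forall>n. T n \<in> borel_measurable M) \<and>
        (\<forall>n. \<forall>\<omega>\<in>space M. (\<exists>\<theta>\<in>C. mean_score u (\<lambda>j. X j \<omega>) n \<theta> = 0) \<longrightarrow>
           T n \<omega> \<in> C \<and> mean_score u (\<lambda>j. X j \<omega>) n (T n \<omega>) = 0) \<and>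
        tendsto_in_prob M T \<theta>0"
proof -
  obtain T where T: "\<forall>n. T n \<in> borel_measurable M"
    "\<forall>n. \<forall>w\<in>space M. (\<exists>\<theta>\<in>C. Z.score \<theta> (avg n w) = 0) \<longrightarrow> T n w \<in> C \<and> Z.score (T n w) (avg n w) = 0"
    "tendsto_in_prob M T \<theta>0"
    using Z.consistent_root_sequence[OF M C(1) avg_measurable avg_tight] by blast
  \<comment> \<open>For \<open>n = 0\<close> the mean score vanishes identically, so every point of
    \<open>C\<close> is a root, whereas \<open>T 0\<close> was selected for the equation with the
    zero vector as average. A single index does not influence convergence.\<close>
  define T' where "T' n = (if n = 0 then (\<lambda>_. \<theta>0) else T n)" for n
  have "T' n \<in> borel_measurable M" for n using T(1) by (simp add: T'_def)
  moreover have "T' n w \<in> C \<and> mean_score u (\<lambda>j. X j w) n (T' n w) = 0"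
    if "w \<in> space M" "\<exists>\<theta>\<in>C. mean_score u (\<lambda>j. X j w) n \<theta> = 0" for n w
  proof (cases "n = 0")
    case True
    then show ?thesis using Z.\<theta>0_in by (simp add: T'_def mean_score_def)
  next
    case False
    then show ?thesis using T(2) that by (simp add: T'_def mean_score_score)
  qed
  moreover have "tendsto_in_prob M T' \<theta>0"
    unfolding tendsto_in_prob_def
  proof (intro allI impI)
    fix \<epsilon> :: real assume "\<epsilon> > 0"
    then have "(\<lambda>n. measure M {\<omega> \<in> space M. \<epsilon> < dist (T n \<omega>) \<theta>0}) \<longlonglongrightarrow> 0"
      using T(3) by (simp add: tendsto_in_prob_def)
    then show "(\<lambda>n. measure M {\<omega> \<in> space M. \<epsilon> < dist (T' n \<omega>) \<theta>0}) \<longlonglongrightarrow> 0"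
      by (rule Lim_transform_eventually) (use eventually_gt_at_top[of 0] in eventually_elim, simp add: T'_def)
  qed
  ultimately show ?thesis by (intro exI[of _ T']) blast
qed

text \<open>The abstract linearisation yields the expansion; the characteristic functions of the
  linear term then pass to the roots through \<open>char_slutsky\<close>, and their limit is that of
  \<open>mv_normal\<close>.\<close>

lemma root_sequence_asymptotics:
  fixes T :: "nat \<Rightarrow> 'w \<Rightarrow> real ^ 4"
  assumes Tm: "\<And>n. T n \<in> borel_measurable M"
    and root: "(\<lambda>n. measure M {w \<in> space M. T n w \<in> C \<and> mean_score u (\<lambda>j. X j w) n (T n w) = 0}) \<longlonglongrightarrow> 1"
    and cons: "tendsto_in_prob M T \<theta>0"
  shows "tendsto_in_prob M
            (\<lambda>n w. sqrt (real n) *\<^sub>R (T n w - \<theta>0)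
               - matrix_inv (trig_info u \<theta>0) *v ((1 / sqrt (real n)) *\<^sub>R (\<Sum>j<n. trig_score u (X j w) \<theta>0))) 0"
    and "tendsto_in_distribution M (\<lambda>n w. sqrt (real n) *\<^sub>R (T n w - \<theta>0)) (mv_normal 0 (matrix_inv (trig_info u \<theta>0)))"
proof -
  have [measurable]: "T n \<in> borel_measurable M" for n by (rule Tm)
  have mv [measurable]: "(\<lambda>x. B *v x) \<in> borel_measurable borel" for B :: "real ^ 'a::finite ^ 'b::finite"
    by (intro borel_measurable_continuous_onI continuous_intros)
  have "(\<lambda>n. measure M {w \<in> space M. T n w \<in> C \<and> Z.score (T n w) (avg n w) = 0}) \<longlonglongrightarrow> 1"
    by (rule Lim_transform_eventually[OF root])
       (use eventually_gt_at_top[of 0] in eventually_elim, simp add: mean_score_score)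
  from Z.root_sequence_linearization[OF M C(1) avg_measurable avg_tight Tm this cons]
  have lin: "tendsto_in_prob M (\<lambda>n w. sqrt (real n) *\<^sub>R (T n w - \<theta>0) -
      matrix_inv (trig_info u \<theta>0) *v (score_matrix u \<theta>0 *v (sqrt (real n) *\<^sub>R (avg n w - trig_mean u \<theta>0)))) 0"
    unfolding trig_info_eq .
  then show "tendsto_in_prob M
            (\<lambda>n w. sqrt (real n) *\<^sub>R (T n w - \<theta>0)
               - matrix_inv (trig_info u \<theta>0) *v ((1 / sqrt (real n)) *\<^sub>R (\<Sum>j<n. trig_score u (X j w) \<theta>0))) 0"
    unfolding linear_term .
  have "pos_def_matrix (trig_info u \<theta>0)" by (rule pos_def_trig_info[OF true_param k dist nz])
  note N = mv_normal_char[OF this]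
  show "tendsto_in_distribution M (\<lambda>n w. sqrt (real n) *\<^sub>R (T n w - \<theta>0)) (mv_normal 0 (matrix_inv (trig_info u \<theta>0)))"
  proof (rule char_convergence_imp_tendsto_in_distribution[OF M _ N(1,2)])
    show "(\<lambda>n. \<integral>w. cis (t \<bullet> (sqrt (real n) *\<^sub>R (T n w - \<theta>0))) \<partial>M)
       \<longlonglongrightarrow> (\<integral>z. cis (t \<bullet> z) \<partial>mv_normal 0 (matrix_inv (trig_info u \<theta>0)))" for t
      unfolding N(3) by (rule char_slutsky[OF M _ _ lin linear_term_char]; measurable)
  qed measurable
qed

end

text \<open>Invertibility is part of the conclusion because \<open>matrix_inv\<close> has its
  meaning for invertible matrices only. The equation may lack a root for some samples, so a sequence
  of roots is one that solves it with probability tending to 1; the constructed sequence solves it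
  whenever a root in \<open>C\<close> exists.\<close>

theorem theorem3p1:
  fixes C :: "(real ^ 4) set"
    and \<theta>0 :: "real ^ 4"
    and u :: "real ^ 'k::finite"
    and M :: "'w measure"
    and X :: "nat \<Rightarrow> 'w \<Rightarrow> real"
  assumes C: "compact C" "C \<subseteq> stable_param_interior"
    and \<theta>0: "\<theta>0 \<in> interior C"
    and k: "CARD('k) \<ge> 2"
    and u_abs_distinct: "\<And>i j. i \<noteq> j \<Longrightarrow> \<bar>u $ i\<bar> \<noteq> \<bar>u $ j\<bar>"
    and u_nonzero: "\<And>i. u $ i \<noteq> 0"
    and M: "prob_space M"
    and X_indep: "prob_space.indep_vars M (\<lambda>_. borel) X UNIV"
    and X_density: "\<And>j. distributed M lborel (X j) (\<lambda>x. ennreal (stable_density \<theta>0 x))"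
  shows
    "(\<forall>\<theta>\<in>C. invertible (trig_cov u \<theta>)) \<and> invertible (trig_info u \<theta>0) \<and>
     (\<lambda>n. measure M {\<omega> \<in> space M. \<exists>\<theta>\<in>C. mean_score u (\<lambda>j. X j \<omega>) n \<theta> = 0}) \<longlonglongrightarrow> 1 \<and>
     (\<exists>T :: nat \<Rightarrow> 'w \<Rightarrow> real ^ 4.
        (\<forall>n. T n \<in> borel_measurable M) \<and>
        (\<forall>n. \<forall>\<omega>\<in>space M. (\<exists>\<theta>\<in>C. mean_score u (\<lambda>j. X j \<omega>) n \<theta> = 0) \<longrightarrow>
           T n \<omega> \<in> C \<and> mean_score u (\<lambda>j. X j \<omega>) n (T n \<omega>) = 0) \<and>
        tendsto_in_prob M T \<theta>0) \<and>
     (\<forall>T :: nat \<Rightarrow> 'w \<Rightarrow> real ^ 4.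
        (\<forall>n. T n \<in> borel_measurable M) \<and>
        (\<lambda>n. measure M {\<omega> \<in> space M. T n \<omega> \<in> C \<and> mean_score u (\<lambda>j. X j \<omega>) n (T n \<omega>) = 0})
          \<longlonglongrightarrow> 1 \<and>
        tendsto_in_prob M T \<theta>0 \<longrightarrow>
          tendsto_in_prob M
            (\<lambda>n \<omega>. sqrt (real n) *\<^sub>R (T n \<omega> - \<theta>0)
               - matrix_inv (trig_info u \<theta>0) *v
                   ((1 / sqrt (real n)) *\<^sub>R (\<Sum>j<n. trig_score u (X j \<omega>) \<theta>0)))
            0 \<and>
          tendsto_in_distribution M
            (\<lambda>n \<omega>. sqrt (real n) *\<^sub>R (T n \<omega> - \<theta>0))
            (mv_normal 0 (matrix_inv (trig_info u \<theta>0))))"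
proof (intro conjI ballI allI impI)
  show "invertible (trig_cov u \<theta>)" if "\<theta> \<in> C" for \<theta>
    using C(2) that by (intro pos_def_invertible pos_def_trig_cov u_abs_distinct u_nonzero) auto
  have "\<theta>0 \<in> stable_param_interior" using C(2) \<theta>0 interior_subset by blast
  then show "invertible (trig_info u \<theta>0)"
    by (intro pos_def_invertible pos_def_trig_info k u_abs_distinct u_nonzero)
qed (use roots_exist[OF assms] consistent_roots[OF assms] root_sequence_asymptotics[OF assms] in blast)+

end
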